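(* Let $(\mathcal{A}, \mathbb{E}, \mathbb{F}, \varepsilon)$ be a $\mathcal{B}$-$\mathcal{B}$-non-commutative probability space with a pair of $(\mathcal{B}, \mathcal{D})$-valued expectations. If $\{(\mathcal{A}_{k, \ell}, \mathcal{A}_{k, r})\}_{k \in K}$ is a family of pairs of $\mathcal{B}$-algebras in $(\mathcal{A}, \mathbb{E}, \mathbb{F}, \varepsilon)$ such that (1) $\mathcal{A}_{m, \ell}$ and $\mathcal{A}_{n, r}$ commute for all $m, n \in K$, (2) for every $k\in K$ and $Y \in \mathcal{A}_{k, r}$, there exists an $X \in \mathcal{A}_{k, \ell}$ such that $\mathbb{E}(ZY) = \mathbb{E}(ZX)$ and $\mathbb{F}(ZY) = \mathbb{F}(ZX)$ for all $Z \in \mathcal{A}$, then $\{(\mathcal{A}_{k, \ell}, \mathcal{A}_{k, r})\}_{k \in K}$ is c-bi-free over $(\mathcal{B}, \mathcal{D})$ if and only if $\{\mathcal{A}_{k, \ell}\}_{k \in K}$ is c-free over $(\mathcal{B}, \mathcal{D})$. Consequently, if $\{\mathcal{A}_{k, \ell}\}_{k \in K}$ is c-free over $(\mathcal{B}, \mathcal{D})$, then $\{\mathcal{A}_{k, r}\}_{k \in K}$ is c-free over $(\mathcal{B}, \mathcal{D})$.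
   Context: All algebras are over $\mathbb{C}$. Spaces. A $\mathcal{B}$-$\mathcal{B}$-non-commutative probability space with a pair of $(\mathcal{B},\mathcal{D})$-valued expectations is a quadruple $(\mathcal{A},\mathbb{E},\mathbb{F},\varepsilon)$ where $\mathcal{A},\mathcal{B},\mathcal{D}$ are unital algebras with $1:=1_{\mathcal{D}}\in\mathcal{B}\subset\mathcal{D}$, $\varepsilon:\mathcal{B}\otimes\mathcal{B}^{\mathrm{op}}\to\mathcal{A}$ is a unital homomorphism whose restrictions to $\mathcal{B}\otimes 1$ and $1\otimes\mathcal{B}^{\mathrm{op}}$ are injective, and $\mathbb{E}:\mathcal{A}\to\mathcal{B}$, $\mathbb{F}:\mathcal{A}\to\mathcal{D}$ are unital linear maps such that, writing $L_b=\varepsilon(b\otimes 1)$ and $R_b=\varepsilon(1\otimes b)$, for all $b_1,b_2,b\in\mathcal{B}$ and $Z\in\mathcal{A}$: $\mathbb{E}(L_{b_1}R_{b_2}Z)=b_1\mathbb{E}(Z)b_2$, $\mathbb{E}(ZL_b)=\mathbb{E}(ZR_b)$, $\mathbb{F}(L_{b_1}R_{b_2}Z)=b_1\mathbb{F}(Z)b_2$, $\mathbb{F}(ZL_b)=\mathbb{F}(ZR_b)$. Set $\mathcal{A}_\ell=\{Z\in\mathcal{A}: ZR_b=R_bZ\ \forall b\in\mathcal{B}\}$ and $\mathcal{A}_r=\{Z\in\mathcal{A}: ZL_b=L_bZ\ \forall b\in\mathcal{B}\}$. A pair of $\mathcal{B}$-algebras is a pair $(\mathcal{C}_\ell,\mathcal{C}_r)$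 of unital subalgebras of $\mathcal{A}$ with $\varepsilon(\mathcal{B}\otimes1)\subset\mathcal{C}_\ell\subset\mathcal{A}_\ell$ and $\varepsilon(1\otimes\mathcal{B}^{\mathrm{op}})\subset\mathcal{C}_r\subset\mathcal{A}_r$. C-free independence with amalgamation. $\{\mathcal{A}_{k,\ell}\}_{k\in K}$ is c-free over $(\mathcal{B},\mathcal{D})$ if $\mathbb{E}(X_1\cdots X_n)=0$ and $\mathbb{F}(X_1\cdots X_n)=\mathbb{F}(X_1)\cdots\mathbb{F}(X_n)$ whenever $n\ge1$, $X_i\in\mathcal{A}_{k_i,\ell}$, $\mathbb{E}(X_i)=0$ for all $i$, and $k_1\ne k_2\ne\cdots\ne k_n$. For right algebras (where $b\mapsto R_b$ is an anti-homomorphism) the order is reversed: $\{\mathcal{A}_{k,r}\}_{k\in K}$ is c-free over $(\mathcal{B},\mathcal{D})$ if $\mathbb{E}(Y_1\cdots Y_n)=0$ and $\mathbb{F}(Y_1\cdots Y_n)=\mathbb{F}(Y_n)\cdots\mathbb{F}(Y_1)$ whenever $Y_i\in\mathcal{A}_{k_i,r}$, $\mathbb{E}(Y_i)=0$, and $k_1\ne k_2\ne\cdots\ne k_n$. C-bi-free independence. A $\mathcal{B}$-$\mathcal{B}$-bimodule with a pair of specified $(\mathcal{B},\mathcal{D})$-valued states is $(\mathcal{X},\mathcal{X}^\circ,\mathfrak{p},\mathfrak{q})$ with $\mathcal{X}=\mathcal{B}\oplus\mathcal{X}^\circ$ a direct sum of $\mathcal{B}$-$\mathcal{B}$-bimodules,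 $\mathfrak{p}(b\oplus\eta)=b$, and $\mathfrak{q}:\mathcal{X}\to\mathcal{D}$ a linear $\mathcal{B}$-$\mathcal{B}$-bimodule map with $\mathfrak{q}(1\oplus0)=1$. On the linear operators $\mathcal{L}(\mathcal{X})$ put $L_b(x)=b\cdot x$, $R_b(x)=x\cdot b$, $\mathcal{L}_\ell(\mathcal{X})=\{Z:ZR_b=R_bZ\ \forall b\}$, $\mathcal{L}_r(\mathcal{X})=\{Z:ZL_b=L_bZ\ \forall b\}$, $\mathbb{E}_{\mathcal{L}(\mathcal{X})}(Z)=\mathfrak{p}(Z(1\oplus0))$, $\mathbb{F}_{\mathcal{L}(\mathcal{X})}(Z)=\mathfrak{q}(Z(1\oplus0))$. The c-free product over $(\mathcal{B},\mathcal{D})$ of $\{(\mathcal{X}_k,\mathcal{X}_k^\circ,\mathfrak{p}_k,\mathfrak{q}_k)\}_{k\in K}$ is $(\mathcal{X},\mathcal{X}^\circ,\mathfrak{p},\mathfrak{q})$ with $\mathcal{X}=\mathcal{B}\oplus\mathcal{X}^\circ$, $\mathcal{X}^\circ=\bigoplus_{n\ge1}\bigoplus_{k_1\ne k_2\neq\cdots\ne k_n}\mathcal{X}_{k_1}^\circ\otimes_{\mathcal{B}}\cdots\otimes_{\mathcal{B}}\mathcal{X}_{k_n}^\circ$ (left action on the first, right action on the last tensor factor), $\mathfrak{p}(b\oplus\eta)=b$, $\mathfrak{q}(1\oplus0)=1$ and $\mathfrak{q}(x_1\otimes\cdots\otimes x_n)=\mathfrak{q}_{k_1}(x_1)\cdots\mathfrak{q}_{k_n}(x_n)$.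 The left representation $\lambda_k:\mathcal{L}_\ell(\mathcal{X}_k)\to\mathcal{L}(\mathcal{X})$ is $Z\mapsto V_k^{-1}(Z\otimes I)V_k$, where $V_k$ is the standard isomorphism of $\mathcal{X}$ with $\mathcal{X}_k\otimes_{\mathcal{B}}(\mathcal{B}\oplus\bigoplus_{n\ge1}\bigoplus_{k_1\ne\cdots\ne k_n,\,k_1\ne k}\mathcal{X}_{k_1}^\circ\otimes_{\mathcal{B}}\cdots\otimes_{\mathcal{B}}\mathcal{X}_{k_n}^\circ)$; the right representation $\rho_k:\mathcal{L}_r(\mathcal{X}_k)\to\mathcal{L}(\mathcal{X})$ is $Z\mapsto W_k^{-1}(I\otimes Z)W_k$, where $W_k$ is the standard isomorphism of $\mathcal{X}$ with $(\mathcal{B}\oplus\bigoplus_{n\ge1}\bigoplus_{k_1\ne\cdots\ne k_n,\,k_n\ne k}\mathcal{X}_{k_1}^\circ\otimes_{\mathcal{B}}\cdots\otimes_{\mathcal{B}}\mathcal{X}_{k_n}^\circ)\otimes_{\mathcal{B}}\mathcal{X}_k$. A family $\{(\mathcal{A}_{k,\ell},\mathcal{A}_{k,r})\}_{k\in K}$ of pairs of $\mathcal{B}$-algebras in $(\mathcal{A},\mathbb{E},\mathbb{F},\varepsilon)$ is c-bi-free over $(\mathcal{B},\mathcal{D})$ if there are $\mathcal{B}$-$\mathcal{B}$-bimodules with pairs of specified $(\mathcal{B},\mathcal{D})$-valued states $(\mathcal{X}_k,\mathcal{X}_k^\circ,\mathfrak{p}_k,\mathfrak{q}_k)$ and unital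 homomorphisms $\ell_k:\mathcal{A}_{k,\ell}\to\mathcal{L}_\ell(\mathcal{X}_k)$, $r_k:\mathcal{A}_{k,r}\to\mathcal{L}_r(\mathcal{X}_k)$ such that, with $\mathcal{X}$ the c-free product, the joint distribution of $\{(\mathcal{A}_{k,\ell},\mathcal{A}_{k,r})\}_{k\in K}$ with respect to $(\mathbb{E},\mathbb{F})$ equals that of $\{(\lambda_k\circ\ell_k(\mathcal{A}_{k,\ell}),\rho_k\circ r_k(\mathcal{A}_{k,r}))\}_{k\in K}$ with respect to $(\mathbb{E}_{\mathcal{L}(\mathcal{X})},\mathbb{F}_{\mathcal{L}(\mathcal{X})})$; i.e. for all products $Z_1\cdots Z_n$ of elements $Z_i\in\mathcal{A}_{\omega(i),\chi(i)}$, $\mathbb{E}$ and $\mathbb{F}$ of the product equal $\mathbb{E}_{\mathcal{L}(\mathcal{X})}$ and $\mathbb{F}_{\mathcal{L}(\mathcal{X})}$ of the product of the images. *)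

theory Defs
  imports Complex_Main "HOL-Algebra.Free_Abelian_Groups" "HOL-Algebra.Ring"
begin

section \<open>Unital complex algebras\<close>

text \<open>The zero algebra is not excluded (hence \<open>ring\<close> and \<open>monoid_mult\<close> instead of \<open>ring_1\<close>).\<close>

class complex_algebra_1 = ring + monoid_mult +
  fixes scaleC :: "complex \<Rightarrow> 'a \<Rightarrow> 'a" (infixr \<open>*\<^sub>C\<close> 75)
  assumes scaleC_add_right: "c *\<^sub>C (x + y) = c *\<^sub>C x + c *\<^sub>C y"
    and scaleC_add_left: "(c + d) *\<^sub>C x = c *\<^sub>C x + d *\<^sub>C x"
    and scaleC_scaleC: "c *\<^sub>C d *\<^sub>C x = (c * d) *\<^sub>C x"
    and scaleC_one: "1 *\<^sub>C x = x"
    and mult_scaleC_left: "(c *\<^sub>C x) * y = c *\<^sub>C (x * y)"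
    and mult_scaleC_right: "x * (c *\<^sub>C y) = c *\<^sub>C (x * y)"

interpretation complex_vector:
  vector_space "scaleC :: complex \<Rightarrow> 'a \<Rightarrow> 'a::complex_algebra_1"
  by unfold_locales
    (simp_all add: scaleC_add_right scaleC_add_left scaleC_scaleC scaleC_one)

definition unital_subalgebra :: "'a::complex_algebra_1 set \<Rightarrow> bool" where
  "unital_subalgebra S \<longleftrightarrow>
     complex_vector.subspace S \<and> 1 \<in> S \<and> (\<forall>x\<in>S. \<forall>y\<in>S. x * y \<in> S)"


section \<open>Spaces with a pair of expectations\<close>

text \<open>
  The algebras \<open>\<A>\<close> and \<open>\<D>\<close> are the types \<open>'a\<close> and \<open>'d\<close>, and \<open>B\<close> is a unital subalgebra of \<open>'d\<close>.
  The homomorphism from the algebra tensor product of \<open>B\<close> and its opposite is given by its values on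
  elementary tensors: \<open>eps b c\<close> stands for \<open>\<epsilon>(b \<otimes> c)\<close>.  Linear maps on the tensor product
  are the same as bilinear maps, and multiplicativity on elementary tensors reads
  \<open>\<epsilon>((b \<otimes> c)(b' \<otimes> c')) = \<epsilon>(b b' \<otimes> c' c)\<close>.
  So \<open>eps b 1\<close> is \<open>L\<^sub>b\<close> and \<open>eps 1 b\<close> is \<open>R\<^sub>b\<close>.
\<close>

locale two_expectation_space =
  fixes B :: "'d::complex_algebra_1 set"
    and eps :: "'d \<Rightarrow> 'd \<Rightarrow> 'a::complex_algebra_1"
    and E F :: "'a \<Rightarrow> 'd"
  assumes B_subalgebra: "unital_subalgebra B"
    and eps_add_left: "\<And>b b' c. \<lbrakk>b \<in> B; b' \<in> B; c \<in> B\<rbrakk> \<Longrightarrow> eps (b + b') c = eps b c + eps b' c"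
    and eps_add_right: "\<And>b c c'. \<lbrakk>b \<in> B; c \<in> B; c' \<in> B\<rbrakk> \<Longrightarrow> eps b (c + c') = eps b c + eps b c'"
    and eps_scale_left: "\<And>z b c. \<lbrakk>b \<in> B; c \<in> B\<rbrakk> \<Longrightarrow> eps (z *\<^sub>C b) c = z *\<^sub>C eps b c"
    and eps_scale_right: "\<And>z b c. \<lbrakk>b \<in> B; c \<in> B\<rbrakk> \<Longrightarrow> eps b (z *\<^sub>C c) = z *\<^sub>C eps b c"
    and eps_mult: "\<And>b b' c c'. \<lbrakk>b \<in> B; b' \<in> B; c \<in> B; c' \<in> B\<rbrakk> \<Longrightarrow>
                     eps b c * eps b' c' = eps (b * b') (c' * c)"
    and eps_one: "eps 1 1 = 1"
    and inj_left: "inj_on (\<lambda>b. eps b 1) B"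
    and inj_right: "inj_on (\<lambda>b. eps 1 b) B"
    and E_range: "\<And>Z. E Z \<in> B"
    and E_linear: "Vector_Spaces.linear scaleC scaleC E"
    and E_one: "E 1 = 1"
    and E_bimodule: "\<And>b b' Z. \<lbrakk>b \<in> B; b' \<in> B\<rbrakk> \<Longrightarrow> E (eps b 1 * eps 1 b' * Z) = b * E Z * b'"
    and E_balanced: "\<And>b Z. b \<in> B \<Longrightarrow> E (Z * eps b 1) = E (Z * eps 1 b)"
    and F_linear: "Vector_Spaces.linear scaleC scaleC F"
    and F_one: "F 1 = 1"
    and F_bimodule: "\<And>b b' Z. \<lbrakk>b \<in> B; b' \<in> B\<rbrakk> \<Longrightarrow> F (eps b 1 * eps 1 b' * Z) = b * F Z * b'"
    and F_balanced: "\<And>b Z. b \<in> B \<Longrightarrow> F (Z * eps b 1) = F (Z * eps 1 b)"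

definition left_algebra ::
  "'d::complex_algebra_1 set \<Rightarrow> ('d \<Rightarrow> 'd \<Rightarrow> 'a::complex_algebra_1) \<Rightarrow> 'a set" where
  "left_algebra B eps = {Z. \<forall>b\<in>B. Z * eps 1 b = eps 1 b * Z}"

definition right_algebra ::
  "'d::complex_algebra_1 set \<Rightarrow> ('d \<Rightarrow> 'd \<Rightarrow> 'a::complex_algebra_1) \<Rightarrow> 'a set" where
  "right_algebra B eps = {Z. \<forall>b\<in>B. Z * eps b 1 = eps b 1 * Z}"

definition pair_of_B_algebras ::
  "'d::complex_algebra_1 set \<Rightarrow> ('d \<Rightarrow> 'd \<Rightarrow> 'a::complex_algebra_1) \<Rightarrow> 'a set \<Rightarrow> 'a set \<Rightarrow> bool" where
  "pair_of_B_algebras B eps Cl Cr \<longleftrightarrow>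
     unital_subalgebra Cl \<and> unital_subalgebra Cr \<and>
     (\<lambda>b. eps b 1) ` B \<subseteq> Cl \<and> Cl \<subseteq> left_algebra B eps \<and>
     (\<lambda>b. eps 1 b) ` B \<subseteq> Cr \<and> Cr \<subseteq> right_algebra B eps"


section \<open>C-free independence with amalgamation\<close>

definition centred_alternating ::
  "('a \<Rightarrow> 'd::zero) \<Rightarrow> 'k set \<Rightarrow> ('k \<Rightarrow> 'a set) \<Rightarrow> ('k \<times> 'a) list \<Rightarrow> bool" where
  "centred_alternating E K A Xs \<longleftrightarrow>
     Xs \<noteq> [] \<and> distinct_adj (map fst Xs) \<and> (\<forall>(k, X)\<in>set Xs. k \<in> K \<and> X \<in> A k \<and> E X = 0)"

definition c_free_left ::
  "('a::monoid_mult \<Rightarrow> 'd::complex_algebra_1) \<Rightarrow> ('a \<Rightarrow> 'd) \<Rightarrow> 'k set \<Rightarrow> ('k \<Rightarrow> 'a set) \<Rightarrow> bool" where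
  "c_free_left E F K A \<longleftrightarrow>
     (\<forall>Xs. centred_alternating E K A Xs \<longrightarrow>
        E (prod_list (map snd Xs)) = 0 \<and>
        F (prod_list (map snd Xs)) = prod_list (map (\<lambda>(k, X). F X) Xs))"

definition c_free_right ::
  "('a::monoid_mult \<Rightarrow> 'd::complex_algebra_1) \<Rightarrow> ('a \<Rightarrow> 'd) \<Rightarrow> 'k set \<Rightarrow> ('k \<Rightarrow> 'a set) \<Rightarrow> bool" where
  "c_free_right E F K A \<longleftrightarrow>
     (\<forall>Ys. centred_alternating E K A Ys \<longrightarrow>
        E (prod_list (map snd Ys)) = 0 \<and>
        F (prod_list (map snd Ys)) = prod_list (rev (map (\<lambda>(k, Y). F Y) Ys)))"


section \<open>Bimodules\<close>

text \<open>
  As for \<open>module\<close> in HOL-Algebra, the record extends \<open>ring\<close>, of which only the additive part is used.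
  The actions of \<open>B\<close> are unital, so the complex scalar \<open>z\<close> necessarily acts as \<open>z *\<^sub>C 1 \<in> B\<close>; the
  compatibility of the bimodule with the vector space structure says that \<open>z *\<^sub>C 1\<close> acts in
  the same way on both sides.
\<close>

record ('d, 'x) bimod = "'x ring" +
  lact :: "'d \<Rightarrow> 'x \<Rightarrow> 'x"
  ract :: "'x \<Rightarrow> 'd \<Rightarrow> 'x"

definition bimodule :: "'d::complex_algebra_1 set \<Rightarrow> ('d, 'x) bimod \<Rightarrow> bool" where
  "bimodule B M \<longleftrightarrow> abelian_group M \<and>
     (\<forall>b\<in>B. \<forall>x\<in>carrier M. lact M b x \<in> carrier M \<and> ract M x b \<in> carrier M) \<and>
     (\<forall>b\<in>B. \<forall>x\<in>carrier M. \<forall>y\<in>carrier M.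
        lact M b (x \<oplus>\<^bsub>M\<^esub> y) = lact M b x \<oplus>\<^bsub>M\<^esub> lact M b y \<and>
        ract M (x \<oplus>\<^bsub>M\<^esub> y) b = ract M x b \<oplus>\<^bsub>M\<^esub> ract M y b) \<and>
     (\<forall>b\<in>B. \<forall>c\<in>B. \<forall>x\<in>carrier M.
        lact M (b + c) x = lact M b x \<oplus>\<^bsub>M\<^esub> lact M c x \<and>
        ract M x (b + c) = ract M x b \<oplus>\<^bsub>M\<^esub> ract M x c \<and>
        lact M (b * c) x = lact M b (lact M c x) \<and>
        ract M x (b * c) = ract M (ract M x b) c \<and>
        ract M (lact M b x) c = lact M b (ract M x c)) \<and>
     (\<forall>x\<in>carrier M. lact M 1 x = x \<and> ract M x 1 = x) \<and>
     (\<forall>z. \<forall>x\<in>carrier M. lact M (z *\<^sub>C 1) x = ract M x (z *\<^sub>C 1))"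

text \<open>The direct sum of \<open>B\<close> and \<open>M\<close>; the pair \<open>(b, \<eta>)\<close> is \<open>b \<oplus> \<eta>\<close>, so that \<open>\<pp>\<close> is \<open>fst\<close>.\<close>

definition B_plus :: "'d::complex_algebra_1 set \<Rightarrow> ('d, 'x) bimod \<Rightarrow> ('d, 'd \<times> 'x) bimod" where
  "B_plus B M =
     \<lparr>carrier = B \<times> carrier M, mult = undefined, one = undefined,
      zero = (0, \<zero>\<^bsub>M\<^esub>),
      add = (\<lambda>(b, x) (c, y). (b + c, x \<oplus>\<^bsub>M\<^esub> y)),
      lact = (\<lambda>b (c, x). (b * c, lact M b x)),
      ract = (\<lambda>(c, x) b. (c * b, ract M x b))\<rparr>"

definition is_state ::
  "'d::complex_algebra_1 set \<Rightarrow> ('d, 'x) bimod \<Rightarrow> ('d \<times> 'x \<Rightarrow> 'd) \<Rightarrow> bool" where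
  "is_state B M q \<longleftrightarrow> (let X = B_plus B M in
     (\<forall>x\<in>carrier X. \<forall>y\<in>carrier X. q (x \<oplus>\<^bsub>X\<^esub> y) = q x + q y) \<and>
     (\<forall>z. \<forall>x\<in>carrier X. q (lact X (z *\<^sub>C 1) x) = z *\<^sub>C q x) \<and>
     (\<forall>b\<in>B. \<forall>x\<in>carrier X. q (lact X b x) = b * q x \<and> q (ract X x b) = q x * b) \<and>
     q (1, \<zero>\<^bsub>M\<^esub>) = 1)"

text \<open>Operators on a bimodule are functions that matter only on its carrier.\<close>

definition operators :: "('d::complex_algebra_1, 'x) bimod \<Rightarrow> ('x \<Rightarrow> 'x) set" where
  "operators X = {T \<in> carrier X \<rightarrow> carrier X.
     (\<forall>x\<in>carrier X. \<forall>y\<in>carrier X. T (x \<oplus>\<^bsub>X\<^esub> y) = T x \<oplus>\<^bsub>X\<^esub> T y) \<and>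
     (\<forall>z. \<forall>x\<in>carrier X. T (lact X (z *\<^sub>C 1) x) = lact X (z *\<^sub>C 1) (T x))}"

definition left_operators ::
  "'d::complex_algebra_1 set \<Rightarrow> ('d, 'x) bimod \<Rightarrow> ('x \<Rightarrow> 'x) set" where
  "left_operators B X =
     {T \<in> operators X. \<forall>b\<in>B. \<forall>x\<in>carrier X. T (ract X x b) = ract X (T x) b}"

definition right_operators ::
  "'d::complex_algebra_1 set \<Rightarrow> ('d, 'x) bimod \<Rightarrow> ('x \<Rightarrow> 'x) set" where
  "right_operators B X =
     {T \<in> operators X. \<forall>b\<in>B. \<forall>x\<in>carrier X. T (lact X b x) = lact X b (T x)}"

definition unital_representation ::
  "'a::complex_algebra_1 set \<Rightarrow> ('d::complex_algebra_1, 'x) bimod \<Rightarrow> ('x \<Rightarrow> 'x) set \<Rightarrow>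
   ('a \<Rightarrow> 'x \<Rightarrow> 'x) \<Rightarrow> bool" where
  "unital_representation A X Ops r \<longleftrightarrow>
     (\<forall>a\<in>A. r a \<in> Ops) \<and>
     (\<forall>x\<in>carrier X. r 1 x = x \<and>
        (\<forall>a\<in>A. \<forall>a'\<in>A. r (a + a') x = r a x \<oplus>\<^bsub>X\<^esub> r a' x \<and> r (a * a') x = r a (r a' x)) \<and>
        (\<forall>z. \<forall>a\<in>A. r (z *\<^sub>C a) x = lact X (z *\<^sub>C 1) (r a x)))"


section \<open>Abelian groups by generators and relations\<close>

definition relators :: "'g set \<Rightarrow> ('g \<Rightarrow>\<^sub>0 int) set \<Rightarrow> ('g \<Rightarrow>\<^sub>0 int) set" where
  "relators S R = generate (free_Abelian_group S) R"

definition presented :: "'g set \<Rightarrow> ('g \<Rightarrow>\<^sub>0 int) set \<Rightarrow> ('g \<Rightarrow>\<^sub>0 int) set ring" where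
  "presented S R = (let Q = free_Abelian_group S Mod relators S R in
     \<lparr>carrier = carrier Q, mult = undefined, one = undefined, zero = one Q, add = mult Q\<rparr>)"

definition gen :: "'g set \<Rightarrow> ('g \<Rightarrow>\<^sub>0 int) set \<Rightarrow> 'g \<Rightarrow> ('g \<Rightarrow>\<^sub>0 int) set" where
  "gen S R s = relators S R #>\<^bsub>free_Abelian_group S\<^esub> frag_of s"

text \<open>
  The unique additive map with prescribed values on the generators.  All uses below prescribe values
  that respect the relations, so that this map exists.
\<close>

definition extend ::
  "'g set \<Rightarrow> ('g \<Rightarrow>\<^sub>0 int) set \<Rightarrow> ('y, 'm) ring_scheme \<Rightarrow> ('g \<Rightarrow> 'y) \<Rightarrow> ('g \<Rightarrow>\<^sub>0 int) set \<Rightarrow> 'y" where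
  "extend S R G f = (THE h. h \<in> carrier (presented S R) \<rightarrow>\<^sub>E carrier G \<and>
     (\<forall>x\<in>carrier (presented S R). \<forall>y\<in>carrier (presented S R).
        h (x \<oplus>\<^bsub>presented S R\<^esub> y) = h x \<oplus>\<^bsub>G\<^esub> h y) \<and>
     (\<forall>s\<in>S. h (gen S R s) = f s))"


section \<open>Tensor products over B\<close>

definition tensor_gens :: "('d, 'x) bimod \<Rightarrow> ('d, 'y) bimod \<Rightarrow> ('x \<times> 'y) set" where
  "tensor_gens M N = carrier M \<times> carrier N"

definition tensor_rels ::
  "'d set \<Rightarrow> ('d, 'x) bimod \<Rightarrow> ('d, 'y) bimod \<Rightarrow> ('x \<times> 'y \<Rightarrow>\<^sub>0 int) set" where
  "tensor_rels B M N =
     {frag_of (x \<oplus>\<^bsub>M\<^esub> x', y) - frag_of (x, y) - frag_of (x', y) | x x' y.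
        x \<in> carrier M \<and> x' \<in> carrier M \<and> y \<in> carrier N} \<union>
     {frag_of (x, y \<oplus>\<^bsub>N\<^esub> y') - frag_of (x, y) - frag_of (x, y') | x y y'.
        x \<in> carrier M \<and> y \<in> carrier N \<and> y' \<in> carrier N} \<union>
     {frag_of (ract M x b, y) - frag_of (x, lact N b y) | x b y.
        x \<in> carrier M \<and> b \<in> B \<and> y \<in> carrier N}"

definition tensor ::
  "'d set \<Rightarrow> ('d, 'x) bimod \<Rightarrow> ('d, 'y) bimod \<Rightarrow> ('x \<times> 'y \<Rightarrow>\<^sub>0 int) set ring" where
  "tensor B M N = presented (tensor_gens M N) (tensor_rels B M N)"

definition pure_tensor ::
  "'d set \<Rightarrow> ('d, 'x) bimod \<Rightarrow> ('d, 'y) bimod \<Rightarrow> 'x \<Rightarrow> 'y \<Rightarrow> ('x \<times> 'y \<Rightarrow>\<^sub>0 int) set" where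
  "pure_tensor B M N x y = gen (tensor_gens M N) (tensor_rels B M N) (x, y)"

definition tensor_extend ::
  "'d set \<Rightarrow> ('d, 'x) bimod \<Rightarrow> ('d, 'y) bimod \<Rightarrow> ('z, 'm) ring_scheme \<Rightarrow> ('x \<Rightarrow> 'y \<Rightarrow> 'z) \<Rightarrow>
   ('x \<times> 'y \<Rightarrow>\<^sub>0 int) set \<Rightarrow> 'z" where
  "tensor_extend B M N G f = extend (tensor_gens M N) (tensor_rels B M N) G (\<lambda>(x, y). f x y)"

definition tensor_map ::
  "'d set \<Rightarrow> ('d, 'x) bimod \<Rightarrow> ('d, 'y) bimod \<Rightarrow> ('x \<Rightarrow> 'x) \<Rightarrow> ('y \<Rightarrow> 'y) \<Rightarrow>
   ('x \<times> 'y \<Rightarrow>\<^sub>0 int) set \<Rightarrow> ('x \<times> 'y \<Rightarrow>\<^sub>0 int) set" where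
  "tensor_map B M N S T =
     tensor_extend B M N (tensor B M N) (\<lambda>x y. pure_tensor B M N (S x) (T y))"


section \<open>Direct sums of tensor products along words\<close>

text \<open>
  For a family \<open>M\<close> of bimodules and a set \<open>W\<close> of nonempty words of indices, the direct sum over all
  \<open>k\<^sub>1 \<dots> k\<^sub>n\<close> in \<open>W\<close> of the tensor products over \<open>B\<close> of \<open>M k\<^sub>1, \<dots>, M k\<^sub>n\<close>.  The list
  \<open>[(k\<^sub>1, x\<^sub>1), \<dots>, (k\<^sub>n, x\<^sub>n)]\<close> represents the pure tensor of the \<open>x\<^sub>i\<close> in the summand of
  \<open>k\<^sub>1 \<dots> k\<^sub>n\<close>.  Every relation involves a single word, whence the direct sum decomposition.
\<close>

definition word_gens :: "('k \<Rightarrow> ('d, 'x) bimod) \<Rightarrow> 'k list set \<Rightarrow> ('k \<times> 'x) list set" where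
  "word_gens M W = {w. map fst w \<in> W \<and> (\<forall>(k, x)\<in>set w. x \<in> carrier (M k))}"

definition word_rels ::
  "'d set \<Rightarrow> ('k \<Rightarrow> ('d, 'x) bimod) \<Rightarrow> 'k list set \<Rightarrow> (('k \<times> 'x) list \<Rightarrow>\<^sub>0 int) set" where
  "word_rels B M W =
     {frag_of (u @ (k, x \<oplus>\<^bsub>M k\<^esub> y) # v) - frag_of (u @ (k, x) # v) - frag_of (u @ (k, y) # v) |
        u k x y v. u @ (k, x) # v \<in> word_gens M W \<and> u @ (k, y) # v \<in> word_gens M W} \<union>
     {frag_of (u @ (k, ract (M k) x b) # (l, y) # v) - frag_of (u @ (k, x) # (l, lact (M l) b y) # v) |
        u k x b l y v. b \<in> B \<and> u @ (k, x) # (l, y) # v \<in> word_gens M W}"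

definition word_tensor ::
  "'d set \<Rightarrow> ('k \<Rightarrow> ('d, 'x) bimod) \<Rightarrow> 'k list set \<Rightarrow> ('k \<times> 'x) list \<Rightarrow>
   (('k \<times> 'x) list \<Rightarrow>\<^sub>0 int) set" where
  "word_tensor B M W = gen (word_gens M W) (word_rels B M W)"

definition word_extend ::
  "'d set \<Rightarrow> ('k \<Rightarrow> ('d, 'x) bimod) \<Rightarrow> 'k list set \<Rightarrow> ('z, 'm) ring_scheme \<Rightarrow>
   (('k \<times> 'x) list \<Rightarrow> 'z) \<Rightarrow> (('k \<times> 'x) list \<Rightarrow>\<^sub>0 int) set \<Rightarrow> 'z" where
  "word_extend B M W G f = extend (word_gens M W) (word_rels B M W) G f"

definition lact_hd ::
  "('k \<Rightarrow> ('d, 'x) bimod) \<Rightarrow> 'd \<Rightarrow> ('k \<times> 'x) list \<Rightarrow> ('k \<times> 'x) list" where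
  "lact_hd M b w = (case hd w of (k, x) \<Rightarrow> (k, lact (M k) b x) # tl w)"

definition ract_last ::
  "('k \<Rightarrow> ('d, 'x) bimod) \<Rightarrow> ('k \<times> 'x) list \<Rightarrow> 'd \<Rightarrow> ('k \<times> 'x) list" where
  "ract_last M w b = (case last w of (k, x) \<Rightarrow> butlast w @ [(k, ract (M k) x b)])"

definition word_module ::
  "'d set \<Rightarrow> ('k \<Rightarrow> ('d, 'x) bimod) \<Rightarrow> 'k list set \<Rightarrow> ('d, (('k \<times> 'x) list \<Rightarrow>\<^sub>0 int) set) bimod" where
  "word_module B M W = (let P = presented (word_gens M W) (word_rels B M W) in
     \<lparr>carrier = carrier P, mult = undefined, one = undefined, zero = \<zero>\<^bsub>P\<^esub>, add = add P,
      lact = (\<lambda>b. word_extend B M W P (\<lambda>w. word_tensor B M W (lact_hd M b w))),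
      ract = (\<lambda>\<xi> b. word_extend B M W P (\<lambda>w. word_tensor B M W (ract_last M w b)) \<xi>)\<rparr>)"


section \<open>The c-free product\<close>

definition alt_words :: "'k set \<Rightarrow> 'k list set" where
  "alt_words K = {ks. ks \<noteq> [] \<and> set ks \<subseteq> K \<and> distinct_adj ks}"

definition alt_words_hd :: "'k set \<Rightarrow> 'k \<Rightarrow> 'k list set" where
  "alt_words_hd K k = {ks \<in> alt_words K. hd ks \<noteq> k}"

definition alt_words_last :: "'k set \<Rightarrow> 'k \<Rightarrow> 'k list set" where
  "alt_words_last K k = {ks \<in> alt_words K. last ks \<noteq> k}"

text \<open>
  In the following, \<open>M k\<close> is the bimodule \<open>\<X>\<^sub>k\<^sup>\<circ>\<close>, so that \<open>\<X>\<^sub>k\<close> is \<open>B_plus B (M k)\<close>, and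
  \<open>q k\<close> is the state \<open>\<qq>\<^sub>k\<close>.
\<close>

definition free_product ::
  "'d::complex_algebra_1 set \<Rightarrow> 'k set \<Rightarrow> ('k \<Rightarrow> ('d, 'x) bimod) \<Rightarrow>
   ('d, 'd \<times> (('k \<times> 'x) list \<Rightarrow>\<^sub>0 int) set) bimod" where
  "free_product B K M = B_plus B (word_module B M (alt_words K))"

definition additive_group :: "'d::ab_group_add ring" where
  "additive_group = \<lparr>carrier = UNIV, mult = undefined, one = undefined, zero = 0, add = (+)\<rparr>"

definition free_product_state ::
  "'d::complex_algebra_1 set \<Rightarrow> 'k set \<Rightarrow> ('k \<Rightarrow> ('d, 'x) bimod) \<Rightarrow> ('k \<Rightarrow> 'd \<times> 'x \<Rightarrow> 'd) \<Rightarrow>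
   'd \<times> (('k \<times> 'x) list \<Rightarrow>\<^sub>0 int) set \<Rightarrow> 'd" where
  "free_product_state B K M q = (\<lambda>(b, \<xi>). b +
     word_extend B M (alt_words K) additive_group
       (\<lambda>w. prod_list (map (\<lambda>(k, x). q k (0, x)) w)) \<xi>)"

text \<open>
  The inverses of the standard isomorphisms \<open>V\<^sub>k\<close> and \<open>W\<^sub>k\<close>:
  \<open>(b \<oplus> \<eta>) \<otimes> (c \<oplus> \<xi>) \<mapsto> b(c \<oplus> \<xi>) + \<eta>c + \<eta> \<otimes> \<xi>\<close>
  and \<open>(c \<oplus> \<xi>) \<otimes> (b \<oplus> \<eta>) \<mapsto> (c \<oplus> \<xi>)b + c\<eta> + \<xi> \<otimes> \<eta>\<close>.
\<close>

definition V_inv ::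
  "'d::complex_algebra_1 set \<Rightarrow> 'k set \<Rightarrow> ('k \<Rightarrow> ('d, 'x) bimod) \<Rightarrow> 'k \<Rightarrow>
   (('d \<times> 'x) \<times> ('d \<times> (('k \<times> 'x) list \<Rightarrow>\<^sub>0 int) set) \<Rightarrow>\<^sub>0 int) set \<Rightarrow>
   'd \<times> (('k \<times> 'x) list \<Rightarrow>\<^sub>0 int) set" where
  "V_inv B K M k =
    (let W = alt_words K; W' = alt_words_hd K k;
         N = word_module B M W; N' = word_module B M W'; X = free_product B K M;
         incl = word_extend B M W' N (word_tensor B M W);
         prepend = (\<lambda>\<eta>. word_extend B M W' N (\<lambda>w. word_tensor B M W ((k, \<eta>) # w)))
     in tensor_extend B (B_plus B (M k)) (B_plus B N') X
          (\<lambda>(b, \<eta>) (c, \<xi>). lact X b (c, incl \<xi>) \<oplus>\<^bsub>X\<^esub>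
             (0, word_tensor B M W [(k, ract (M k) \<eta> c)] \<oplus>\<^bsub>N\<^esub> prepend \<eta> \<xi>)))"

definition W_inv ::
  "'d::complex_algebra_1 set \<Rightarrow> 'k set \<Rightarrow> ('k \<Rightarrow> ('d, 'x) bimod) \<Rightarrow> 'k \<Rightarrow>
   (('d \<times> (('k \<times> 'x) list \<Rightarrow>\<^sub>0 int) set) \<times> ('d \<times> 'x) \<Rightarrow>\<^sub>0 int) set \<Rightarrow>
   'd \<times> (('k \<times> 'x) list \<Rightarrow>\<^sub>0 int) set" where
  "W_inv B K M k =
    (let W = alt_words K; W' = alt_words_last K k;
         N = word_module B M W; N' = word_module B M W'; X = free_product B K M;
         incl = word_extend B M W' N (word_tensor B M W);
         postpend = (\<lambda>\<eta>. word_extend B M W' N (\<lambda>w. word_tensor B M W (w @ [(k, \<eta>)])))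
     in tensor_extend B (B_plus B N') (B_plus B (M k)) X
          (\<lambda>(c, \<xi>) (b, \<eta>). ract X (c, incl \<xi>) b \<oplus>\<^bsub>X\<^esub>
             (0, word_tensor B M W [(k, lact (M k) c \<eta>)] \<oplus>\<^bsub>N\<^esub> postpend \<eta> \<xi>)))"

definition left_rep ::
  "'d::complex_algebra_1 set \<Rightarrow> 'k set \<Rightarrow> ('k \<Rightarrow> ('d, 'x) bimod) \<Rightarrow> 'k \<Rightarrow>
   ('d \<times> 'x \<Rightarrow> 'd \<times> 'x) \<Rightarrow>
   'd \<times> (('k \<times> 'x) list \<Rightarrow>\<^sub>0 int) set \<Rightarrow> 'd \<times> (('k \<times> 'x) list \<Rightarrow>\<^sub>0 int) set" where
  "left_rep B K M k Z =
    (let Xk = B_plus B (M k); Y = B_plus B (word_module B M (alt_words_hd K k)) in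
     V_inv B K M k \<circ> tensor_map B Xk Y Z id \<circ>
     inv_into (carrier (tensor B Xk Y)) (V_inv B K M k))"

definition right_rep ::
  "'d::complex_algebra_1 set \<Rightarrow> 'k set \<Rightarrow> ('k \<Rightarrow> ('d, 'x) bimod) \<Rightarrow> 'k \<Rightarrow>
   ('d \<times> 'x \<Rightarrow> 'd \<times> 'x) \<Rightarrow>
   'd \<times> (('k \<times> 'x) list \<Rightarrow>\<^sub>0 int) set \<Rightarrow> 'd \<times> (('k \<times> 'x) list \<Rightarrow>\<^sub>0 int) set" where
  "right_rep B K M k Z =
    (let Xk = B_plus B (M k); Y = B_plus B (word_module B M (alt_words_last K k)) in
     W_inv B K M k \<circ> tensor_map B Y Xk id Z \<circ>
     inv_into (carrier (tensor B Y Xk)) (W_inv B K M k))"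


section \<open>C-bi-free independence with amalgamation\<close>

datatype side = Lft | Rgt

text \<open>The vector \<open>Z\<^sub>1 \<dots> Z\<^sub>n (1 \<oplus> 0)\<close> for the images \<open>Z\<^sub>i\<close> of the given letters.\<close>

definition word_vector ::
  "'d::complex_algebra_1 set \<Rightarrow> 'k set \<Rightarrow> ('k \<Rightarrow> ('d, 'x) bimod) \<Rightarrow>
   ('k \<Rightarrow> 'a \<Rightarrow> 'd \<times> 'x \<Rightarrow> 'd \<times> 'x) \<Rightarrow> ('k \<Rightarrow> 'a \<Rightarrow> 'd \<times> 'x \<Rightarrow> 'd \<times> 'x) \<Rightarrow>
   ('k \<times> side \<times> 'a) list \<Rightarrow> 'd \<times> (('k \<times> 'x) list \<Rightarrow>\<^sub>0 int) set" where
  "word_vector B K M l r Zs =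
     foldr (\<lambda>(k, s, Z). case s of Lft \<Rightarrow> left_rep B K M k (l k Z) | Rgt \<Rightarrow> right_rep B K M k (r k Z))
       Zs (1, \<zero>\<^bsub>word_module B M (alt_words K)\<^esub>)"

text \<open>
  The type argument is the universe containing the carriers of the bimodules \<open>\<X>\<^sub>k\<^sup>\<circ>\<close>, as HOL
  cannot quantify over types.  The universe \<open>'a\<close> is already large enough: replacing each
  \<open>\<X>\<^sub>k\<close> by its smallest sub-bimodule \<open>B \<oplus> \<Y>\<^sub>k\<close> with \<open>\<Y>\<^sub>k \<subseteq> \<X>\<^sub>k\<^sup>\<circ>\<close> that is invariant under the images
  of \<open>l k\<close> and \<open>r k\<close> does not change the joint distribution, and this sub-bimodule
  has at most the cardinality of \<open>'a\<close>.
\<close>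

definition c_bi_free ::
  "'x itself \<Rightarrow> 'd::complex_algebra_1 set \<Rightarrow> ('a::complex_algebra_1 \<Rightarrow> 'd) \<Rightarrow> ('a \<Rightarrow> 'd) \<Rightarrow>
   'k set \<Rightarrow> ('k \<Rightarrow> 'a set) \<Rightarrow> ('k \<Rightarrow> 'a set) \<Rightarrow> bool" where
  "c_bi_free U B E F K Al Ar \<longleftrightarrow>
     (\<exists>(M :: 'k \<Rightarrow> ('d, 'x) bimod) q l r.
        (\<forall>k\<in>K. bimodule B (M k) \<and> is_state B (M k) (q k) \<and>
           unital_representation (Al k) (B_plus B (M k))
             (left_operators B (B_plus B (M k))) (l k) \<and>
           unital_representation (Ar k) (B_plus B (M k))
             (right_operators B (B_plus B (M k))) (r k)) \<and>
        (\<forall>Zs. (\<forall>(k, s, Z)\<in>set Zs. k \<in> K \<and> Z \<in> (case s of Lft \<Rightarrow> Al k | Rgt \<Rightarrow> Ar k)) \<longrightarrow>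
           E (prod_list (map (\<lambda>(k, s, Z). Z) Zs)) = fst (word_vector B K M l r Zs) \<and>
           F (prod_list (map (\<lambda>(k, s, Z). Z) Zs)) =
             free_product_state B K M q (word_vector B K M l r Zs)))"

end

theory Submission
  imports Defs
begin

text \<open>
  In the c-free product, left operators \<open>Z\<^sub>i\<close> with \<open>Z\<^sub>i (1 \<oplus> 0) = 0 \<oplus> \<eta>\<^sub>i\<close> and alternating indices send the vacuum to
  \<open>\<eta>\<^sub>1 \<otimes> \<dots> \<otimes> \<eta>\<^sub>n\<close>; so c-bi-free independence always implies c-free independence of the left algebras.

  Conversely, let \<open>N\<close> be the largest left ideal contained in the kernels of both expectations.  Since
  \<open>L\<^sub>b - R\<^sub>b \<in> N\<close>, all the \<open>\<X>\<^sub>k\<close> can be taken to be \<open>\<A>/N\<close> (realised in \<open>\<A>\<close> by a linear projection with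
  kernel \<open>N\<close>), on which the algebras act by left multiplication.  For words in left letters, both sides are
  multilinear, adjacent letters of one algebra can be multiplied, and \<open>L\<^sub>b\<close> may be assigned to any algebra;
  centring the letters reduces the claim to the centred alternating words, where it is c-freeness.  A right
  letter commutes with the left letters after it, also in the free product, and modulo \<open>N\<close> it coincides
  at the vacuum with the left letter that hypothesis (2) provides.
\<close>

section \<open>Additive maps and presented abelian groups\<close>

text \<open>The operators in the definition of c-bi-freeness conjugate Z \<otimes> I by V_k, with
  cosets for vectors and a chosen preimage for the inverse. Computations become possible on explicit
  generating vectors: \<open>prefix_vec k \<xi> w\<close>, the image in the free product of \<xi>
  \<otimes> w for \<xi> in X_k and a word w not beginning with k, and its mirror image
  \<open>suffix_vec\<close>. On them an operator T just replaces \<xi> by T \<xi>.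

  Left and right operators commute because on \<xi> \<otimes> u \<otimes> \<zeta> they work at
  different ends. The ends coincide only in the copy of X_k itself, when both operators have the
  same index; there the commutation inside X_k has to be supplied, and in A/N it comes from
  hypothesis (1).

  Hypothesis (2) quantifies over every left factor Z. That is what places Y - X in N; equal moments
  of Y and X alone would not allow Y to be replaced at the end of a longer word.

  Centring a letter leaves behind a term containing L_b. It is harmless because L_b can be given the
  index of a neighbouring letter and absorbed there, which makes the word shorter.\<close>

definition add_hom :: "('x, 'm) ring_scheme \<Rightarrow> ('y, 'n) ring_scheme \<Rightarrow> ('x \<Rightarrow> 'y) \<Rightarrow> bool" where
  "add_hom P G h \<longleftrightarrow> h \<in> carrier P \<rightarrow> carrier G \<and>
     (\<forall>x\<in>carrier P. \<forall>y\<in>carrier P. h (x \<oplus>\<^bsub>P\<^esub> y) = h x \<oplus>\<^bsub>G\<^esub> h y)"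

lemma add_homI:
  assumes "\<And>x. x \<in> carrier P \<Longrightarrow> h x \<in> carrier G"
    and "\<And>x y. \<lbrakk>x \<in> carrier P; y \<in> carrier P\<rbrakk> \<Longrightarrow> h (x \<oplus>\<^bsub>P\<^esub> y) = h x \<oplus>\<^bsub>G\<^esub> h y"
  shows "add_hom P G h"
  using assms by (auto simp: add_hom_def)

lemma add_hom_closed: "add_hom P G h \<Longrightarrow> x \<in> carrier P \<Longrightarrow> h x \<in> carrier G"
  by (auto simp: add_hom_def)

lemma add_hom_add:
  "add_hom P G h \<Longrightarrow> x \<in> carrier P \<Longrightarrow> y \<in> carrier P \<Longrightarrow> h (x \<oplus>\<^bsub>P\<^esub> y) = h x \<oplus>\<^bsub>G\<^esub> h y"
  by (auto simp: add_hom_def)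

lemma add_hom_comp: "add_hom P G h \<Longrightarrow> add_hom G H g \<Longrightarrow> add_hom P H (\<lambda>x. g (h x))"
  by (auto simp: add_hom_def Pi_iff)

lemma add_hom_id: "add_hom P P (\<lambda>x. x)"
  by (auto simp: add_hom_def)

lemma (in abelian_group) idem_zero: "x \<in> carrier G \<Longrightarrow> x \<oplus> x = x \<Longrightarrow> x = \<zero>"
  by (metis add.l_cancel_one)

lemma (in abelian_group) add_minus_minus:
  "p \<in> carrier G \<Longrightarrow> q \<in> carrier G \<Longrightarrow> p \<oplus> q \<ominus> p \<ominus> q = \<zero>"
  by (simp add: a_minus_def a_comm[of p q] a_assoc r_neg r_neg2)

lemma add_hom_zero:
  assumes "add_hom P G h" "abelian_group P" "abelian_group G"
  shows "h \<zero>\<^bsub>P\<^esub> = \<zero>\<^bsub>G\<^esub>"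
proof -
  interpret P: abelian_group P by fact
  interpret G: abelian_group G by fact
  have "h \<zero>\<^bsub>P\<^esub> \<oplus>\<^bsub>G\<^esub> h \<zero>\<^bsub>P\<^esub> = h \<zero>\<^bsub>P\<^esub>"
    using add_hom_add[OF assms(1), of "\<zero>\<^bsub>P\<^esub>" "\<zero>\<^bsub>P\<^esub>"] by simp
  then show ?thesis
    using G.idem_zero add_hom_closed[OF assms(1)] by simp
qed

lemma add_hom_minus:
  assumes "add_hom P G h" "abelian_group P" "abelian_group G" "x \<in> carrier P"
  shows "h (\<ominus>\<^bsub>P\<^esub> x) = \<ominus>\<^bsub>G\<^esub> h x"
proof -
  interpret P: abelian_group P by fact
  interpret G: abelian_group G by fact
  have "h (\<ominus>\<^bsub>P\<^esub> x) \<oplus>\<^bsub>G\<^esub> h x = \<zero>\<^bsub>G\<^esub>"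
    using add_hom_add[OF assms(1), of "\<ominus>\<^bsub>P\<^esub> x" x] add_hom_zero[OF assms(1-3)] assms(4)
    by (simp add: P.l_neg)
  then show ?thesis
    using G.minus_equality add_hom_closed[OF assms(1)] assms(4) by simp
qed

lemma add_hom_sum:
  assumes "abelian_group G" "add_hom P G h" "add_hom P G g"
  shows "add_hom P G (\<lambda>x. h x \<oplus>\<^bsub>G\<^esub> g x)"
proof -
  interpret G: abelian_group G by fact
  show ?thesis
    using assms(2,3) by (intro add_homI) (auto simp: add_hom_add add_hom_closed G.a_ac)
qed

section \<open>Generators and relations: cosets, induction and the universal property\<close>

locale presentation =
  fixes S :: "'g set" and R :: "('g \<Rightarrow>\<^sub>0 int) set"
  assumes relations: "R \<subseteq> carrier (free_Abelian_group S)"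
begin

abbreviation "FA \<equiv> free_Abelian_group S"
abbreviation "P \<equiv> presented S R"

lemma subgroup_relators: "subgroup (relators S R) FA"
  unfolding relators_def by (simp add: group.generate_is_subgroup relations)

lemma normal_relators: "relators S R \<lhd> FA"
  using abelian_free_Abelian_group comm_group.subgroup_imp_normal subgroup_relators by blast

lemma carrier_presented: "carrier P = (\<lambda>x. relators S R #>\<^bsub>FA\<^esub> x) ` carrier FA"
  by (auto simp: presented_def Let_def carrier_FactGroup)

lemma add_presented:
  assumes "x \<in> carrier FA" "y \<in> carrier FA"
  shows "(relators S R #>\<^bsub>FA\<^esub> x) \<oplus>\<^bsub>P\<^esub> (relators S R #>\<^bsub>FA\<^esub> y) = relators S R #>\<^bsub>FA\<^esub> (x + y)"
  using normal.rcos_sum[OF normal_relators assms] by (simp add: presented_def Let_def)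

lemma abelian_group_presented: "abelian_group P"
proof -
  interpret Q: comm_group "FA Mod relators S R"
    using abelian_free_Abelian_group comm_group.abelian_FactGroup subgroup_relators by blast
  show ?thesis
  proof (rule abelian_groupI)
    fix x assume "x \<in> carrier P"
    then show "\<exists>y\<in>carrier P. y \<oplus>\<^bsub>P\<^esub> x = \<zero>\<^bsub>P\<^esub>"
      using Q.l_inv_ex by (simp add: presented_def Let_def)
  qed (use Q.m_closed Q.one_closed Q.m_assoc Q.m_comm Q.l_one in \<open>auto simp: presented_def Let_def\<close>)
qed

sublocale P: abelian_group P
  by (rule abelian_group_presented)

lemma gen_closed: "s \<in> S \<Longrightarrow> gen S R s \<in> carrier P"
  by (auto simp: gen_def carrier_presented)

lemma zero_coset: "\<zero>\<^bsub>P\<^esub> = relators S R #>\<^bsub>FA\<^esub> 0"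
proof -
  have "relators S R #>\<^bsub>FA\<^esub> \<one>\<^bsub>FA\<^esub> = relators S R"
    using subgroup.subset[OF subgroup_relators]
    by (intro group.coset_mult_one) auto
  then show ?thesis
    by (simp add: presented_def Let_def)
qed

lemma coset_relation:
  assumes "a \<in> carrier FA" "b \<in> carrier FA" "a - b \<in> R"
  shows "relators S R #>\<^bsub>FA\<^esub> a = relators S R #>\<^bsub>FA\<^esub> b"
proof -
  have "a - b \<in> relators S R"
    using assms(3) by (auto simp: relators_def intro: generate.incl)
  moreover have "a = (a - b) \<otimes>\<^bsub>FA\<^esub> b"
    by simp
  ultimately have "a \<in> relators S R #>\<^bsub>FA\<^esub> b"
    unfolding r_coset_def by blast
  then show ?thesis
    using group.repr_independence[OF group_free_Abelian_group _ assms(2) subgroup_relators] by simp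
qed

lemma gen_eq:
  assumes "a \<in> S" "b \<in> S" "frag_of a - frag_of b \<in> R"
  shows "gen S R a = gen S R b"
  unfolding gen_def using assms by (intro coset_relation) auto

lemma gen_add:
  assumes "a \<in> S" "b \<in> S" "c \<in> S" "frag_of a - frag_of b - frag_of c \<in> R"
  shows "gen S R a = gen S R b \<oplus>\<^bsub>P\<^esub> gen S R c"
proof -
  have "frag_of b + frag_of c \<in> carrier FA"
    using group.is_monoid[OF group_free_Abelian_group] assms
      keys_add[of "frag_of b" "frag_of c"] by auto
  then have "relators S R #>\<^bsub>FA\<^esub> frag_of a = relators S R #>\<^bsub>FA\<^esub> (frag_of b + frag_of c)"
    using assms by (intro coset_relation) (auto simp: diff_diff_eq)
  then show ?thesis
    using assms by (simp add: gen_def add_presented)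
qed

text \<open>Each element is the coset of a formal integer combination of generators, and
  \<open>frag_induction\<close> reaches those by differences. The principle serves both to compare
  additive maps on generators and to show that an image containing the generators is
  everything.\<close>

lemma presented_induct [consumes 1, case_names gen minus add zero]:
  assumes x: "x \<in> carrier P"
    and gen: "\<And>s. s \<in> S \<Longrightarrow> Q (gen S R s)"
    and minus: "\<And>x. x \<in> carrier P \<Longrightarrow> Q x \<Longrightarrow> Q (\<ominus>\<^bsub>P\<^esub> x)"
    and add: "\<And>x y. x \<in> carrier P \<Longrightarrow> y \<in> carrier P \<Longrightarrow> Q x \<Longrightarrow> Q y \<Longrightarrow> Q (x \<oplus>\<^bsub>P\<^esub> y)"
    and zero: "Q \<zero>\<^bsub>P\<^esub>"
  shows "Q x"
proof -
  obtain c where c: "Poly_Mapping.keys c \<subseteq> S" "x = relators S R #>\<^bsub>FA\<^esub> c"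
    using x by (auto simp: carrier_presented)
  \<comment> \<open>The support condition belongs to the induction predicate: the difference case of
    \<open>frag_induction\<close> supplies nothing about the two combinations except the predicate
    itself.\<close>
  have "Poly_Mapping.keys c \<subseteq> S \<and> Q (relators S R #>\<^bsub>FA\<^esub> c)"
    using c(1)
  proof (induction c rule: frag_induction)
    case zero
    then show ?case using assms(5) by (simp add: zero_coset)
  next
    case (one s)
    then show ?case using gen by (simp add: gen_def)
  next
    case (diff a b)
    have cl: "a - b \<in> carrier FA" "a \<in> carrier FA" "b \<in> carrier FA"
      using diff keys_diff[of a b] by auto
    let ?A = "relators S R #>\<^bsub>FA\<^esub> a" and ?B = "relators S R #>\<^bsub>FA\<^esub> b"
    have AB: "?A \<in> carrier P" "?B \<in> carrier P"
      using cl by (auto simp: carrier_presented)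
    have "(relators S R #>\<^bsub>FA\<^esub> (a - b)) \<oplus>\<^bsub>P\<^esub> ?B = ?A"
      using cl by (simp add: add_presented)
    moreover have "relators S R #>\<^bsub>FA\<^esub> (a - b) \<in> carrier P"
      using cl by (auto simp: carrier_presented)
    ultimately have "relators S R #>\<^bsub>FA\<^esub> (a - b) = ?A \<oplus>\<^bsub>P\<^esub> (\<ominus>\<^bsub>P\<^esub> ?B)"
      using AB by (metis P.a_assoc P.a_inv_closed P.r_neg P.r_zero)
    then show ?case
      using add[OF AB(1) P.a_inv_closed[OF AB(2)]] minus[OF AB(2)] diff cl by simp
  qed
  then show ?thesis using c by simp
qed

lemma add_hom_eqI:
  assumes "abelian_group G" "add_hom P G h" "add_hom P G g"
    and "\<And>s. s \<in> S \<Longrightarrow> h (gen S R s) = g (gen S R s)"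
    and "x \<in> carrier P"
  shows "h x = g x"
  using assms(5)
  by (induction x rule: presented_induct)
    (simp_all add: assms(4) add_hom_add[OF assms(2)] add_hom_add[OF assms(3)]
      add_hom_minus[OF assms(2) P.abelian_group_axioms assms(1)]
      add_hom_minus[OF assms(3) P.abelian_group_axioms assms(1)]
      add_hom_zero[OF assms(2) P.abelian_group_axioms assms(1)]
      add_hom_zero[OF assms(3) P.abelian_group_axioms assms(1)])

text \<open>The map f extends to the free group, and the extension factors through the relators once
  it kills R. The premise \<open>kills\<close> speaks of an arbitrary h with the properties of that
  extension, so a caller only has to evaluate h on each relation. Uniqueness, which justifies the
  description in \<open>extend\<close>, is \<open>add_hom_eqI\<close>.\<close>

lemma extend_add_hom:
  assumes G: "abelian_group G"
    and f: "f \<in> S \<rightarrow> carrier G"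
    and kills: "\<forall>h. (\<forall>s\<in>S. h (frag_of s) = f s) \<and>
        (\<forall>a\<in>carrier FA. \<forall>b\<in>carrier FA. h (a - b) = h a \<ominus>\<^bsub>G\<^esub> h b) \<longrightarrow> (\<forall>\<rho>\<in>R. h \<rho> = \<zero>\<^bsub>G\<^esub>)"
  shows "add_hom P G (extend S R G f)" "s \<in> S \<Longrightarrow> extend S R G f (gen S R s) = f s"
proof -
  interpret G: abelian_group G by fact
  obtain h where h: "h \<in> hom FA (add_monoid G)" "\<And>s. s \<in> S \<Longrightarrow> h (frag_of s) = f s"
    using comm_group.free_Abelian_group_universal[of "add_monoid G" f S] G.a_comm_group f
    by (auto simp: image_subset_iff_funcset)
  interpret h: group_hom FA "add_monoid G" h
    using h(1) by (simp add: group_hom_def group_hom_axioms_def G.a_group)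
  have hd: "h (a - b) = h a \<ominus>\<^bsub>G\<^esub> h b" if "a \<in> carrier FA" "b \<in> carrier FA" for a b
    using that h.hom_inv[of b] h.hom_mult[of a "- b"] keys_minus[of b]
    by (simp add: a_minus_def a_inv_def keys_minus)
  have hR: "h \<rho> = \<zero>\<^bsub>G\<^esub>" if "\<rho> \<in> R" for \<rho>
    using kills h(2) hd that by blast
  have "relators S R \<subseteq> kernel FA (add_monoid G) h"
    unfolding relators_def
    using h.subgroup_kernel relations hR
    by (intro group.generate_subgroup_incl) (fastforce simp: kernel_def)+
  then obtain g where g: "g \<in> hom (FA Mod relators S R) (add_monoid G)"
    "\<And>x. x \<in> carrier FA \<Longrightarrow> g (relators S R #>\<^bsub>FA\<^esub> x) = h x"
    using h.FactGroup_universal_kernel[OF normal_relators] by blast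
  have gh: "add_hom P G g"
    using g(1) by (auto simp: add_hom_def hom_def presented_def Let_def)
  have gg: "g (gen S R s) = f s" if "s \<in> S" for s
    using that g(2) h(2) by (simp add: gen_def)
  \<comment> \<open>\<open>extend\<close> describes an extensional function, so the candidate must
    be restricted to the carrier.\<close>
  let ?g = "restrict g (carrier P)"
  have "extend S R G f = ?g"
    unfolding extend_def
  proof (rule the_equality)
    show "?g \<in> carrier P \<rightarrow>\<^sub>E carrier G \<and>
     (\<forall>x\<in>carrier P. \<forall>y\<in>carrier P. ?g (x \<oplus>\<^bsub>P\<^esub> y) = ?g x \<oplus>\<^bsub>G\<^esub> ?g y) \<and>
     (\<forall>s\<in>S. ?g (gen S R s) = f s)"
      using gh gg gen_closed by (auto simp: add_hom_def)
  next
    fix k assume k: "k \<in> carrier P \<rightarrow>\<^sub>E carrier G \<and>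
     (\<forall>x\<in>carrier P. \<forall>y\<in>carrier P. k (x \<oplus>\<^bsub>P\<^esub> y) = k x \<oplus>\<^bsub>G\<^esub> k y) \<and>
     (\<forall>s\<in>S. k (gen S R s) = f s)"
    then have "add_hom P G k"
      by (auto simp: add_hom_def PiE_iff)
    then have "k x = g x" if "x \<in> carrier P" for x
      using add_hom_eqI[OF G _ gh] gg k that by simp
    then show "k = ?g"
      using k by (intro extensionalityI[of k "carrier P"]) (auto simp: PiE_iff)
  qed
  then show "add_hom P G (extend S R G f)" "s \<in> S \<Longrightarrow> extend S R G f (gen S R s) = f s"
    using gh gg gen_closed by (auto simp: add_hom_def)
qed

end

section \<open>Bimodules and balanced maps\<close>

lemma bimoduleD:
  assumes "bimodule B M"
  shows "abelian_group M"
    and "\<lbrakk>b \<in> B; x \<in> carrier M\<rbrakk> \<Longrightarrow> lact M b x \<in> carrier M"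
    and "\<lbrakk>b \<in> B; x \<in> carrier M\<rbrakk> \<Longrightarrow> ract M x b \<in> carrier M"
    and "\<lbrakk>b \<in> B; x \<in> carrier M; y \<in> carrier M\<rbrakk> \<Longrightarrow> lact M b (x \<oplus>\<^bsub>M\<^esub> y) = lact M b x \<oplus>\<^bsub>M\<^esub> lact M b y"
    and "\<lbrakk>b \<in> B; x \<in> carrier M; y \<in> carrier M\<rbrakk> \<Longrightarrow> ract M (x \<oplus>\<^bsub>M\<^esub> y) b = ract M x b \<oplus>\<^bsub>M\<^esub> ract M y b"
    and "\<lbrakk>b \<in> B; c \<in> B; x \<in> carrier M\<rbrakk> \<Longrightarrow> lact M (b + c) x = lact M b x \<oplus>\<^bsub>M\<^esub> lact M c x"
    and "\<lbrakk>b \<in> B; c \<in> B; x \<in> carrier M\<rbrakk> \<Longrightarrow> ract M x (b + c) = ract M x b \<oplus>\<^bsub>M\<^esub> ract M x c"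
    and "\<lbrakk>b \<in> B; c \<in> B; x \<in> carrier M\<rbrakk> \<Longrightarrow> lact M (b * c) x = lact M b (lact M c x)"
    and "\<lbrakk>b \<in> B; c \<in> B; x \<in> carrier M\<rbrakk> \<Longrightarrow> ract M x (b * c) = ract M (ract M x b) c"
    and "\<lbrakk>b \<in> B; c \<in> B; x \<in> carrier M\<rbrakk> \<Longrightarrow> ract M (lact M b x) c = lact M b (ract M x c)"
    and "x \<in> carrier M \<Longrightarrow> lact M 1 x = x"
    and "x \<in> carrier M \<Longrightarrow> ract M x 1 = x"
    and "x \<in> carrier M \<Longrightarrow> lact M (z *\<^sub>C 1) x = ract M x (z *\<^sub>C 1)"
  using assms unfolding bimodule_def by simp_all

lemma subalgebraD:
  assumes "unital_subalgebra B"
  shows "0 \<in> B" "1 \<in> B" "x \<in> B \<Longrightarrow> y \<in> B \<Longrightarrow> x + y \<in> B" "x \<in> B \<Longrightarrow> y \<in> B \<Longrightarrow> x * y \<in> B"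
    "x \<in> B \<Longrightarrow> z *\<^sub>C x \<in> B" "x \<in> B \<Longrightarrow> - x \<in> B" "x \<in> B \<Longrightarrow> y \<in> B \<Longrightarrow> x - y \<in> B"
  using assms complex_vector.subspace_0 complex_vector.subspace_add complex_vector.subspace_scale
    complex_vector.subspace_neg complex_vector.subspace_diff
  unfolding unital_subalgebra_def by auto

lemma bimodule_zero:
  assumes M: "bimodule B M" and B: "unital_subalgebra B"
  shows "x \<in> carrier M \<Longrightarrow> lact M 0 x = \<zero>\<^bsub>M\<^esub>" "x \<in> carrier M \<Longrightarrow> ract M x 0 = \<zero>\<^bsub>M\<^esub>"
    "b \<in> B \<Longrightarrow> lact M b \<zero>\<^bsub>M\<^esub> = \<zero>\<^bsub>M\<^esub>" "b \<in> B \<Longrightarrow> ract M \<zero>\<^bsub>M\<^esub> b = \<zero>\<^bsub>M\<^esub>"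
proof -
  interpret abelian_group M by (rule bimoduleD[OF M])
  show "x \<in> carrier M \<Longrightarrow> lact M 0 x = \<zero>\<^bsub>M\<^esub>"
    using bimoduleD(6)[OF M, of 0 0 x] bimoduleD(2)[OF M, of 0 x] subalgebraD[OF B]
    by (metis add_0 idem_zero)
  show "x \<in> carrier M \<Longrightarrow> ract M x 0 = \<zero>\<^bsub>M\<^esub>"
    using bimoduleD(7)[OF M, of 0 0 x] bimoduleD(3)[OF M, of 0 x] subalgebraD[OF B]
    by (metis add_0 idem_zero)
  show "b \<in> B \<Longrightarrow> lact M b \<zero>\<^bsub>M\<^esub> = \<zero>\<^bsub>M\<^esub>"
    using bimoduleD(4)[OF M, of b "\<zero>\<^bsub>M\<^esub>" "\<zero>\<^bsub>M\<^esub>"] bimoduleD(2)[OF M, of b "\<zero>\<^bsub>M\<^esub>"]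
    by (metis l_zero idem_zero zero_closed)
  show "b \<in> B \<Longrightarrow> ract M \<zero>\<^bsub>M\<^esub> b = \<zero>\<^bsub>M\<^esub>"
    using bimoduleD(5)[OF M, of b "\<zero>\<^bsub>M\<^esub>" "\<zero>\<^bsub>M\<^esub>"] bimoduleD(3)[OF M, of b "\<zero>\<^bsub>M\<^esub>"]
    by (metis l_zero idem_zero zero_closed)
qed

lemma B_plus_simps [simp]:
  "carrier (B_plus B M) = B \<times> carrier M"
  "\<zero>\<^bsub>B_plus B M\<^esub> = (0, \<zero>\<^bsub>M\<^esub>)"
  "(b, x) \<oplus>\<^bsub>B_plus B M\<^esub> (c, y) = (b + c, x \<oplus>\<^bsub>M\<^esub> y)"
  "lact (B_plus B M) d (b, x) = (d * b, lact M d x)"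
  "ract (B_plus B M) (b, x) d = (b * d, ract M x d)"
  by (simp_all add: B_plus_def)

lemma abelian_group_B_plus:
  assumes B: "unital_subalgebra B" and M: "abelian_group M"
  shows "abelian_group (B_plus B M)"
proof -
  interpret abelian_group M by fact
  show ?thesis
  proof (rule abelian_groupI)
    fix x assume "x \<in> carrier (B_plus B M)"
    then show "\<exists>y\<in>carrier (B_plus B M). y \<oplus>\<^bsub>B_plus B M\<^esub> x = \<zero>\<^bsub>B_plus B M\<^esub>"
      using l_neg subalgebraD(6)[OF B] by (intro bexI[of _ "(- fst x, \<ominus>\<^bsub>M\<^esub> snd x)"]) auto
  qed (auto simp: subalgebraD[OF B] a_ac ac_simps)
qed

lemma bimodule_B_plus:
  assumes B: "unital_subalgebra B" and M: "bimodule B M"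
  shows "bimodule B (B_plus B M)"
proof -
  interpret M: abelian_group M by (rule bimoduleD[OF M])
  note simps = subalgebraD[OF B] bimoduleD(2-12)[OF M] distrib_left distrib_right mult.assoc
  show ?thesis
    unfolding bimodule_def
  proof (intro conjI ballI allI)
    show "abelian_group (B_plus B M)"
      by (rule abelian_group_B_plus[OF B bimoduleD(1)[OF M]])
    show "lact (B_plus B M) (z *\<^sub>C 1) x = ract (B_plus B M) x (z *\<^sub>C 1)"
      if "x \<in> carrier (B_plus B M)" for z x
      using that bimoduleD(13)[OF M, of "snd x" z]
      by (cases x) (simp add: mult_scaleC_left mult_scaleC_right)
  qed (auto simp: simps)
qed

definition balanced ::
  "'d set \<Rightarrow> ('d, 'x) bimod \<Rightarrow> ('d, 'y) bimod \<Rightarrow> ('z, 'm) ring_scheme \<Rightarrow> ('x \<Rightarrow> 'y \<Rightarrow> 'z) \<Rightarrow> bool" where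
  "balanced B M N G f \<longleftrightarrow>
     (\<forall>x\<in>carrier M. add_hom N G (f x)) \<and> (\<forall>y\<in>carrier N. add_hom M G (\<lambda>x. f x y)) \<and>
     (\<forall>x\<in>carrier M. \<forall>b\<in>B. \<forall>y\<in>carrier N. f (ract M x b) y = f x (lact N b y))"

lemma balancedI:
  assumes "\<And>x y. \<lbrakk>x \<in> carrier M; y \<in> carrier N\<rbrakk> \<Longrightarrow> f x y \<in> carrier G"
    and "\<And>x y y'. \<lbrakk>x \<in> carrier M; y \<in> carrier N; y' \<in> carrier N\<rbrakk> \<Longrightarrow> f x (y \<oplus>\<^bsub>N\<^esub> y') = f x y \<oplus>\<^bsub>G\<^esub> f x y'"
    and "\<And>x x' y. \<lbrakk>x \<in> carrier M; x' \<in> carrier M; y \<in> carrier N\<rbrakk> \<Longrightarrow> f (x \<oplus>\<^bsub>M\<^esub> x') y = f x y \<oplus>\<^bsub>G\<^esub> f x' y"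
    and "\<And>x b y. \<lbrakk>x \<in> carrier M; b \<in> B; y \<in> carrier N\<rbrakk> \<Longrightarrow> f (ract M x b) y = f x (lact N b y)"
  shows "balanced B M N G f"
  using assms by (simp add: balanced_def add_hom_def)

lemma balancedD:
  assumes "balanced B M N G f"
  shows "\<lbrakk>x \<in> carrier M; y \<in> carrier N\<rbrakk> \<Longrightarrow> f x y \<in> carrier G"
    and "\<lbrakk>x \<in> carrier M; y \<in> carrier N; y' \<in> carrier N\<rbrakk> \<Longrightarrow> f x (y \<oplus>\<^bsub>N\<^esub> y') = f x y \<oplus>\<^bsub>G\<^esub> f x y'"
    and "\<lbrakk>x \<in> carrier M; x' \<in> carrier M; y \<in> carrier N\<rbrakk> \<Longrightarrow> f (x \<oplus>\<^bsub>M\<^esub> x') y = f x y \<oplus>\<^bsub>G\<^esub> f x' y"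
    and "\<lbrakk>x \<in> carrier M; b \<in> B; y \<in> carrier N\<rbrakk> \<Longrightarrow> f (ract M x b) y = f x (lact N b y)"
  using assms by (simp_all add: balanced_def add_hom_def Pi_iff)

lemma balanced_comp:
  assumes "balanced B P Q Y f" "add_hom Y Z h"
  shows "balanced B P Q Z (\<lambda>x y. h (f x y))"
  using assms by (auto simp: balanced_def intro: add_hom_comp)

section \<open>The universal property of the tensor product over B\<close>

context
  fixes B :: "'d::complex_algebra_1 set" and M :: "('d, 'x) bimod" and N :: "('d, 'y) bimod"
  assumes M: "bimodule B M" and N: "bimodule B N"
begin

lemma tensor_presentation: "presentation (tensor_gens M N) (tensor_rels B M N)"
proof -
  interpret M: abelian_group M by (rule bimoduleD[OF M])
  interpret N: abelian_group N by (rule bimoduleD[OF N])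
  show ?thesis
    by standard (auto simp: tensor_rels_def tensor_gens_def bimoduleD[OF M] bimoduleD[OF N]
        dest!: subsetD[OF keys_diff])
qed

interpretation T: presentation "tensor_gens M N" "tensor_rels B M N"
  by (rule tensor_presentation)

lemma abelian_group_tensor: "abelian_group (tensor B M N)"
  unfolding tensor_def by (rule T.abelian_group_presented)

lemma tensor_relsI1:
  "\<lbrakk>x \<in> carrier M; x' \<in> carrier M; y \<in> carrier N\<rbrakk> \<Longrightarrow>
     frag_of (x \<oplus>\<^bsub>M\<^esub> x', y) - frag_of (x, y) - frag_of (x', y) \<in> tensor_rels B M N"
  unfolding tensor_rels_def by blast

lemma tensor_relsI2:
  "\<lbrakk>x \<in> carrier M; y \<in> carrier N; y' \<in> carrier N\<rbrakk> \<Longrightarrow>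
     frag_of (x, y \<oplus>\<^bsub>N\<^esub> y') - frag_of (x, y) - frag_of (x, y') \<in> tensor_rels B M N"
  unfolding tensor_rels_def by blast

lemma tensor_relsI3:
  "\<lbrakk>x \<in> carrier M; b \<in> B; y \<in> carrier N\<rbrakk> \<Longrightarrow>
     frag_of (ract M x b, y) - frag_of (x, lact N b y) \<in> tensor_rels B M N"
  unfolding tensor_rels_def by blast

lemma pure_tensor_balanced: "balanced B M N (tensor B M N) (pure_tensor B M N)"
proof -
  interpret M: abelian_group M by (rule bimoduleD[OF M])
  interpret N: abelian_group N by (rule bimoduleD[OF N])
  have g: "(x, y) \<in> tensor_gens M N" if "x \<in> carrier M" "y \<in> carrier N" for x y
    using that by (simp add: tensor_gens_def)
  show ?thesis
    unfolding tensor_def pure_tensor_def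
  proof (rule balancedI, goal_cases)
    case (1 x y) then show ?case by (intro T.gen_closed g)
  next
    case (2 x y y') then show ?case
      by (intro T.gen_add g tensor_relsI2 N.a_closed)
  next
    case (3 x x' y) then show ?case
      by (intro T.gen_add g tensor_relsI1 M.a_closed)
  next
    case (4 x b y) then show ?case
      by (intro T.gen_eq g tensor_relsI3 bimoduleD(3)[OF M] bimoduleD(2)[OF N])
  qed
qed

text \<open>A biadditive map that lets B pass between its two arguments kills each of the three
  families of relations, hence factors through the tensor product.\<close>

lemma tensor_extend:
  assumes G: "abelian_group G" and f: "balanced B M N G f"
  shows "add_hom (tensor B M N) G (tensor_extend B M N G f)"
    and "\<lbrakk>x \<in> carrier M; y \<in> carrier N\<rbrakk> \<Longrightarrow> tensor_extend B M N G f (pure_tensor B M N x y) = f x y"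
proof -
  interpret M: abelian_group M by (rule bimoduleD[OF M])
  interpret N: abelian_group N by (rule bimoduleD[OF N])
  interpret G: abelian_group G by fact
  have gens: "(\<lambda>(x, y). f x y) \<in> tensor_gens M N \<rightarrow> carrier G"
    by (auto simp: tensor_gens_def balancedD(1)[OF f])
  have kills: "h \<rho> = \<zero>\<^bsub>G\<^esub>"
    if h: "\<And>s. s \<in> tensor_gens M N \<Longrightarrow> h (frag_of s) = (case s of (x, y) \<Rightarrow> f x y)"
      and hd: "\<And>a b. \<lbrakk>a \<in> carrier (free_Abelian_group (tensor_gens M N));
        b \<in> carrier (free_Abelian_group (tensor_gens M N))\<rbrakk> \<Longrightarrow> h (a - b) = h a \<ominus>\<^bsub>G\<^esub> h b"
      and \<rho>: "\<rho> \<in> tensor_rels B M N" for h \<rho>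
  proof -
    have k: "Poly_Mapping.keys (frag_of s - frag_of t) \<subseteq> tensor_gens M N"
      if "s \<in> tensor_gens M N" "t \<in> tensor_gens M N" for s t
      using that keys_diff[of "frag_of s" "frag_of t"] by auto
    have g: "(x, y) \<in> tensor_gens M N" if "x \<in> carrier M" "y \<in> carrier N" for x y
      using that by (simp add: tensor_gens_def)
    have hg: "h (frag_of (x, y)) = f x y" if "x \<in> carrier M" "y \<in> carrier N" for x y
      using h that by (simp add: tensor_gens_def)
    from \<rho> consider
        x x' y where "x \<in> carrier M" "x' \<in> carrier M" "y \<in> carrier N"
          "\<rho> = frag_of (x \<oplus>\<^bsub>M\<^esub> x', y) - frag_of (x, y) - frag_of (x', y)"
      | x y y' where "x \<in> carrier M" "y \<in> carrier N" "y' \<in> carrier N"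
          "\<rho> = frag_of (x, y \<oplus>\<^bsub>N\<^esub> y') - frag_of (x, y) - frag_of (x, y')"
      | x b y where "x \<in> carrier M" "b \<in> B" "y \<in> carrier N"
          "\<rho> = frag_of (ract M x b, y) - frag_of (x, lact N b y)"
      unfolding tensor_rels_def by auto
    then show ?thesis
    proof cases
      case 1 then show ?thesis
        by (simp add: hd k hg g balancedD(1,3)[OF f] G.add_minus_minus)
    next
      case 2 then show ?thesis
        by (simp add: hd k hg g balancedD(1,2)[OF f] G.add_minus_minus)
    next
      case 3 then show ?thesis
        by (simp add: hd hg g balancedD(1,4)[OF f] bimoduleD(3)[OF M] bimoduleD(2)[OF N]
            a_minus_def G.r_neg)
    qed
  qed
  show "add_hom (tensor B M N) G (tensor_extend B M N G f)"
    unfolding tensor_def tensor_extend_def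
    by (rule T.extend_add_hom(1)[OF G gens]) (blast intro: kills)
  show "tensor_extend B M N G f (pure_tensor B M N x y) = f x y" if "x \<in> carrier M" "y \<in> carrier N"
    unfolding pure_tensor_def tensor_extend_def
    using T.extend_add_hom(2)[OF G gens, of "(x, y)"] that kills
    by (auto simp: tensor_gens_def)
qed

text \<open>
  The operator induced on \<open>X\<close> through a surjection \<open>v\<close> from the tensor product is determined by its
  values on the images of the pure tensors as soon as some additive operator has these values; in
  particular \<open>v\<close> need not be shown to be injective.
\<close>

lemma induced_operator:
  assumes X: "abelian_group X" and f: "balanced B M N X f"
    and Sf: "balanced B M N (tensor B M N) (\<lambda>x y. pure_tensor B M N (S x) (T y))"
    and S: "\<And>x. x \<in> carrier M \<Longrightarrow> S x \<in> carrier M"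
    and T: "\<And>y. y \<in> carrier N \<Longrightarrow> T y \<in> carrier N"
    and op: "add_hom X X op"
    and op_f: "\<And>x y. \<lbrakk>x \<in> carrier M; y \<in> carrier N\<rbrakk> \<Longrightarrow> op (f x y) = f (S x) (T y)"
    and surj: "\<xi> \<in> tensor_extend B M N X f ` carrier (tensor B M N)"
  shows "(tensor_extend B M N X f \<circ> tensor_map B M N S T \<circ>
     inv_into (carrier (tensor B M N)) (tensor_extend B M N X f)) \<xi> = op \<xi>"
proof -
  let ?v = "tensor_extend B M N X f"
  define t where "t = inv_into (carrier (tensor B M N)) ?v \<xi>"
  have t: "t \<in> carrier (tensor B M N)" "?v t = \<xi>"
    using surj by (auto simp: t_def inv_into_into f_inv_into_f)
  \<comment> \<open>Both sides are additive in t, and on pure tensors they agree by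
    \<open>op_f\<close>. At the preimage chosen by \<open>inv_into\<close> the argument of
    \<open>op\<close> is the given vector.\<close>
  have "?v (tensor_map B M N S T t) = op (?v t)"
  proof (rule T.add_hom_eqI[OF X, folded tensor_def])
    show "add_hom (tensor B M N) X (\<lambda>t. ?v (tensor_map B M N S T t))"
      unfolding tensor_map_def
      by (rule add_hom_comp[OF tensor_extend(1)[OF abelian_group_tensor Sf] tensor_extend(1)[OF X f]])
    show "add_hom (tensor B M N) X (\<lambda>t. op (?v t))"
      by (rule add_hom_comp[OF tensor_extend(1)[OF X f] op])
  next
    fix s assume "s \<in> tensor_gens M N"
    then obtain x y where s: "s = (x, y)" "x \<in> carrier M" "y \<in> carrier N"
      by (auto simp: tensor_gens_def)
    show "?v (tensor_map B M N S T (gen (tensor_gens M N) (tensor_rels B M N) s)) =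
      op (?v (gen (tensor_gens M N) (tensor_rels B M N) s))"
      using s S T tensor_extend(2)[OF X f] tensor_extend(2)[OF abelian_group_tensor Sf] op_f
      by (simp add: tensor_map_def flip: pure_tensor_def)
  qed (rule t)
  then show ?thesis
    by (simp add: t_def[symmetric] t)
qed

end

section \<open>Modules of words\<close>

lemma word_gens_Cons:
  "p # w \<in> word_gens M W \<longleftrightarrow> fst p # map fst w \<in> W \<and> snd p \<in> carrier (M (fst p)) \<and>
     (\<forall>(k, x)\<in>set w. x \<in> carrier (M k))"
  by (auto simp: word_gens_def)

lemma word_gens_append:
  "u @ v \<in> word_gens M W \<longleftrightarrow> map fst u @ map fst v \<in> W \<and>
     (\<forall>(k, x)\<in>set u. x \<in> carrier (M k)) \<and> (\<forall>(k, x)\<in>set v. x \<in> carrier (M k))"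
  by (auto simp: word_gens_def)

text \<open>The analogue of \<open>balanced\<close> for any number of factors: additivity in each
  entry and the passage of B between neighbours mirror the two families in \<open>word_rels\<close>,
  so such a function descends to the word module.\<close>

definition compat ::
  "'d set \<Rightarrow> ('k \<Rightarrow> ('d, 'x) bimod) \<Rightarrow> 'k list set \<Rightarrow> ('z, 'm) ring_scheme \<Rightarrow>
   (('k \<times> 'x) list \<Rightarrow> 'z) \<Rightarrow> bool" where
  "compat B M W G f \<longleftrightarrow> (\<forall>w\<in>word_gens M W. f w \<in> carrier G) \<and>
     (\<forall>u k x y v. u @ (k, x) # v \<in> word_gens M W \<longrightarrow> u @ (k, y) # v \<in> word_gens M W \<longrightarrow>
        f (u @ (k, x \<oplus>\<^bsub>M k\<^esub> y) # v) = f (u @ (k, x) # v) \<oplus>\<^bsub>G\<^esub> f (u @ (k, y) # v)) \<and>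
     (\<forall>u k x b l y v. b \<in> B \<longrightarrow> u @ (k, x) # (l, y) # v \<in> word_gens M W \<longrightarrow>
        f (u @ (k, ract (M k) x b) # (l, y) # v) = f (u @ (k, x) # (l, lact (M l) b y) # v))"

lemma compatI:
  assumes "\<And>w. w \<in> word_gens M W \<Longrightarrow> f w \<in> carrier G"
    and "\<And>u k x y v. \<lbrakk>u @ (k, x) # v \<in> word_gens M W; u @ (k, y) # v \<in> word_gens M W\<rbrakk> \<Longrightarrow>
        f (u @ (k, x \<oplus>\<^bsub>M k\<^esub> y) # v) = f (u @ (k, x) # v) \<oplus>\<^bsub>G\<^esub> f (u @ (k, y) # v)"
    and "\<And>u k x b l y v. \<lbrakk>b \<in> B; u @ (k, x) # (l, y) # v \<in> word_gens M W\<rbrakk> \<Longrightarrow>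
        f (u @ (k, ract (M k) x b) # (l, y) # v) = f (u @ (k, x) # (l, lact (M l) b y) # v)"
  shows "compat B M W G f"
  unfolding compat_def using assms by simp

lemma compat_closed: "compat B M W G f \<Longrightarrow> w \<in> word_gens M W \<Longrightarrow> f w \<in> carrier G"
  by (simp add: compat_def)

lemma compat_add:
  "\<lbrakk>compat B M W G f; u @ (k, x) # v \<in> word_gens M W; u @ (k, y) # v \<in> word_gens M W\<rbrakk> \<Longrightarrow>
    f (u @ (k, x \<oplus>\<^bsub>M k\<^esub> y) # v) = f (u @ (k, x) # v) \<oplus>\<^bsub>G\<^esub> f (u @ (k, y) # v)"
  by (simp add: compat_def)

lemma compat_balanced:
  "\<lbrakk>compat B M W G f; b \<in> B; u @ (k, x) # (l, y) # v \<in> word_gens M W\<rbrakk> \<Longrightarrow>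
    f (u @ (k, ract (M k) x b) # (l, y) # v) = f (u @ (k, x) # (l, lact (M l) b y) # v)"
  by (simp add: compat_def)

lemma compat_sum:
  assumes "abelian_group G" "compat B M W G f" "compat B M W G g"
  shows "compat B M W G (\<lambda>w. f w \<oplus>\<^bsub>G\<^esub> g w)"
proof -
  interpret abelian_group G by fact
  note f = compat_closed[OF assms(2)] and g = compat_closed[OF assms(3)]
  show ?thesis
    by (rule compatI)
      (simp_all add: f g a_ac compat_add[OF assms(2)] compat_add[OF assms(3)]
        compat_balanced[OF assms(2)] compat_balanced[OF assms(3)])
qed

lemma compat_comp:
  assumes "compat B M W G f" "add_hom G H h"
  shows "compat B M W H (\<lambda>w. h (f w))"
  using assms by (auto simp: compat_def add_hom_def Pi_iff)

lemma lact_hd_Cons [simp]: "lact_hd M b ((k, x) # w) = (k, lact (M k) b x) # w"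
  by (simp add: lact_hd_def)

lemma lact_hd_append: "u \<noteq> [] \<Longrightarrow> lact_hd M b (u @ v) = lact_hd M b u @ v"
  by (cases u) (auto simp: lact_hd_def split: prod.splits)

lemma ract_last_snoc [simp]: "ract_last M (w @ [(k, x)]) b = w @ [(k, ract (M k) x b)]"
  by (simp add: ract_last_def)

lemma ract_last_single [simp]: "ract_last M [(k, x)] b = [(k, ract (M k) x b)]"
  by (simp add: ract_last_def)

lemma ract_last_append: "v \<noteq> [] \<Longrightarrow> ract_last M (u @ v) b = u @ ract_last M v b"
  by (simp add: ract_last_def butlast_append split: prod.splits)

lemma ract_last_Cons: "v \<noteq> [] \<Longrightarrow> ract_last M (p # v) b = p # ract_last M v b"
  using ract_last_append[of v M "[p]" b] by simp

lemma map_fst_acts [simp]: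
  "w \<noteq> [] \<Longrightarrow> map fst (lact_hd M b w) = map fst w"
  "w \<noteq> [] \<Longrightarrow> map fst (ract_last M w b) = map fst w"
  by (cases w; auto simp: lact_hd_def split: prod.splits)
    (cases w rule: rev_cases; auto simp: ract_last_def split: prod.splits)

lemma acts_Nil_iff [simp]:
  "w \<noteq> [] \<Longrightarrow> lact_hd M b w \<noteq> []" "w \<noteq> [] \<Longrightarrow> ract_last M w b \<noteq> []"
  by (auto simp: lact_hd_def ract_last_def split: prod.splits)

locale bimodule_family =
  fixes B :: "'d::complex_algebra_1 set" and K :: "'k set" and M :: "'k \<Rightarrow> ('d, 'x) bimod"
  assumes B: "unital_subalgebra B" and M: "\<And>k. k \<in> K \<Longrightarrow> bimodule B (M k)"

text \<open>The set W is left abstract since three sets of words occur: all alternating words, those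
  not beginning with a given index, and those not ending with it.\<close>

locale word_family = bimodule_family B K M
  for B :: "'d::complex_algebra_1 set" and K :: "'k set" and M :: "'k \<Rightarrow> ('d, 'x) bimod" +
  fixes W :: "'k list set"
  assumes W: "\<And>ks. ks \<in> W \<Longrightarrow> ks \<noteq> [] \<and> set ks \<subseteq> K"
begin

abbreviation "G \<equiv> word_gens M W"
abbreviation "N \<equiv> word_module B M W"
abbreviation "wt \<equiv> word_tensor B M W"

lemma gens_not_Nil: "w \<in> G \<Longrightarrow> w \<noteq> []"
  using W by (auto simp: word_gens_def)

lemma gens_M: "u @ (k, x) # v \<in> G \<Longrightarrow> bimodule B (M k) \<and> x \<in> carrier (M k)"
  using W M by (force simp: word_gens_def)

lemma gens_replace:
  "u @ (k, x) # v \<in> G \<Longrightarrow> y \<in> carrier (M k) \<Longrightarrow> u @ (k, y) # v \<in> G"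
  by (simp add: word_gens_def)

lemma gens_add:
  assumes "u @ (k, x) # v \<in> G" "u @ (k, y) # v \<in> G"
  shows "u @ (k, x \<oplus>\<^bsub>M k\<^esub> y) # v \<in> G"
proof -
  interpret abelian_group "M k" using gens_M[OF assms(1)] bimoduleD(1) by blast
  show ?thesis using gens_replace[OF assms(1)] gens_M[OF assms(1)] gens_M[OF assms(2)] by simp
qed

lemma gens_ract: "u @ (k, x) # v \<in> G \<Longrightarrow> b \<in> B \<Longrightarrow> u @ (k, ract (M k) x b) # v \<in> G"
  using gens_replace[of u k x v "ract (M k) x b"] gens_M[of u k x v] by (simp add: bimoduleD(3)[of B])

lemma gens_lact: "u @ (k, x) # v \<in> G \<Longrightarrow> b \<in> B \<Longrightarrow> u @ (k, lact (M k) b x) # v \<in> G"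
  using gens_replace[of u k x v "lact (M k) b x"] gens_M[of u k x v] by (simp add: bimoduleD(2)[of B])

lemma gens_lact2: "u @ p # (k, x) # v \<in> G \<Longrightarrow> b \<in> B \<Longrightarrow> u @ p # (k, lact (M k) b x) # v \<in> G"
  using gens_lact[of "u @ [p]"] by simp

lemma lact_hd_gens: "w \<in> G \<Longrightarrow> b \<in> B \<Longrightarrow> lact_hd M b w \<in> G"
  using gens_lact[of "[]"] gens_not_Nil[of w] by (cases w) auto

lemma ract_last_gens: "w \<in> G \<Longrightarrow> b \<in> B \<Longrightarrow> ract_last M w b \<in> G"
  using gens_ract[of _ _ _ "[]"] gens_not_Nil[of w] by (cases w rule: rev_cases) auto

sublocale pres: presentation "word_gens M W" "word_rels B M W"
proof
  show "word_rels B M W \<subseteq> carrier (free_Abelian_group G)"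
    unfolding word_rels_def
    by (auto dest!: subsetD[OF keys_diff] simp: gens_add gens_ract gens_lact2)
qed

lemma N_simps [simp]:
  "carrier pres.P = carrier N" "\<zero>\<^bsub>pres.P\<^esub> = \<zero>\<^bsub>N\<^esub>" "add pres.P = add N"
  by (simp_all add: word_module_def Let_def)

sublocale N: abelian_group N
proof (rule abelian_groupI)
  show "\<exists>y\<in>carrier N. y \<oplus>\<^bsub>N\<^esub> x = \<zero>\<^bsub>N\<^esub>" if "x \<in> carrier N" for x
    using pres.P.l_neg[of x] pres.P.a_inv_closed[of x] that by auto
qed (use pres.P.a_assoc pres.P.a_comm pres.P.l_zero pres.P.a_closed pres.P.zero_closed in auto)

lemma add_hom_N [simp]: "add_hom pres.P X h \<longleftrightarrow> add_hom N X h"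
  by (simp add: add_hom_def)

lemma word_tensor_closed: "w \<in> G \<Longrightarrow> wt w \<in> carrier N"
  using pres.gen_closed by (simp add: word_tensor_def)

lemma word_tensor_compat: "compat B M W N wt"
  unfolding word_tensor_def
proof (rule compatI, goal_cases)
  case (1 w)
  then show ?case using pres.gen_closed by simp
next
  case (2 u k x y v)
  then have "frag_of (u @ (k, x \<oplus>\<^bsub>M k\<^esub> y) # v) - frag_of (u @ (k, x) # v) - frag_of (u @ (k, y) # v)
     \<in> word_rels B M W"
    unfolding word_rels_def by blast
  then show ?case
    using 2 pres.gen_add gens_add by simp
next
  case (3 u k x b l y v)
  then have "frag_of (u @ (k, ract (M k) x b) # (l, y) # v) -
      frag_of (u @ (k, x) # (l, lact (M l) b y) # v) \<in> word_rels B M W"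
    unfolding word_rels_def by blast
  then show ?case
    using 3 pres.gen_eq gens_ract gens_lact2 by simp
qed

lemma word_extend:
  assumes X: "abelian_group X" and f: "compat B M W X f"
  shows "add_hom N X (word_extend B M W X f)"
    and "w \<in> G \<Longrightarrow> word_extend B M W X f (wt w) = f w"
proof -
  interpret X: abelian_group X by fact
  have gens: "f \<in> G \<rightarrow> carrier X"
    using compat_closed[OF f] by blast
  have kills: "h \<rho> = \<zero>\<^bsub>X\<^esub>"
    if h: "\<And>s. s \<in> G \<Longrightarrow> h (frag_of s) = f s"
      and hd: "\<And>a b. \<lbrakk>a \<in> carrier (free_Abelian_group G); b \<in> carrier (free_Abelian_group G)\<rbrakk> \<Longrightarrow>
        h (a - b) = h a \<ominus>\<^bsub>X\<^esub> h b"
      and \<rho>: "\<rho> \<in> word_rels B M W" for h \<rho>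
  proof -
    have k: "Poly_Mapping.keys (frag_of s - frag_of t) \<subseteq> G" if "s \<in> G" "t \<in> G" for s t
      using that keys_diff[of "frag_of s" "frag_of t"] by auto
    from \<rho> consider
        u k x y v where "u @ (k, x) # v \<in> G" "u @ (k, y) # v \<in> G"
          "\<rho> = frag_of (u @ (k, x \<oplus>\<^bsub>M k\<^esub> y) # v) - frag_of (u @ (k, x) # v) - frag_of (u @ (k, y) # v)"
      | u k x b l y v where "b \<in> B" "u @ (k, x) # (l, y) # v \<in> G"
          "\<rho> = frag_of (u @ (k, ract (M k) x b) # (l, y) # v) - frag_of (u @ (k, x) # (l, lact (M l) b y) # v)"
      unfolding word_rels_def by auto
    then show ?thesis
    proof cases
      case 1 then show ?thesis
        by (simp add: hd k h gens_add compat_add[OF f] compat_closed[OF f] X.add_minus_minus)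
    next
      case 2 then show ?thesis
        by (simp add: hd h gens_ract gens_lact2 compat_balanced[OF f] compat_closed[OF f]
            a_minus_def X.r_neg)
    qed
  qed
  show "add_hom N X (word_extend B M W X f)"
    unfolding word_extend_def add_hom_N[symmetric]
    by (rule pres.extend_add_hom(1)[OF X gens]) (blast intro: kills)
  show "w \<in> G \<Longrightarrow> word_extend B M W X f (wt w) = f w"
    unfolding word_tensor_def word_extend_def
    by (rule pres.extend_add_hom(2)[OF X gens]) (blast intro: kills)
qed

lemma word_hom_eqI:
  assumes "abelian_group X" "add_hom N X h" "add_hom N X g"
    and "\<And>w. w \<in> G \<Longrightarrow> h (wt w) = g (wt w)" and "\<xi> \<in> carrier N"
  shows "h \<xi> = g \<xi>"
  by (rule pres.add_hom_eqI[of X]) (use assms in \<open>simp_all add: word_tensor_def\<close>)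

text \<open>The action touches the head alone, so only relations at the head require something of
  \<open>M k\<close>: additivity of its left action, and, for a balancing relation between the first
  two entries, that its left and right actions commute.\<close>

lemma lact_hd_compat:
  assumes b: "b \<in> B"
  shows "compat B M W N (\<lambda>w. wt (lact_hd M b w))"
proof (rule compatI, goal_cases)
  case (1 w)
  then show ?case using b by (intro word_tensor_closed lact_hd_gens)
next
  case (2 u k x y v)
  then have Mk: "bimodule B (M k)" "x \<in> carrier (M k)" "y \<in> carrier (M k)"
    using gens_M by blast+
  show ?case
  proof (cases "u = []")
    case True
    then show ?thesis
      using lact_hd_gens[OF 2(1) b] lact_hd_gens[OF 2(2) b] compat_add[OF word_tensor_compat, of "[]"]
      by (simp add: bimoduleD(4)[OF Mk(1) b] Mk)
  next
    case False
    then show ?thesis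
      using lact_hd_gens[OF 2(1) b] lact_hd_gens[OF 2(2) b]
      by (simp add: lact_hd_append compat_add[OF word_tensor_compat])
  qed
next
  case (3 u k x c l y v)
  then have Mk: "bimodule B (M k)" "x \<in> carrier (M k)"
    using gens_M by blast+
  show ?case
  proof (cases "u = []")
    case True
    then show ?thesis
      using lact_hd_gens[OF 3(2) b] compat_balanced[OF word_tensor_compat 3(1), of "[]"]
      by (simp add: bimoduleD(10)[OF Mk(1) b 3(1) Mk(2), symmetric])
  next
    case False
    then show ?thesis
      using lact_hd_gens[OF 3(2) b] 3(1)
      by (simp add: lact_hd_append compat_balanced[OF word_tensor_compat])
  qed
qed

text \<open>The mirror image: relations at the last entry matter, and a balancing relation between
  the last two entries uses that both actions on the last factor commute.\<close>

lemma ract_last_compat: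
  assumes b: "b \<in> B"
  shows "compat B M W N (\<lambda>w. wt (ract_last M w b))"
proof (rule compatI, goal_cases)
  case (1 w)
  then show ?case using b by (intro word_tensor_closed ract_last_gens)
next
  case (2 u k x y v)
  then have Mk: "bimodule B (M k)" "x \<in> carrier (M k)" "y \<in> carrier (M k)"
    using gens_M by blast+
  show ?case
  proof (cases "v = []")
    case True
    then show ?thesis
      using ract_last_gens[OF 2(1) b] ract_last_gens[OF 2(2) b]
        compat_add[OF word_tensor_compat, of u _ _ "[]"]
      by (simp add: bimoduleD(5)[OF Mk(1) b] Mk)
  next
    case False
    then show ?thesis
      using ract_last_gens[OF 2(1) b] ract_last_gens[OF 2(2) b]
      by (simp add: ract_last_append ract_last_Cons compat_add[OF word_tensor_compat])
  qed
next
  case (3 u k x c l y v)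
  then have Ml: "bimodule B (M l)" "y \<in> carrier (M l)"
    using gens_M[of "u @ [(k, x)]" l y v] by auto
  have snoc: "ract_last M (u @ [p, (l, z)]) b = u @ [p, (l, ract (M l) z b)]" for p z
    using ract_last_snoc[of M "u @ [p]" l z b] by simp
  show ?case
  proof (cases "v = []")
    case True
    then show ?thesis
      using ract_last_gens[OF 3(2) b] compat_balanced[OF word_tensor_compat 3(1), of u k x l _ "[]"]
      by (simp add: snoc bimoduleD(10)[OF Ml(1) 3(1) b Ml(2)])
  next
    case False
    then show ?thesis
      using ract_last_gens[OF 3(2) b] 3(1)
      by (simp add: ract_last_append ract_last_Cons compat_balanced[OF word_tensor_compat])
  qed
qed

text \<open>In \<open>word_module\<close> the actions are extended with the presented group as
  target. \<open>extend\<close> reads only the carrier and the addition of its target, and these are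
  shared by \<open>N\<close>.\<close>

lemma N_acts:
  "lact N b = word_extend B M W N (\<lambda>w. wt (lact_hd M b w))"
  "ract N \<xi> b = word_extend B M W N (\<lambda>w. wt (ract_last M w b)) \<xi>"
proof -
  have "word_extend B M W pres.P f = word_extend B M W N f" for f
    by (simp add: word_extend_def extend_def)
  then show "lact N b = word_extend B M W N (\<lambda>w. wt (lact_hd M b w))"
    "ract N \<xi> b = word_extend B M W N (\<lambda>w. wt (ract_last M w b)) \<xi>"
    by (subst word_module_def, simp add: Let_def)+
qed

lemma lact_hom: "b \<in> B \<Longrightarrow> add_hom N N (lact N b)"
  unfolding N_acts by (rule word_extend(1)[OF N.abelian_group_axioms lact_hd_compat])

lemma ract_hom: "b \<in> B \<Longrightarrow> add_hom N N (\<lambda>\<xi>. ract N \<xi> b)"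
  unfolding N_acts by (rule word_extend(1)[OF N.abelian_group_axioms ract_last_compat])

lemma lact_wt: "b \<in> B \<Longrightarrow> w \<in> G \<Longrightarrow> lact N b (wt w) = wt (lact_hd M b w)"
  unfolding N_acts by (rule word_extend(2)[OF N.abelian_group_axioms lact_hd_compat])

lemma ract_wt: "b \<in> B \<Longrightarrow> w \<in> G \<Longrightarrow> ract N (wt w) b = wt (ract_last M w b)"
  unfolding N_acts by (rule word_extend(2)[OF N.abelian_group_axioms ract_last_compat])

lemma gens_hd: 
  assumes "w \<in> G"
  obtains k x v where "w = (k, x) # v" "bimodule B (M k)" "x \<in> carrier (M k)"
proof (cases w)
  case (Cons p v)
  then show ?thesis using that[of "fst p" "snd p" v] gens_M[of "[]" "fst p" "snd p" v] assms by simp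
qed (use gens_not_Nil assms in blast)

lemma gens_last:
  assumes "w \<in> G"
  obtains k x v where "w = v @ [(k, x)]" "bimodule B (M k)" "x \<in> carrier (M k)"
proof (cases w rule: rev_cases)
  case (snoc v p)
  then show ?thesis using that[of v "fst p" "snd p"] gens_M[of v "fst p" "snd p" "[]"] assms by simp
qed (use gens_not_Nil assms in blast)

lemma acts_commute:
  assumes "w \<in> G" "b \<in> B" "c \<in> B"
  shows "ract_last M (lact_hd M b w) c = lact_hd M b (ract_last M w c)"
proof -
  obtain k x v where w: "w = (k, x) # v" "bimodule B (M k)" "x \<in> carrier (M k)"
    using gens_hd[OF assms(1)] .
  show ?thesis
    using w assms by (cases "v = []") (simp_all add: bimoduleD(10)[OF w(2)] ract_last_Cons)
qed

lemma wt_add: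
  "\<lbrakk>u @ (k, x) # v \<in> G; y \<in> carrier (M k)\<rbrakk> \<Longrightarrow>
    wt (u @ (k, x \<oplus>\<^bsub>M k\<^esub> y) # v) = wt (u @ (k, x) # v) \<oplus>\<^bsub>N\<^esub> wt (u @ (k, y) # v)"
  using compat_add[OF word_tensor_compat] gens_replace by blast

lemma wt_zero:
  assumes "u @ (k, \<zero>\<^bsub>M k\<^esub>) # v \<in> G"
  shows "wt (u @ (k, \<zero>\<^bsub>M k\<^esub>) # v) = \<zero>\<^bsub>N\<^esub>"
proof -
  interpret Mk: abelian_group "M k" using gens_M[OF assms] bimoduleD(1) by blast
  show ?thesis
    using wt_add[OF assms Mk.zero_closed] word_tensor_closed[OF assms] by (simp add: N.idem_zero)
qed

lemma lact_hd_add: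
  assumes "w \<in> G" "b \<in> B" "c \<in> B"
  shows "wt (lact_hd M (b + c) w) = wt (lact_hd M b w) \<oplus>\<^bsub>N\<^esub> wt (lact_hd M c w)"
proof -
  obtain k x v where w: "w = (k, x) # v" "bimodule B (M k)" "x \<in> carrier (M k)"
    using gens_hd[OF assms(1)] .
  show ?thesis
    using lact_hd_gens[OF assms(1,2)] assms w wt_add[of "[]" k "lact (M k) b x" v "lact (M k) c x"]
    by (simp add: bimoduleD(2,6)[OF w(2)])
qed

lemma ract_last_add:
  assumes "w \<in> G" "b \<in> B" "c \<in> B"
  shows "wt (ract_last M w (b + c)) = wt (ract_last M w b) \<oplus>\<^bsub>N\<^esub> wt (ract_last M w c)"
proof -
  obtain k x v where w: "w = v @ [(k, x)]" "bimodule B (M k)" "x \<in> carrier (M k)"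
    using gens_last[OF assms(1)] .
  show ?thesis
    using ract_last_gens[OF assms(1,2)] assms w wt_add[of v k "ract (M k) x b" "[]" "ract (M k) x c"]
    by (simp add: bimoduleD(3,7)[OF w(2)])
qed

lemma acts_mult:
  assumes "w \<in> G" "b \<in> B" "c \<in> B"
  shows "lact_hd M (b * c) w = lact_hd M b (lact_hd M c w)"
    and "ract_last M w (b * c) = ract_last M (ract_last M w b) c"
proof -
  obtain k x v where w: "w = (k, x) # v" "bimodule B (M k)" "x \<in> carrier (M k)"
    using gens_hd[OF assms(1)] .
  show "lact_hd M (b * c) w = lact_hd M b (lact_hd M c w)"
    using w(1,3) assms by (simp add: bimoduleD(8)[OF w(2)])
next
  obtain k x v where w: "w = v @ [(k, x)]" "bimodule B (M k)" "x \<in> carrier (M k)"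
    using gens_last[OF assms(1)] .
  show "ract_last M w (b * c) = ract_last M (ract_last M w b) c"
    using w(1,3) assms by (simp add: bimoduleD(9)[OF w(2)])
qed

lemma acts_one:
  assumes "w \<in> G"
  shows "lact_hd M 1 w = w" "ract_last M w 1 = w"
proof -
  obtain k x v where w: "w = (k, x) # v" "bimodule B (M k)" "x \<in> carrier (M k)"
    using gens_hd[OF assms(1)] .
  show "lact_hd M 1 w = w"
    using w(1,3) by (simp add: bimoduleD(11)[OF w(2)])
next
  obtain k x v where w: "w = v @ [(k, x)]" "bimodule B (M k)" "x \<in> carrier (M k)"
    using gens_last[OF assms(1)] .
  show "ract_last M w 1 = w"
    using w(1,3) by (simp add: bimoduleD(12)[OF w(2)])
qed

lemma scalar_in_B: "z *\<^sub>C 1 \<in> B"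
  using subalgebraD(2,5)[OF B] by blast

text \<open>A complex scalar acts alike on both sides of each single factor, so it can be switched
  from left to right there and then handed to the next factor by balancing, until it reaches the end
  of the word.\<close>

lemma acts_scalar:
  assumes "w \<in> G"
  shows "wt (lact_hd M (z *\<^sub>C 1) w) = wt (ract_last M w (z *\<^sub>C 1))"
proof -
  \<comment> \<open>The prefix u collects the entries that the scalar has already passed.\<close>
  have *: "wt (u @ (k, lact (M k) (z *\<^sub>C 1) x) # v) = wt (u @ ract_last M ((k, x) # v) (z *\<^sub>C 1))"
    if "u @ (k, x) # v \<in> G" for u k x v
    using that
  proof (induction v arbitrary: u k x)
    case Nil
    then show ?case using gens_M[OF Nil] by (simp add: bimoduleD(13)[of B])
  next
    case (Cons p v)
    obtain l y where p: "p = (l, y)" by (cases p)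
    have "wt (u @ (k, lact (M k) (z *\<^sub>C 1) x) # p # v) = wt ((u @ [(k, x)]) @ (l, lact (M l) (z *\<^sub>C 1) y) # v)"
      using Cons.prems gens_M[OF Cons.prems] scalar_in_B
        compat_balanced[OF word_tensor_compat, of "z *\<^sub>C 1" u k x l y v]
      by (simp add: p bimoduleD(13)[of B])
    also have "\<dots> = wt ((u @ [(k, x)]) @ ract_last M ((l, y) # v) (z *\<^sub>C 1))"
      using Cons.prems by (intro Cons.IH) (simp add: p)
    finally show ?case
      by (simp add: p ract_last_Cons)
  qed
  obtain k x v where w: "w = (k, x) # v"
    using gens_hd[OF assms(1)] .
  show ?thesis
    using *[of "[]" k x v] assms w by simp
qed

lemmas N_hom_eqI = word_hom_eqI[OF N.abelian_group_axioms]

text \<open>Each law is an equation between additive maps, so it suffices to check it on words,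
  where it reduces to a law for the first or the last entry.\<close>

lemma bimodule_N: "bimodule B N"
proof -
  note acts_N = lact_wt ract_wt lact_hd_gens ract_last_gens
  note comp = add_hom_comp[OF lact_hom lact_hom] add_hom_comp[OF ract_hom ract_hom]
    add_hom_comp[OF lact_hom ract_hom] add_hom_comp[OF ract_hom lact_hom]
  note sum = add_hom_sum[OF N.abelian_group_axioms lact_hom lact_hom]
    add_hom_sum[OF N.abelian_group_axioms ract_hom ract_hom]
  note B_simps = subalgebraD(2-4)[OF B] scalar_in_B
  show ?thesis
    unfolding bimodule_def
  proof (intro conjI ballI allI)
    show "lact N (b + c) \<xi> = lact N b \<xi> \<oplus>\<^bsub>N\<^esub> lact N c \<xi>" "lact N (b * c) \<xi> = lact N b (lact N c \<xi>)"
      "ract N \<xi> (b + c) = ract N \<xi> b \<oplus>\<^bsub>N\<^esub> ract N \<xi> c" "ract N \<xi> (b * c) = ract N (ract N \<xi> b) c"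
      "ract N (lact N b \<xi>) c = lact N b (ract N \<xi> c)"
      if "b \<in> B" "c \<in> B" "\<xi> \<in> carrier N" for b c \<xi>
      by (rule N_hom_eqI[OF _ _ _ that(3)];
          simp add: that B_simps lact_hom ract_hom comp sum acts_N lact_hd_add ract_last_add acts_mult
            acts_commute)+
    show "lact N 1 \<xi> = \<xi>" "ract N \<xi> 1 = \<xi>" "lact N (z *\<^sub>C 1) \<xi> = ract N \<xi> (z *\<^sub>C 1)"
      if "\<xi> \<in> carrier N" for z \<xi>
      by (rule N_hom_eqI[OF _ _ _ that];
          simp add: B_simps lact_hom ract_hom add_hom_id acts_N acts_one acts_scalar)+
  qed (use N.abelian_group_axioms add_hom_closed[OF lact_hom] add_hom_closed[OF ract_hom]
      add_hom_add[OF lact_hom] add_hom_add[OF ract_hom] in auto)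
qed

text \<open>Used with a single letter for u or for v, this makes tensoring with a fixed vector on
  one side a well-defined map.\<close>

lemma insert_compat:
  assumes X: "word_family B K M W'" and "\<And>w. w \<in> word_gens M W' \<Longrightarrow> u @ w @ v \<in> G"
  shows "compat B M W' N (\<lambda>w. wt (u @ w @ v))"
proof -
  interpret W': word_family B K M W' by fact
  show ?thesis
  proof (rule compatI, goal_cases)
    case (1 w)
    then show ?case using assms by (intro word_tensor_closed)
  next
    case (2 u' k x y v')
    then show ?case
      using compat_add[OF word_tensor_compat, of "u @ u'" k x "v' @ v" y] assms by force
  next
    case (3 u' k x b l y v')
    then show ?case
      using compat_balanced[OF word_tensor_compat, of b "u @ u'" k x l y "v' @ v"] assms by force
  qed
qed

end

section \<open>The left regular representations on a free product\<close>

type_synonym ('d, 'k, 'x) vector = "'d \<times> (('k \<times> 'x) list \<Rightarrow>\<^sub>0 int) set"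

text \<open>The vectors \<open>prefix_vec\<close> and \<open>suffix_vec\<close> are defined by cases
  on the empty word, which lies outside the word modules; only the nonempty case matters
  here.\<close>

lemma compat_cong:
  assumes "[] \<notin> W" "\<And>w. w \<noteq> [] \<Longrightarrow> f w = g w" "compat B M W X g"
  shows "compat B M W X f"
proof -
  have "w \<noteq> []" if "w \<in> word_gens M W" for w
    using that assms(1) by (auto simp: word_gens_def)
  then show ?thesis
    using assms(2,3) by (simp add: compat_def)
qed

lemma compat_subset:
  assumes "W' \<subseteq> W" "compat B M W X f"
  shows "compat B M W' X f"
proof -
  have "w \<in> word_gens M W" if "w \<in> word_gens M W'" for w
    using that assms(1) by (auto simp: word_gens_def)
  then show ?thesis
    using assms(2) by (simp add: compat_def)
qed

lemma operatorsD:
  assumes "T \<in> operators X"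
  shows "x \<in> carrier X \<Longrightarrow> T x \<in> carrier X"
    "\<lbrakk>x \<in> carrier X; y \<in> carrier X\<rbrakk> \<Longrightarrow> T (x \<oplus>\<^bsub>X\<^esub> y) = T x \<oplus>\<^bsub>X\<^esub> T y"
  using assms by (auto simp: operators_def)

lemma left_operatorsD:
  assumes "T \<in> left_operators B X"
  shows "T \<in> operators X"
    "\<lbrakk>b \<in> B; x \<in> carrier X\<rbrakk> \<Longrightarrow> T (ract X x b) = ract X (T x) b"
  using assms by (auto simp: left_operators_def)

lemma right_operatorsD:
  assumes "T \<in> right_operators B X"
  shows "T \<in> operators X"
    "\<lbrakk>b \<in> B; x \<in> carrier X\<rbrakk> \<Longrightarrow> T (lact X b x) = lact X b (T x)"
  using assms by (auto simp: right_operators_def)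

context bimodule_family
begin

sublocale A: word_family B K M "alt_words K"
  by standard (auto simp: alt_words_def)

lemma word_family_hd: "word_family B K M (alt_words_hd K k)"
  by unfold_locales (auto simp: alt_words_hd_def alt_words_def)

lemma word_family_last: "word_family B K M (alt_words_last K k)"
  by unfold_locales (auto simp: alt_words_last_def alt_words_def)

abbreviation "X \<equiv> free_product B K M"
abbreviation "Xk k \<equiv> B_plus B (M k)"
abbreviation "vac k \<equiv> (1, \<zero>\<^bsub>M k\<^esub>)"

lemma X_simps [simp]:
  "carrier X = B \<times> carrier A.N"
  "\<zero>\<^bsub>X\<^esub> = (0, \<zero>\<^bsub>A.N\<^esub>)"
  "(b, \<eta>) \<oplus>\<^bsub>X\<^esub> (c, \<xi>) = (b + c, \<eta> \<oplus>\<^bsub>A.N\<^esub> \<xi>)"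
  "lact X d (b, \<eta>) = (d * b, lact A.N d \<eta>)"
  "ract X (b, \<eta>) d = (b * d, ract A.N \<eta> d)"
  by (simp_all add: free_product_def)

lemmas abelian_group_AN = A.N.abelian_group_axioms

lemma bimodule_X: "bimodule B X"
  unfolding free_product_def by (rule bimodule_B_plus[OF B A.bimodule_N])

lemma bimodule_Xk: "k \<in> K \<Longrightarrow> bimodule B (Xk k)"
  by (rule bimodule_B_plus[OF B M])

sublocale X: abelian_group X
  by (rule bimoduleD(1)[OF bimodule_X])

lemma B_simps [simp]: "0 \<in> B" "1 \<in> B" "x \<in> B \<Longrightarrow> y \<in> B \<Longrightarrow> x + y \<in> B" "x \<in> B \<Longrightarrow> y \<in> B \<Longrightarrow> x * y \<in> B"
  using subalgebraD[OF B] by auto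

lemma zero_Mk [simp]: "k \<in> K \<Longrightarrow> \<zero>\<^bsub>M k\<^esub> \<in> carrier (M k)"
  using abelian_group.axioms(1)[OF bimoduleD(1)[OF M]] abelian_monoid.zero_closed by blast

lemma Cons_gens_iff:
  "(k, x) # w \<in> A.G \<longleftrightarrow> k \<in> K \<and> x \<in> carrier (M k) \<and> (w = [] \<or> w \<in> word_gens M (alt_words_hd K k))"
  by (cases w) (auto simp: word_gens_Cons alt_words_def alt_words_hd_def distinct_adj_Cons)

lemma hd_gens_iff: "(j, x) # w \<in> word_gens M (alt_words_hd K k) \<longleftrightarrow> (j, x) # w \<in> A.G \<and> j \<noteq> k"
  by (auto simp: word_gens_Cons alt_words_hd_def)

lemma hd_gens_subset: "w \<in> word_gens M (alt_words_hd K k) \<Longrightarrow> w \<in> A.G"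
  by (auto simp: alt_words_hd_def word_gens_def)

lemma embed_hom: "add_hom A.N X (\<lambda>\<eta>. (0, \<eta>))"
  by (rule add_homI) auto

lemma X_hom_eqI:
  assumes Y: "abelian_group Y" and h: "add_hom X Y h" and g: "add_hom X Y g"
    and 1: "\<And>b. b \<in> B \<Longrightarrow> h (b, \<zero>\<^bsub>A.N\<^esub>) = g (b, \<zero>\<^bsub>A.N\<^esub>)"
    and 2: "\<And>w. w \<in> A.G \<Longrightarrow> h (0, A.wt w) = g (0, A.wt w)"
    and v: "v \<in> carrier X"
  shows "h v = g v"
proof -
  obtain b \<eta> where v: "v = (b, \<eta>)" "b \<in> B" "\<eta> \<in> carrier A.N" using v by auto
  have "h (0, \<eta>) = g (0, \<eta>)"
    using A.word_hom_eqI[OF Y add_hom_comp[OF embed_hom h] add_hom_comp[OF embed_hom g] 2 v(3)] .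
  then show ?thesis
    using 1[OF v(2)] v add_hom_add[OF h, of "(b, \<zero>\<^bsub>A.N\<^esub>)" "(0, \<eta>)"]
      add_hom_add[OF g, of "(b, \<zero>\<^bsub>A.N\<^esub>)" "(0, \<eta>)"] by simp
qed

text \<open>The image of an additive map is a subgroup, and X is generated as an abelian group by B
  and the word tensors.\<close>

lemma X_hom_surj:
  assumes Y: "abelian_group Y" and h: "add_hom Y X h"
    and 1: "\<And>b. b \<in> B \<Longrightarrow> (b, \<zero>\<^bsub>A.N\<^esub>) \<in> h ` carrier Y"
    and 2: "\<And>w. w \<in> A.G \<Longrightarrow> (0, A.wt w) \<in> h ` carrier Y"
    and v: "v \<in> carrier X"
  shows "v \<in> h ` carrier Y"
proof -
  interpret Y: abelian_group Y by fact
  have add: "x \<oplus>\<^bsub>X\<^esub> y \<in> h ` carrier Y" if xy: "x \<in> h ` carrier Y" "y \<in> h ` carrier Y" for x y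
  proof -
    obtain s t where "s \<in> carrier Y" "t \<in> carrier Y" "x = h s" "y = h t" using xy by blast
    then show ?thesis
      using add_hom_add[OF h, of s t] by (metis Y.a_closed imageI)
  qed
  have minus: "\<ominus>\<^bsub>X\<^esub> x \<in> h ` carrier Y" if x: "x \<in> h ` carrier Y" for x
  proof -
    obtain s where "s \<in> carrier Y" "x = h s" using x by blast
    then show ?thesis
      using add_hom_minus[OF h Y X.abelian_group_axioms, of s] by (metis Y.a_inv_closed imageI)
  qed
  obtain b \<eta> where b\<eta>: "v = (b, \<eta>)" "b \<in> B" "\<eta> \<in> carrier A.N" using v by auto
  have emb: "add_hom A.pres.P X (\<lambda>\<eta>. (0, \<eta>))"
    using embed_hom by simp
  have "\<eta> \<in> carrier A.pres.P" using b\<eta> by simp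
  then have "(0, \<eta>) \<in> h ` carrier Y"
  proof (induction \<eta> rule: A.pres.presented_induct)
    case (gen w)
    then show ?case using 2 by (simp add: word_tensor_def)
  next
    case (minus x)
    then show ?case
      using \<open>\<And>x. x \<in> h ` carrier Y \<Longrightarrow> \<ominus>\<^bsub>X\<^esub> x \<in> h ` carrier Y\<close>
        add_hom_minus[OF emb A.pres.abelian_group_presented X.abelian_group_axioms] by fastforce
  next
    case (add x y)
    then show ?case
      using \<open>\<And>x y. x \<in> h ` carrier Y \<Longrightarrow> y \<in> h ` carrier Y \<Longrightarrow> x \<oplus>\<^bsub>X\<^esub> y \<in> h ` carrier Y\<close>[of "(0, x)" "(0, y)"]
      by simp
  next
    case zero
    then show ?case using 1[of 0] by simp
  qed
  then show ?thesis
    using add[OF 1[OF b\<eta>(2)], of "(0, \<eta>)"] b\<eta> by simp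
qed

text \<open>For \<xi> = a \<oplus> x and w not beginning with k this is the image of \<xi> \<otimes>
  w under the inverse of V_k, namely aw + x \<otimes> w. The empty word stands for the unit of the
  second factor and gives a \<oplus> x, so \<open>prefix_vec k \<xi> []\<close> is the embedding of
  X_k into X.\<close>

definition prefix_vec :: "'k \<Rightarrow> 'd \<times> 'x \<Rightarrow> ('k \<times> 'x) list \<Rightarrow> ('d, 'k, 'x) vector" where
  "prefix_vec k \<xi> w = (if w = [] then (fst \<xi>, A.wt [(k, snd \<xi>)])
     else (0, A.wt (lact_hd M (fst \<xi>) w) \<oplus>\<^bsub>A.N\<^esub> A.wt ((k, snd \<xi>) # w)))"

context
  fixes k assumes k: "k \<in> K"
begin

abbreviation "H \<equiv> word_gens M (alt_words_hd K k)"

interpretation H: word_family B K M "alt_words_hd K k"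
  by (rule word_family_hd)

interpretation Mk: abelian_group "M k"
  by (rule bimoduleD(1)[OF M[OF k]])

lemma Cons_gens: "x \<in> carrier (M k) \<Longrightarrow> w \<in> insert [] H \<Longrightarrow> (k, x) # w \<in> A.G"
  using k by (auto simp: Cons_gens_iff)

lemma lact_hd_gens_H: "w \<in> H \<Longrightarrow> b \<in> B \<Longrightarrow> lact_hd M b w \<in> A.G"
  by (intro A.lact_hd_gens hd_gens_subset)

lemmas closed = A.word_tensor_closed[OF Cons_gens] A.word_tensor_closed[OF lact_hd_gens_H]

lemma prefix_vec_closed:
  "\<xi> \<in> carrier (Xk k) \<Longrightarrow> w \<in> insert [] H \<Longrightarrow> prefix_vec k \<xi> w \<in> carrier X"
  by (auto simp: prefix_vec_def closed)

lemma prefix_vec_add: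
  assumes "\<xi> \<in> carrier (Xk k)" "\<xi>' \<in> carrier (Xk k)" "w \<in> insert [] H"
  shows "prefix_vec k (\<xi> \<oplus>\<^bsub>Xk k\<^esub> \<xi>') w = prefix_vec k \<xi> w \<oplus>\<^bsub>X\<^esub> prefix_vec k \<xi>' w"
proof -
  obtain a x c y where \<xi>: "\<xi> = (a, x)" "\<xi>' = (c, y)" by (cases \<xi>, cases \<xi>')
  then have in_M: "x \<in> carrier (M k)" "y \<in> carrier (M k)" "a \<in> B" "c \<in> B"
    using assms by auto
  show ?thesis
    using A.wt_add[of "[]" k x w y] Cons_gens[OF in_M(1) assms(3)] in_M assms(3)
      A.lact_hd_add[of w a c] hd_gens_subset[of w k]
    by (auto simp: prefix_vec_def \<xi> closed A.N.a_ac)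
qed

lemma prefix_vec_compat:
  assumes "\<xi> \<in> carrier (Xk k)"
  shows "compat B M (alt_words_hd K k) X (prefix_vec k \<xi>)"
proof -
  obtain a x where \<xi>: "\<xi> = (a, x)" by (cases \<xi>)
  have "compat B M (alt_words_hd K k) A.N (\<lambda>w. A.wt (lact_hd M a w))"
    using assms by (intro compat_subset[OF _ A.lact_hd_compat]) (auto simp: \<xi> alt_words_hd_def)
  moreover have "compat B M (alt_words_hd K k) A.N (\<lambda>w. A.wt ((k, x) # w))"
    using A.insert_compat[OF word_family_hd, of k "[(k, x)]" "[]"] Cons_gens assms
    by (simp add: \<xi>)
  ultimately have "compat B M (alt_words_hd K k) X
      (\<lambda>w. (0, A.wt (lact_hd M a w) \<oplus>\<^bsub>A.N\<^esub> A.wt ((k, x) # w)))"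
    by (intro compat_comp[OF compat_sum embed_hom] abelian_group_AN)
  then show ?thesis
    by (rule compat_cong[rotated 2]) (auto simp: prefix_vec_def \<xi> alt_words_hd_def alt_words_def)
qed

lemma prefix_vec_balanced:
  assumes "\<xi> \<in> carrier (Xk k)" "b \<in> B" "w \<in> H"
  shows "prefix_vec k (ract (Xk k) \<xi> b) w = prefix_vec k \<xi> (lact_hd M b w)"
proof -
  obtain a x where \<xi>: "\<xi> = (a, x)" by (cases \<xi>)
  obtain j y v where w: "w = (j, y) # v"
    using H.gens_hd[OF assms(3)] .
  show ?thesis
    using assms compat_balanced[OF A.word_tensor_compat assms(2), of "[]" k x j y v] Cons_gens
      A.acts_mult(1)[OF hd_gens_subset[OF assms(3)], of a b]
    by (simp add: prefix_vec_def \<xi> w)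
qed

lemma lact_prefix_vec:
  assumes "\<xi> \<in> carrier (Xk k)" "b \<in> B" "w \<in> insert [] H"
  shows "lact X b (prefix_vec k \<xi> w) = prefix_vec k (lact (Xk k) b \<xi>) w"
proof -
  obtain a x where \<xi>: "\<xi> = (a, x)" "a \<in> B" "x \<in> carrier (M k)"
    using assms by (cases \<xi>) auto
  note cl = closed(1)[OF \<xi>(3)] and wt = A.lact_wt[OF assms(2) Cons_gens[OF \<xi>(3)]]
  show ?thesis
  proof (cases "w = []")
    case True
    then show ?thesis
      using wt by (simp add: prefix_vec_def \<xi>)
  next
    case False
    then have w: "w \<in> H" using assms by auto
    show ?thesis
      using False w wt[OF assms(3)] cl[OF assms(3)] \<xi> assms(2) bimoduleD(4)[OF A.bimodule_N assms(2)]
        A.acts_mult(1)[OF hd_gens_subset[OF w] assms(2), of a]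
        bimodule_zero(3)[OF A.bimodule_N B]
      by (simp add: prefix_vec_def closed A.lact_wt lact_hd_gens_H)
  qed
qed

lemma prefix_vec_Nil: "b \<in> B \<Longrightarrow> prefix_vec k (b, \<zero>\<^bsub>M k\<^esub>) [] = (b, \<zero>\<^bsub>A.N\<^esub>)"
  using A.wt_zero[of "[]" k "[]"] Cons_gens by (simp add: prefix_vec_def)

lemma prefix_vec_Cons:
  assumes "x \<in> carrier (M k)" "w \<in> insert [] H"
  shows "prefix_vec k (0, x) w = (0, A.wt ((k, x) # w))"
proof (cases "w = []")
  case False
  then obtain j y v where w: "w = (j, y) # v" "bimodule B (M j)" "y \<in> carrier (M j)" "w \<in> H"
    using H.gens_hd[of w] assms(2) by blast
  have "A.wt (lact_hd M 0 w) = \<zero>\<^bsub>A.N\<^esub>"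
    using A.wt_zero[of "[]" j v] lact_hd_gens_H[OF w(4), of 0] bimodule_zero(1)[OF w(2) B w(3)]
    by (simp add: w(1))
  then show ?thesis
    using assms closed(1) by (auto simp: prefix_vec_def)
qed (simp add: prefix_vec_def)

lemma prefix_vec_other:
  assumes "w \<in> H"
  shows "prefix_vec k (vac k) w = (0, A.wt w)"
proof -
  have "A.wt ((k, \<zero>\<^bsub>M k\<^esub>) # w) = \<zero>\<^bsub>A.N\<^esub>"
    using A.wt_zero[of "[]" k w] Cons_gens[of "\<zero>\<^bsub>M k\<^esub>" w] assms k by simp
  then show ?thesis
    using assms A.acts_one(1)[OF hd_gens_subset[OF assms]]
      A.word_tensor_closed[OF hd_gens_subset[OF assms]] H.gens_not_Nil[OF assms]
    by (simp add: prefix_vec_def)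
qed

text \<open>This is the surjectivity of the inverse of V_k on words: a word beginning with k splits
  off its head as \<xi>, and any other word is the vacuum of X_k tensored with itself.\<close>

lemma prefix_vec_cases:
  assumes "w \<in> A.G"
  obtains \<xi> v where "\<xi> \<in> carrier (Xk k)" "v \<in> insert [] H" "(0, A.wt w) = prefix_vec k \<xi> v"
proof -
  obtain j x v where w: "w = (j, x) # v" using A.gens_hd[OF assms] .
  show ?thesis
  proof (cases "j = k")
    case True
    then show ?thesis
      using that[of "(0, x)" v] prefix_vec_Cons[of x v] assms w by (auto simp: Cons_gens_iff)
  next
    case False
    then have "w \<in> H" using assms w by (simp add: hd_gens_iff)
    then show ?thesis
      using that[of "vac k" w] prefix_vec_other k by simp
  qed
qed

lemma prefix_hom_eqI:
  assumes Y: "abelian_group Y" and h: "add_hom X Y h" and g: "add_hom X Y g"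
    and hg: "\<And>\<xi> w. \<xi> \<in> carrier (Xk k) \<Longrightarrow> w \<in> insert [] H \<Longrightarrow> h (prefix_vec k \<xi> w) = g (prefix_vec k \<xi> w)"
    and v: "v \<in> carrier X"
  shows "h v = g v"
proof (rule X_hom_eqI[OF Y h g _ _ v])
  show "h (b, \<zero>\<^bsub>A.N\<^esub>) = g (b, \<zero>\<^bsub>A.N\<^esub>)" if "b \<in> B" for b
    using hg[of "(b, \<zero>\<^bsub>M k\<^esub>)" "[]"] prefix_vec_Nil[OF that] that k by simp
  show "h (0, A.wt w) = g (0, A.wt w)" if "w \<in> A.G" for w
    using prefix_vec_cases[OF that] hg by metis
qed

end

section \<open>The left representation in explicit form\<close>

definition left_word :: "'k \<Rightarrow> ('d \<times> 'x \<Rightarrow> 'd \<times> 'x) \<Rightarrow> ('k \<times> 'x) list \<Rightarrow> ('d, 'k, 'x) vector" where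
  "left_word k T w = (if fst (hd w) = k then prefix_vec k (T (0, snd (hd w))) (tl w)
     else prefix_vec k (T (vac k)) w)"

text \<open>The operator induced by T \<otimes> I, written without preimages under
  \<open>V_inv\<close>: the B-component is read inside X_k, a word with head k hands its head to T,
  and any other word is read as vacuum \<otimes> word.\<close>

definition left_op :: "'k \<Rightarrow> ('d \<times> 'x \<Rightarrow> 'd \<times> 'x) \<Rightarrow>
    ('d, 'k, 'x) vector \<Rightarrow> ('d, 'k, 'x) vector" where
  "left_op k T v = prefix_vec k (T (fst v, \<zero>\<^bsub>M k\<^esub>)) [] \<oplus>\<^bsub>X\<^esub>
     word_extend B M (alt_words K) X (left_word k T) (snd v)"

text \<open>The formula inside \<open>V_inv\<close> before its extension to the tensor
  product.\<close>

definition left_glue :: "'k \<Rightarrow> 'd \<times> 'x \<Rightarrow> ('d, 'k, 'x) vector \<Rightarrow> ('d, 'k, 'x) vector" where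
  "left_glue k = (\<lambda>(b, \<eta>) (c, \<xi>).
     lact X b (c, word_extend B M (alt_words_hd K k) A.N A.wt \<xi>) \<oplus>\<^bsub>X\<^esub>
     (0, A.wt [(k, ract (M k) \<eta> c)] \<oplus>\<^bsub>A.N\<^esub>
       word_extend B M (alt_words_hd K k) A.N (\<lambda>w. A.wt ((k, \<eta>) # w)) \<xi>))"

context
  fixes k assumes k: "k \<in> K"
begin

interpretation H: word_family B K M "alt_words_hd K k"
  by (rule word_family_hd)

interpretation Mk: abelian_group "M k"
  by (rule bimoduleD(1)[OF M[OF k]])

interpretation Xk: abelian_group "Xk k"
  by (rule bimoduleD(1)[OF bimodule_Xk[OF k]])

lemma tl_gens: "(k, x) # w \<in> A.G \<Longrightarrow> w \<in> insert [] H.G"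
  by (auto simp: Cons_gens_iff)

text \<open>A relation away from the part consumed by T is a relation for \<open>prefix_vec\<close>
  with a fixed vector of X_k. That T commutes with the right action enters when the head has index k
  and B passes between it and the second entry, since these two are separated by the action of
  T.\<close>

lemma left_word_compat:
  assumes T: "T \<in> left_operators B (Xk k)"
  shows "compat B M (alt_words K) X (left_word k T)"
proof -
  note T_op = operatorsD[OF left_operatorsD(1)[OF T]]
  have vac: "T (vac k) \<in> carrier (Xk k)"
    by (rule T_op) simp
  have Tx: "T (0, x) \<in> carrier (Xk k)" if "x \<in> carrier (M k)" for x
    by (rule T_op) (simp add: that)
  note other = prefix_vec_compat[OF k vac] and same = prefix_vec_compat[OF k Tx]
  show ?thesis
  proof (rule compatI, goal_cases)
    case (1 w)
    then obtain j x v where w: "w = (j, x) # v" "x \<in> carrier (M j)"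
      using A.gens_hd[of w] by blast
    show ?case
    proof (cases "j = k")
      case True
      then show ?thesis
        using 1 w prefix_vec_closed[OF k Tx] tl_gens by (simp add: left_word_def)
    next
      case False
      then show ?thesis
        using 1 w prefix_vec_closed[OF k vac, of w] by (simp add: left_word_def hd_gens_iff)
    qed
  next
    case (2 u j x y v)
    show ?case
    proof (cases u)
      case Nil
      then have gens: "(j, x) # v \<in> A.G" "(j, y) # v \<in> A.G"
        using 2 by auto
      show ?thesis
      proof (cases "j = k")
        case True
        then have in_M: "x \<in> carrier (M k)" "y \<in> carrier (M k)"
          using gens by (auto simp: Cons_gens_iff)
        then have "T (0, x \<oplus>\<^bsub>M k\<^esub> y) = T (0, x) \<oplus>\<^bsub>Xk k\<^esub> T (0, y)"
          using T_op(2)[of "(0, x)" "(0, y)"] by simp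
        then show ?thesis
          using Nil True tl_gens[of x v] gens prefix_vec_add[OF k Tx[OF in_M(1)] Tx[OF in_M(2)], of v]
          by (simp add: left_word_def)
      next
        case False
        then show ?thesis
          using Nil gens compat_add[OF other, of "[]" j x v y] by (simp add: left_word_def hd_gens_iff)
      qed
    next
      case (Cons p u')
      obtain i z where p: "p = (i, z)" by (cases p)
      show ?thesis
      proof (cases "i = k")
        case True
        then have z: "z \<in> carrier (M k)" and "u' @ (j, x) # v \<in> H.G" "u' @ (j, y) # v \<in> H.G"
          using 2 Cons p by (auto simp: Cons_gens_iff)
        then show ?thesis
          using Cons p True compat_add[OF same[OF z]] by (simp add: left_word_def)
      next
        case False
        then show ?thesis
          using Cons p 2 compat_add[OF other, of u j x v y] by (simp add: left_word_def hd_gens_iff)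
      qed
    qed
  next
    case (3 u j x b l y v)
    show ?case
    proof (cases u)
      case Nil
      then have gens: "(j, x) # (l, y) # v \<in> A.G"
        using 3 by auto
      show ?thesis
      proof (cases "j = k")
        case True
        then have in_M: "x \<in> carrier (M k)" and tail: "(l, y) # v \<in> H.G"
          using gens by (auto simp: Cons_gens_iff)
        then have "T (0, ract (M k) x b) = ract (Xk k) (T (0, x)) b"
          using left_operatorsD(2)[OF T 3(1), of "(0, x)"] by simp
        then show ?thesis
          using Nil True prefix_vec_balanced[OF k Tx[OF in_M] 3(1) tail] by (simp add: left_word_def)
      next
        case False
        then show ?thesis
          using Nil gens compat_balanced[OF other 3(1), of "[]" j x l y v] by (simp add: left_word_def hd_gens_iff)
      qed
    next
      case (Cons p u')
      obtain i z where p: "p = (i, z)" by (cases p)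
      show ?thesis
      proof (cases "i = k")
        case True
        then have z: "z \<in> carrier (M k)" and "u' @ (j, x) # (l, y) # v \<in> H.G"
          using 3 Cons p by (auto simp: Cons_gens_iff)
        then show ?thesis
          using Cons p True compat_balanced[OF same[OF z] 3(1)] by (simp add: left_word_def)
      next
        case False
        then show ?thesis
          using Cons p 3 compat_balanced[OF other 3(1), of u j x l y v] by (simp add: left_word_def hd_gens_iff)
      qed
    qed
  qed
qed

lemma left_op_hom:
  assumes T: "T \<in> left_operators B (Xk k)"
  shows "add_hom X X (left_op k T)"
proof -
  note T_op = operatorsD[OF left_operatorsD(1)[OF T]]
  have 1: "add_hom X X (\<lambda>v. prefix_vec k (T (fst v, \<zero>\<^bsub>M k\<^esub>)) [])"
  proof (rule add_homI)
    show "prefix_vec k (T (fst v, \<zero>\<^bsub>M k\<^esub>)) [] \<in> carrier X" if "v \<in> carrier X" for v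
      using that by (intro prefix_vec_closed[OF k] T_op) auto
    show "prefix_vec k (T (fst (v \<oplus>\<^bsub>X\<^esub> v'), \<zero>\<^bsub>M k\<^esub>)) [] =
        prefix_vec k (T (fst v, \<zero>\<^bsub>M k\<^esub>)) [] \<oplus>\<^bsub>X\<^esub> prefix_vec k (T (fst v', \<zero>\<^bsub>M k\<^esub>)) []"
      if "v \<in> carrier X" "v' \<in> carrier X" for v v'
    proof -
      have "T (fst v, \<zero>\<^bsub>M k\<^esub>) \<in> carrier (Xk k)" "T (fst v', \<zero>\<^bsub>M k\<^esub>) \<in> carrier (Xk k)"
        by (rule T_op(1); use that in auto)+
      moreover have "T (fst v + fst v', \<zero>\<^bsub>M k\<^esub>) = T (fst v, \<zero>\<^bsub>M k\<^esub>) \<oplus>\<^bsub>Xk k\<^esub> T (fst v', \<zero>\<^bsub>M k\<^esub>)"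
        using that T_op(2)[of "(fst v, \<zero>\<^bsub>M k\<^esub>)" "(fst v', \<zero>\<^bsub>M k\<^esub>)"] by auto
      ultimately show ?thesis
        using that by (cases v, cases v') (simp add: prefix_vec_add[OF k] del: B_plus_simps(1))
    qed
  qed
  have "add_hom X A.N snd"
    by (rule add_homI) auto
  then have 2: "add_hom X X (\<lambda>v. word_extend B M (alt_words K) X (left_word k T) (snd v))"
    by (rule add_hom_comp) (rule A.word_extend(1)[OF X.abelian_group_axioms left_word_compat[OF T]])
  show ?thesis
    using add_hom_sum[OF X.abelian_group_axioms 1 2] by (simp add: left_op_def[abs_def])
qed

lemma left_op_word:
  assumes T: "T \<in> left_operators B (Xk k)" and w: "w \<in> A.G"
  shows "left_op k T (0, A.wt w) = left_word k T w"
proof -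
  note T_op = operatorsD[OF left_operatorsD(1)[OF T]]
  have "T \<zero>\<^bsub>Xk k\<^esub> = \<zero>\<^bsub>Xk k\<^esub>"
    using T_op by (intro add_hom_zero Xk.abelian_group_axioms) (auto simp: add_hom_def)
  then have "prefix_vec k (T (0, \<zero>\<^bsub>M k\<^esub>)) [] = \<zero>\<^bsub>X\<^esub>"
    using prefix_vec_Nil[OF k, of 0] by simp
  then show ?thesis
    using A.word_extend(2)[OF X.abelian_group_axioms left_word_compat[OF T] w]
      compat_closed[OF left_word_compat[OF T] w] X.l_zero
    by (simp add: left_op_def del: X_simps)
qed

text \<open>The vector \<xi> is split as (a, 0) + (0, x). The second part yields an honest word with
  head k; for the first the scalar has to be moved out of the way.\<close>

lemma left_op_prefix_vec:
  assumes T: "T \<in> left_operators B (Xk k)" and \<xi>: "\<xi> \<in> carrier (Xk k)" and w: "w \<in> insert [] H.G"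
  shows "left_op k T (prefix_vec k \<xi> w) = prefix_vec k (T \<xi>) w"
proof -
  obtain a x where ax: "\<xi> = (a, x)" "a \<in> B" "x \<in> carrier (M k)"
    using \<xi> by (cases \<xi>) auto
  note T_op = operatorsD[OF left_operatorsD(1)[OF T]]
  have cl: "T (a, \<zero>\<^bsub>M k\<^esub>) \<in> carrier (Xk k)" "T (0, x) \<in> carrier (Xk k)" "T (vac k) \<in> carrier (Xk k)"
    by (rule T_op(1); use ax in simp)+
  have T_split: "T \<xi> = T (a, \<zero>\<^bsub>M k\<^esub>) \<oplus>\<^bsub>Xk k\<^esub> T (0, x)"
    using T_op(2)[of "(a, \<zero>\<^bsub>M k\<^esub>)" "(0, x)"] ax by simp
  have split: "prefix_vec k \<xi> w = prefix_vec k (a, \<zero>\<^bsub>M k\<^esub>) w \<oplus>\<^bsub>X\<^esub> prefix_vec k (0, x) w"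
    using prefix_vec_add[OF k _ _ w, of "(a, \<zero>\<^bsub>M k\<^esub>)" "(0, x)"] ax by simp
  have gens: "(k, x) # w \<in> A.G"
    using Cons_gens[OF k] ax w by blast
  have 2: "left_op k T (prefix_vec k (0, x) w) = prefix_vec k (T (0, x)) w"
    using left_op_word[OF T gens] ax w by (simp add: prefix_vec_Cons[OF k] left_word_def)
  have 1: "left_op k T (prefix_vec k (a, \<zero>\<^bsub>M k\<^esub>) w) = prefix_vec k (T (a, \<zero>\<^bsub>M k\<^esub>)) w"
  proof (cases "w = []")
    case True
    have "word_extend B M (alt_words K) X (left_word k T) \<zero>\<^bsub>A.N\<^esub> = \<zero>\<^bsub>X\<^esub>"
      by (rule add_hom_zero[OF A.word_extend(1)[OF X.abelian_group_axioms left_word_compat[OF T]]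
            abelian_group_AN X.abelian_group_axioms])
    then show ?thesis
      using True ax prefix_vec_closed[OF k cl(1), of "[]"]
      by (simp add: prefix_vec_Nil[OF k] left_op_def X.r_zero del: X_simps)
  next
    case False
    then have wH: "w \<in> H.G" using w by simp
    \<comment> \<open>Since (a, 0) is the vacuum times a, balancing moves a onto w. The new word
      still does not begin with k, and T follows along because it commutes with the right
      action.\<close>
    have "ract (Xk k) (vac k) a = (a, \<zero>\<^bsub>M k\<^esub>)"
      using ax bimodule_zero(4)[OF M[OF k] B] by simp
    then have eq: "prefix_vec k (T (a, \<zero>\<^bsub>M k\<^esub>)) w = prefix_vec k (T (vac k)) (lact_hd M a w)"
      "prefix_vec k (a, \<zero>\<^bsub>M k\<^esub>) w = prefix_vec k (vac k) (lact_hd M a w)"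
      using prefix_vec_balanced[OF k cl(3) ax(2) wH] prefix_vec_balanced[OF k _ ax(2) wH, of "vac k"]
        left_operatorsD(2)[OF T ax(2), of "vac k"] by simp_all
    have lw: "lact_hd M a w \<in> H.G"
      by (rule H.lact_hd_gens[OF wH ax(2)])
    obtain j y v where "lact_hd M a w = (j, y) # v"
      using H.gens_hd[OF lw] .
    then have "left_word k T (lact_hd M a w) = prefix_vec k (T (vac k)) (lact_hd M a w)"
      using lw by (simp add: left_word_def hd_gens_iff)
    then show ?thesis
      using left_op_word[OF T hd_gens_subset[OF lw]] prefix_vec_other[OF k lw] eq by simp
  qed
  have "left_op k T (prefix_vec k \<xi> w) = prefix_vec k (T (a, \<zero>\<^bsub>M k\<^esub>)) w \<oplus>\<^bsub>X\<^esub> prefix_vec k (T (0, x)) w"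
    unfolding split 1[symmetric] 2[symmetric]
    by (rule add_hom_add[OF left_op_hom[OF T]]; rule prefix_vec_closed[OF k _ w]) (use ax in auto)
  then show ?thesis
    using prefix_vec_add[OF k cl(1,2) w] T_split by simp
qed

section \<open>The gluing map behind the inverse of V_k\<close>

lemma incl:
  defines "incl \<equiv> word_extend B M (alt_words_hd K k) A.N A.wt"
  shows "add_hom H.N A.N incl" "w \<in> H.G \<Longrightarrow> incl (H.wt w) = A.wt w"
    "\<lbrakk>b \<in> B; \<xi> \<in> carrier H.N\<rbrakk> \<Longrightarrow> incl (lact H.N b \<xi>) = lact A.N b (incl \<xi>)"
proof -
  have c: "compat B M (alt_words_hd K k) A.N A.wt"
    by (rule compat_subset[OF _ A.word_tensor_compat]) (auto simp: alt_words_hd_def)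
  show 1: "add_hom H.N A.N incl" and 2: "\<And>w. w \<in> H.G \<Longrightarrow> incl (H.wt w) = A.wt w"
    unfolding incl_def by (rule H.word_extend[OF abelian_group_AN c], assumption?)+
  show "incl (lact H.N b \<xi>) = lact A.N b (incl \<xi>)" if "b \<in> B" "\<xi> \<in> carrier H.N"
    by (rule H.word_hom_eqI[OF abelian_group_AN add_hom_comp[OF H.lact_hom 1]
          add_hom_comp[OF 1 A.lact_hom] _ that(2)])
      (simp_all add: that 2 H.lact_wt A.lact_wt H.lact_hd_gens hd_gens_subset)
qed

lemma prepend:
  defines "pre \<equiv> \<lambda>\<eta>. word_extend B M (alt_words_hd K k) A.N (\<lambda>w. A.wt ((k, \<eta>) # w))"
  shows "\<eta> \<in> carrier (M k) \<Longrightarrow> add_hom H.N A.N (pre \<eta>)"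
    "\<lbrakk>\<eta> \<in> carrier (M k); w \<in> H.G\<rbrakk> \<Longrightarrow> pre \<eta> (H.wt w) = A.wt ((k, \<eta>) # w)"
    "\<lbrakk>\<eta> \<in> carrier (M k); \<eta>' \<in> carrier (M k); \<xi> \<in> carrier H.N\<rbrakk> \<Longrightarrow>
       pre (\<eta> \<oplus>\<^bsub>M k\<^esub> \<eta>') \<xi> = pre \<eta> \<xi> \<oplus>\<^bsub>A.N\<^esub> pre \<eta>' \<xi>"
    "\<lbrakk>\<eta> \<in> carrier (M k); b \<in> B; \<xi> \<in> carrier H.N\<rbrakk> \<Longrightarrow> pre (ract (M k) \<eta> b) \<xi> = pre \<eta> (lact H.N b \<xi>)"
proof -
  have c: "compat B M (alt_words_hd K k) A.N (\<lambda>w. A.wt ((k, \<eta>) # w))" if "\<eta> \<in> carrier (M k)" for \<eta>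
    using A.insert_compat[OF word_family_hd, of k "[(k, \<eta>)]" "[]"] Cons_gens[OF k that] by simp
  have 1: "add_hom H.N A.N (pre \<eta>)" if "\<eta> \<in> carrier (M k)" for \<eta>
    unfolding pre_def by (rule H.word_extend(1)[OF abelian_group_AN c[OF that]])
  have 2: "pre \<eta> (H.wt w) = A.wt ((k, \<eta>) # w)" if "\<eta> \<in> carrier (M k)" "w \<in> H.G" for \<eta> w
    unfolding pre_def by (rule H.word_extend(2)[OF abelian_group_AN c[OF that(1)] that(2)])
  note eqI = H.word_hom_eqI[OF abelian_group_AN]
  show "\<eta> \<in> carrier (M k) \<Longrightarrow> add_hom H.N A.N (pre \<eta>)"
    "\<lbrakk>\<eta> \<in> carrier (M k); w \<in> H.G\<rbrakk> \<Longrightarrow> pre \<eta> (H.wt w) = A.wt ((k, \<eta>) # w)"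
    by (fact 1 2)+
  show "pre (\<eta> \<oplus>\<^bsub>M k\<^esub> \<eta>') \<xi> = pre \<eta> \<xi> \<oplus>\<^bsub>A.N\<^esub> pre \<eta>' \<xi>"
    if "\<eta> \<in> carrier (M k)" "\<eta>' \<in> carrier (M k)" "\<xi> \<in> carrier H.N"
  proof (rule eqI[OF 1 add_hom_sum[OF abelian_group_AN 1 1] _ that(3)])
    fix w assume w: "w \<in> H.G"
    show "pre (\<eta> \<oplus>\<^bsub>M k\<^esub> \<eta>') (H.wt w) = pre \<eta> (H.wt w) \<oplus>\<^bsub>A.N\<^esub> pre \<eta>' (H.wt w)"
      using A.wt_add[of "[]" k \<eta> w \<eta>'] Cons_gens[OF k that(1)] that w by (simp add: 2)
  qed (use that in auto)
  show "pre (ract (M k) \<eta> b) \<xi> = pre \<eta> (lact H.N b \<xi>)"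
    if "\<eta> \<in> carrier (M k)" "b \<in> B" "\<xi> \<in> carrier H.N"
  proof (rule eqI[OF 1 add_hom_comp[OF H.lact_hom 1] _ that(3)])
    fix w assume w: "w \<in> H.G"
    then obtain j y v where jy: "w = (j, y) # v" using H.gens_hd by blast
    have "A.wt ((k, ract (M k) \<eta> b) # w) = A.wt ((k, \<eta>) # lact_hd M b w)"
      using compat_balanced[OF A.word_tensor_compat that(2), of "[]" k \<eta> j y v] Cons_gens[OF k that(1), of w] w jy
      by simp
    then show "pre (ract (M k) \<eta> b) (H.wt w) = pre \<eta> (lact H.N b (H.wt w))"
      using that w by (simp add: 2 bimoduleD(3)[OF M[OF k]] H.lact_wt H.lact_hd_gens)
  qed (use that bimoduleD(3)[OF M[OF k]] in auto)
qed

lemma left_glue_balanced: "balanced B (Xk k) (B_plus B H.N) X (left_glue k)"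
proof -
  note Mk = bimoduleD[OF M[OF k]] and AN = bimoduleD[OF A.bimodule_N]
  have sgl: "A.wt [(k, x)] \<in> carrier A.N" if "x \<in> carrier (M k)" for x
    using closed(1)[OF k that, of "[]"] by simp
  have sgl_add: "A.wt [(k, x \<oplus>\<^bsub>M k\<^esub> y)] = A.wt [(k, x)] \<oplus>\<^bsub>A.N\<^esub> A.wt [(k, y)]"
    if "x \<in> carrier (M k)" "y \<in> carrier (M k)" for x y
    using A.wt_add[of "[]" k x "[]" y] Cons_gens[OF k that(1), of "[]"] that by simp
  note cl = add_hom_closed[OF incl(1)] add_hom_closed[OF prepend(1)] sgl AN(2) Mk(2,3) H.N.a_closed
  show ?thesis
  proof (rule balancedI, goal_cases)
    case (1 p y)
    then show ?case by (auto simp: left_glue_def cl)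
  next
    case (2 p y y')
    then show ?case
      by (auto simp: left_glue_def cl add_hom_add[OF incl(1)] add_hom_add[OF prepend(1)] AN(4) Mk(7)
          sgl_add distrib_left A.N.a_ac ac_simps)
  next
    case (3 p p' y)
    then show ?case
      by (auto simp: left_glue_def cl prepend(3) AN(6) Mk(5) sgl_add distrib_right A.N.a_ac ac_simps)
  next
    case (4 p b y)
    then show ?case
      by (auto simp: left_glue_def cl prepend(4) incl(3) AN(8) Mk(9) mult.assoc)
  qed
qed

lemma left_glue_vacuum:
  assumes "\<xi> \<in> carrier (Xk k)"
  shows "left_glue k \<xi> (1, \<zero>\<^bsub>H.N\<^esub>) = prefix_vec k \<xi> []"
proof -
  obtain a x where "\<xi> = (a, x)" "a \<in> B" "x \<in> carrier (M k)"
    using assms by (cases \<xi>) auto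
  then show ?thesis
    using closed(1)[OF k, of x "[]"]
    by (simp add: left_glue_def prefix_vec_def bimoduleD(12)[OF M[OF k]] bimodule_zero[OF A.bimodule_N B]
        add_hom_zero[OF incl(1) H.N.abelian_group_axioms abelian_group_AN]
        add_hom_zero[OF prepend(1) H.N.abelian_group_axioms abelian_group_AN])
qed

lemma left_glue_word:
  assumes "\<xi> \<in> carrier (Xk k)" "w \<in> H.G"
  shows "left_glue k \<xi> (0, H.wt w) = prefix_vec k \<xi> w"
proof -
  obtain a x where \<xi>: "\<xi> = (a, x)" "a \<in> B" "x \<in> carrier (M k)"
    using assms by (cases \<xi>) auto
  have "A.wt [(k, \<zero>\<^bsub>M k\<^esub>)] = \<zero>\<^bsub>A.N\<^esub>"
    using A.wt_zero[of "[]" k "[]"] Cons_gens[OF k, of "\<zero>\<^bsub>M k\<^esub>" "[]"] by simp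
  then show ?thesis
    using \<xi> assms closed(1)[OF k \<xi>(3), of w] closed(2)[OF k assms(2) \<xi>(2)] H.gens_not_Nil[OF assms(2)]
    by (simp add: left_glue_def prefix_vec_def bimodule_zero[OF M[OF k] B] incl(2) prepend(2)
        A.lact_wt hd_gens_subset)
qed

lemma V_inv_eq: "V_inv B K M k = tensor_extend B (Xk k) (B_plus B H.N) X (left_glue k)"
  by (simp add: V_inv_def Let_def left_glue_def)

text \<open>In the second factor the vacuum alone has to be tested besides the words, since \<xi>
  \<otimes> c = \<xi>c \<otimes> 1 by balancing.\<close>

lemma left_glue_hom_eqI:
  assumes Y: "abelian_group Y" and \<xi>: "\<xi> \<in> carrier (Xk k)" and y: "y \<in> carrier (B_plus B H.N)"
    and f: "balanced B (Xk k) (B_plus B H.N) Y f" and g: "balanced B (Xk k) (B_plus B H.N) Y g"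
    and 1: "\<And>\<xi>. \<xi> \<in> carrier (Xk k) \<Longrightarrow> f \<xi> (1, \<zero>\<^bsub>H.N\<^esub>) = g \<xi> (1, \<zero>\<^bsub>H.N\<^esub>)"
    and 2: "\<And>\<xi> w. \<xi> \<in> carrier (Xk k) \<Longrightarrow> w \<in> H.G \<Longrightarrow> f \<xi> (0, H.wt w) = g \<xi> (0, H.wt w)"
  shows "f \<xi> y = g \<xi> y"
proof -
  obtain c \<eta> where c\<eta>: "y = (c, \<eta>)" "c \<in> B" "\<eta> \<in> carrier H.N" using y by auto
  have emb: "add_hom H.N (B_plus B H.N) (\<lambda>\<eta>. (0, \<eta>))"
    by (rule add_homI) auto
  have homs: "add_hom (B_plus B H.N) Y (f \<xi>)" "add_hom (B_plus B H.N) Y (g \<xi>)"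
    using f g \<xi> by (auto simp: balanced_def)
  have "f \<xi> (0, \<eta>) = g \<xi> (0, \<eta>)"
    by (rule H.word_hom_eqI[OF Y add_hom_comp[OF emb homs(1)] add_hom_comp[OF emb homs(2)] 2[OF \<xi>] c\<eta>(3)])
  moreover have "f \<xi> (c, \<zero>\<^bsub>H.N\<^esub>) = g \<xi> (c, \<zero>\<^bsub>H.N\<^esub>)"
  proof -
    have "ract (Xk k) \<xi> c \<in> carrier (Xk k)"
      using bimoduleD(3)[OF bimodule_Xk[OF k] c\<eta>(2) \<xi>] .
    from 1[OF this] show ?thesis
      using balancedD(4)[OF f \<xi> c\<eta>(2), of "(1, \<zero>\<^bsub>H.N\<^esub>)"] balancedD(4)[OF g \<xi> c\<eta>(2), of "(1, \<zero>\<^bsub>H.N\<^esub>)"]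
        bimodule_zero(3)[OF H.bimodule_N B c\<eta>(2)] by simp
  qed
  ultimately show ?thesis
    using c\<eta> add_hom_add[OF homs(1), of "(c, \<zero>\<^bsub>H.N\<^esub>)" "(0, \<eta>)"]
      add_hom_add[OF homs(2), of "(c, \<zero>\<^bsub>H.N\<^esub>)" "(0, \<eta>)"] by simp
qed

lemma balanced_left_operator:
  assumes "balanced B (Xk k) Q Y f" "T \<in> left_operators B (Xk k)"
  shows "balanced B (Xk k) Q Y (\<lambda>x y. f (T x) y)"
proof -
  note T = operatorsD[OF left_operatorsD(1)[OF assms(2)]]
  show ?thesis
    by (rule balancedI)
      (simp_all add: T balancedD[OF assms(1)] left_operatorsD(2)[OF assms(2)] del: B_plus_simps)
qed

text \<open>\<open>left_op\<close> intertwines the gluing map with T \<otimes> I, as a check against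
  the vacuum and against words shows, and every generator of X is a \<open>prefix_vec\<close>, hence
  the image of a pure tensor. So \<open>induced_operator\<close> applies.\<close>

lemma left_rep_eq:
  assumes T: "T \<in> left_operators B (Xk k)" and v: "v \<in> carrier X"
  shows "left_rep B K M k T v = left_op k T v"
proof -
  let ?Y = "B_plus B H.N"
  let ?t = "tensor B (Xk k) ?Y" and ?p = "pure_tensor B (Xk k) ?Y"
  note Xk = bimodule_Xk[OF k] and Y = bimodule_B_plus[OF B H.bimodule_N]
  note vi = tensor_extend[OF Xk Y X.abelian_group_axioms left_glue_balanced]
  have op: "left_op k T (left_glue k \<xi> y) = left_glue k (T \<xi>) y"
    if "\<xi> \<in> carrier (Xk k)" "y \<in> carrier ?Y" for \<xi> y
    by (rule left_glue_hom_eqI[OF X.abelian_group_axioms that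
          balanced_comp[OF left_glue_balanced left_op_hom[OF T]]
          balanced_left_operator[OF left_glue_balanced T]])
      (simp_all add: left_glue_vacuum left_glue_word left_op_prefix_vec[OF T]
        operatorsD(1)[OF left_operatorsD(1)[OF T]] del: B_plus_simps)
  have img: "prefix_vec k \<xi> w \<in> tensor_extend B (Xk k) ?Y X (left_glue k) ` carrier ?t"
    if \<xi>: "\<xi> \<in> carrier (Xk k)" "w \<in> insert [] H.G" for \<xi> w
  proof -
    obtain y where y: "y \<in> carrier ?Y" "prefix_vec k \<xi> w = left_glue k \<xi> y"
    proof (cases "w = []")
      case True
      then show ?thesis
        using that[of "(1, \<zero>\<^bsub>H.N\<^esub>)"] left_glue_vacuum[OF \<xi>(1)] by simp
    next
      case False
      then show ?thesis
        using that[of "(0, H.wt w)"] left_glue_word[OF \<xi>(1), of w] \<xi>(2) H.word_tensor_closed by simp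
    qed
    then have "prefix_vec k \<xi> w = tensor_extend B (Xk k) ?Y X (left_glue k) (?p \<xi> y)"
      using vi(2) \<xi>(1) by metis
    moreover have "?p \<xi> y \<in> carrier ?t"
      by (rule balancedD(1)[OF pure_tensor_balanced[OF Xk Y] \<xi>(1) y(1)])
    ultimately show ?thesis by blast
  qed
  have surj: "v \<in> tensor_extend B (Xk k) ?Y X (left_glue k) ` carrier ?t"
  proof (rule X_hom_surj[OF abelian_group_tensor[OF Xk Y] vi(1) _ _ v])
    show "(b, \<zero>\<^bsub>A.N\<^esub>) \<in> tensor_extend B (Xk k) ?Y X (left_glue k) ` carrier ?t" if "b \<in> B" for b
      using img[of "(b, \<zero>\<^bsub>M k\<^esub>)" "[]"] that prefix_vec_Nil[OF k that] by simp
    show "(0, A.wt w) \<in> tensor_extend B (Xk k) ?Y X (left_glue k) ` carrier ?t" if w: "w \<in> A.G" for w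
    proof -
      obtain \<xi> u where "\<xi> \<in> carrier (Xk k)" "u \<in> insert [] H.G" "(0, A.wt w) = prefix_vec k \<xi> u"
        by (rule prefix_vec_cases[OF k w])
      then show ?thesis using img by metis
    qed
  qed
  show ?thesis
    unfolding left_rep_def Let_def V_inv_eq
  proof (rule induced_operator[OF Xk Y X.abelian_group_axioms left_glue_balanced _ _ _ left_op_hom[OF T] _ surj])
    show "balanced B (Xk k) ?Y ?t (\<lambda>x y. ?p (T x) (id y))"
      using balanced_left_operator[OF pure_tensor_balanced[OF Xk Y] T] by simp
  qed (use op operatorsD(1)[OF left_operatorsD(1)[OF T]] in auto)
qed

end

section \<open>The right regular representations on a free product\<close>

lemma snoc_gens_iff:
  "w @ [(k, x)] \<in> A.G \<longleftrightarrow> k \<in> K \<and> x \<in> carrier (M k) \<and> (w = [] \<or> w \<in> word_gens M (alt_words_last K k))"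
  by (cases w rule: rev_cases)
    (auto simp: word_gens_append word_gens_def alt_words_def alt_words_last_def distinct_adj_append_iff)

lemma last_gens_iff:
  "w @ [(j, x)] \<in> word_gens M (alt_words_last K k) \<longleftrightarrow> w @ [(j, x)] \<in> A.G \<and> j \<noteq> k"
  by (auto simp: word_gens_def alt_words_last_def)

lemma last_gens_subset: "w \<in> word_gens M (alt_words_last K k) \<Longrightarrow> w \<in> A.G"
  by (auto simp: alt_words_last_def word_gens_def)

text \<open>The image of w \<otimes> \<xi> under the inverse of W_k, that is wa + w \<otimes> x for
  \<xi> = a \<oplus> x. On the empty word it agrees with \<open>prefix_vec\<close>: both embed X_k
  into X.\<close>

definition suffix_vec :: "'k \<Rightarrow> ('k \<times> 'x) list \<Rightarrow> 'd \<times> 'x \<Rightarrow> ('d, 'k, 'x) vector" where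
  "suffix_vec k w \<xi> = (if w = [] then (fst \<xi>, A.wt [(k, snd \<xi>)])
     else (0, A.wt (ract_last M w (fst \<xi>)) \<oplus>\<^bsub>A.N\<^esub> A.wt (w @ [(k, snd \<xi>)])))"

context
  fixes k assumes k: "k \<in> K"
begin

abbreviation "H' \<equiv> word_gens M (alt_words_last K k)"

interpretation H: word_family B K M "alt_words_last K k"
  by (rule word_family_last)

interpretation Mk: abelian_group "M k"
  by (rule bimoduleD(1)[OF M[OF k]])

lemma snoc_gens: "x \<in> carrier (M k) \<Longrightarrow> w \<in> insert [] H' \<Longrightarrow> w @ [(k, x)] \<in> A.G"
  using k by (auto simp: snoc_gens_iff)

lemma ract_last_gens_H: "w \<in> H' \<Longrightarrow> b \<in> B \<Longrightarrow> ract_last M w b \<in> A.G"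
  by (intro A.ract_last_gens last_gens_subset)

lemmas suffix_closed = A.word_tensor_closed[OF snoc_gens] A.word_tensor_closed[OF ract_last_gens_H]

lemma suffix_vec_closed:
  "\<xi> \<in> carrier (Xk k) \<Longrightarrow> w \<in> insert [] H' \<Longrightarrow> suffix_vec k w \<xi> \<in> carrier X"
  using suffix_closed(1)[of _ "[]"] by (auto simp: suffix_vec_def suffix_closed)

lemma suffix_vec_add:
  assumes "\<xi> \<in> carrier (Xk k)" "\<xi>' \<in> carrier (Xk k)" "w \<in> insert [] H'"
  shows "suffix_vec k w (\<xi> \<oplus>\<^bsub>Xk k\<^esub> \<xi>') = suffix_vec k w \<xi> \<oplus>\<^bsub>X\<^esub> suffix_vec k w \<xi>'"
proof -
  obtain a x c y where \<xi>: "\<xi> = (a, x)" "\<xi>' = (c, y)" by (cases \<xi>, cases \<xi>')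
  then have in_M: "x \<in> carrier (M k)" "y \<in> carrier (M k)" "a \<in> B" "c \<in> B"
    using assms by auto
  show ?thesis
    using A.wt_add[of w k x "[]" y] snoc_gens[OF in_M(1) assms(3)] in_M assms(3)
      A.ract_last_add[of w a c] last_gens_subset[of w k]
    by (auto simp: suffix_vec_def \<xi> suffix_closed A.N.a_ac)
qed

lemma suffix_vec_compat:
  assumes "\<xi> \<in> carrier (Xk k)"
  shows "compat B M (alt_words_last K k) X (\<lambda>w. suffix_vec k w \<xi>)"
proof -
  obtain a x where \<xi>: "\<xi> = (a, x)" by (cases \<xi>)
  have "compat B M (alt_words_last K k) A.N (\<lambda>w. A.wt (ract_last M w a))"
    using assms by (intro compat_subset[OF _ A.ract_last_compat]) (auto simp: \<xi> alt_words_last_def)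
  moreover have "compat B M (alt_words_last K k) A.N (\<lambda>w. A.wt (w @ [(k, x)]))"
    using A.insert_compat[OF word_family_last, of k "[]" "[(k, x)]"] snoc_gens assms
    by (simp add: \<xi>)
  ultimately have "compat B M (alt_words_last K k) X
      (\<lambda>w. (0, A.wt (ract_last M w a) \<oplus>\<^bsub>A.N\<^esub> A.wt (w @ [(k, x)])))"
    by (intro compat_comp[OF compat_sum embed_hom] abelian_group_AN)
  then show ?thesis
    by (rule compat_cong[rotated 2]) (auto simp: suffix_vec_def \<xi> alt_words_last_def alt_words_def)
qed

lemma suffix_vec_balanced:
  assumes "\<xi> \<in> carrier (Xk k)" "b \<in> B" "w \<in> H'"
  shows "suffix_vec k w (lact (Xk k) b \<xi>) = suffix_vec k (ract_last M w b) \<xi>"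
proof -
  obtain a x where \<xi>: "\<xi> = (a, x)" by (cases \<xi>)
  obtain j y v where w: "w = v @ [(j, y)]"
    using H.gens_last[OF assms(3)] .
  show ?thesis
    using assms compat_balanced[OF A.word_tensor_compat assms(2), of v j y k x "[]"] snoc_gens[of x w]
      A.acts_mult(2)[OF last_gens_subset[OF assms(3)], of b a]
    by (simp add: suffix_vec_def \<xi> w)
qed

lemma suffix_vec_Nil: "b \<in> B \<Longrightarrow> suffix_vec k [] (b, \<zero>\<^bsub>M k\<^esub>) = (b, \<zero>\<^bsub>A.N\<^esub>)"
  using A.wt_zero[of "[]" k "[]"] snoc_gens[of "\<zero>\<^bsub>M k\<^esub>" "[]"] by (simp add: suffix_vec_def)

lemma suffix_vec_snoc:
  assumes "x \<in> carrier (M k)" "w \<in> insert [] H'"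
  shows "suffix_vec k w (0, x) = (0, A.wt (w @ [(k, x)]))"
proof (cases "w = []")
  case False
  then obtain j y v where w: "w = v @ [(j, y)]" "bimodule B (M j)" "y \<in> carrier (M j)" "w \<in> H'"
    using H.gens_last[of w] assms(2) by blast
  have "A.wt (ract_last M w 0) = \<zero>\<^bsub>A.N\<^esub>"
    using A.wt_zero[of v j "[]"] ract_last_gens_H[OF w(4), of 0] bimodule_zero(2)[OF w(2) B w(3)]
    by (simp add: w(1))
  then show ?thesis
    using assms suffix_closed(1) by (auto simp: suffix_vec_def)
qed (simp add: suffix_vec_def)

lemma suffix_vec_other:
  assumes "w \<in> H'"
  shows "suffix_vec k w (vac k) = (0, A.wt w)"
proof -
  have "A.wt (w @ [(k, \<zero>\<^bsub>M k\<^esub>)]) = \<zero>\<^bsub>A.N\<^esub>"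
    using A.wt_zero[of w k "[]"] snoc_gens[of "\<zero>\<^bsub>M k\<^esub>" w] assms k by simp
  then show ?thesis
    using assms A.acts_one(2)[OF last_gens_subset[OF assms]]
      A.word_tensor_closed[OF last_gens_subset[OF assms]] H.gens_not_Nil[OF assms]
    by (simp add: suffix_vec_def)
qed

lemma suffix_vec_cases:
  assumes "w \<in> A.G"
  obtains \<xi> v where "\<xi> \<in> carrier (Xk k)" "v \<in> insert [] H'" "(0, A.wt w) = suffix_vec k v \<xi>"
proof -
  obtain j x v where w: "w = v @ [(j, x)]" using A.gens_last[OF assms] .
  show ?thesis
  proof (cases "j = k")
    case True
    then show ?thesis
      using that[of "(0, x)" v] suffix_vec_snoc[of x v] assms w by (auto simp: snoc_gens_iff)
  next
    case False
    then have "w \<in> H'" using assms w by (simp add: last_gens_iff)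
    then show ?thesis
      using that[of "vac k" w] suffix_vec_other k by simp
  qed
qed

end

definition right_word :: "'k \<Rightarrow> ('d \<times> 'x \<Rightarrow> 'd \<times> 'x) \<Rightarrow> ('k \<times> 'x) list \<Rightarrow> ('d, 'k, 'x) vector" where
  "right_word k T w = (if fst (last w) = k then suffix_vec k (butlast w) (T (0, snd (last w)))
     else suffix_vec k w (T (vac k)))"

definition right_op :: "'k \<Rightarrow> ('d \<times> 'x \<Rightarrow> 'd \<times> 'x) \<Rightarrow>
    ('d, 'k, 'x) vector \<Rightarrow> ('d, 'k, 'x) vector" where
  "right_op k T v = suffix_vec k [] (T (fst v, \<zero>\<^bsub>M k\<^esub>)) \<oplus>\<^bsub>X\<^esub>
     word_extend B M (alt_words K) X (right_word k T) (snd v)"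

definition right_glue :: "'k \<Rightarrow> ('d, 'k, 'x) vector \<Rightarrow> 'd \<times> 'x \<Rightarrow>
    ('d, 'k, 'x) vector" where
  "right_glue k = (\<lambda>(c, \<xi>) (b, \<eta>).
     ract X (c, word_extend B M (alt_words_last K k) A.N A.wt \<xi>) b \<oplus>\<^bsub>X\<^esub>
     (0, A.wt [(k, lact (M k) c \<eta>)] \<oplus>\<^bsub>A.N\<^esub>
       word_extend B M (alt_words_last K k) A.N (\<lambda>w. A.wt (w @ [(k, \<eta>)])) \<xi>))"

context
  fixes k assumes k: "k \<in> K"
begin

interpretation H: word_family B K M "alt_words_last K k"
  by (rule word_family_last)

interpretation Mk: abelian_group "M k"
  by (rule bimoduleD(1)[OF M[OF k]])

interpretation Xk: abelian_group "Xk k"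
  by (rule bimoduleD(1)[OF bimodule_Xk[OF k]])

lemma init_gens: "w @ [(k, x)] \<in> A.G \<Longrightarrow> w \<in> insert [] H.G"
  by (auto simp: snoc_gens_iff)

text \<open>Right operators see the end of a list, so all case distinctions below are made on this
  form.\<close>

lemma right_word_snoc:
  "right_word k T (w @ [(j, x)]) = (if j = k then suffix_vec k w (T (0, x))
     else suffix_vec k (w @ [(j, x)]) (T (vac k)))"
  by (simp add: right_word_def)

lemma right_word_compat:
  assumes T: "T \<in> right_operators B (Xk k)"
  shows "compat B M (alt_words K) X (right_word k T)"
proof -
  note T_op = operatorsD[OF right_operatorsD(1)[OF T]]
  have vac: "T (vac k) \<in> carrier (Xk k)"
    by (rule T_op) simp
  have Tx: "T (0, x) \<in> carrier (Xk k)" if "x \<in> carrier (M k)" for x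
    by (rule T_op) (simp add: that)
  note other = suffix_vec_compat[OF k vac] and same = suffix_vec_compat[OF k Tx]
  show ?thesis
  proof (rule compatI, goal_cases)
    case (1 w)
    then obtain j x v where w: "w = v @ [(j, x)]" "x \<in> carrier (M j)"
      using A.gens_last[of w] by blast
    show ?case
    proof (cases "j = k")
      case True
      then show ?thesis
        using 1 w suffix_vec_closed[OF k Tx] init_gens by (simp add: right_word_snoc)
    next
      case False
      then show ?thesis
        using 1 w suffix_vec_closed[OF k vac, of w] by (simp add: right_word_snoc last_gens_iff)
    qed
  next
    case (2 u j x y v)
    show ?case
    proof (cases v rule: rev_cases)
      case Nil
      then have gens: "u @ [(j, x)] \<in> A.G" "u @ [(j, y)] \<in> A.G"
        using 2 by auto
      show ?thesis
      proof (cases "j = k")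
        case True
        then have in_M: "x \<in> carrier (M k)" "y \<in> carrier (M k)"
          using gens by (auto simp: snoc_gens_iff)
        then have "T (0, x \<oplus>\<^bsub>M k\<^esub> y) = T (0, x) \<oplus>\<^bsub>Xk k\<^esub> T (0, y)"
          using T_op(2)[of "(0, x)" "(0, y)"] by simp
        then show ?thesis
          using Nil True init_gens[of u x] gens suffix_vec_add[OF k Tx[OF in_M(1)] Tx[OF in_M(2)], of u]
          by (simp add: right_word_snoc)
      next
        case False
        then show ?thesis
          using Nil gens compat_add[OF other, of u j x "[]" y] by (simp add: right_word_snoc last_gens_iff)
      qed
    next
      case (snoc v' p)
      obtain i z where p: "p = (i, z)" by (cases p)
      \<comment> \<open>The relation sits at entry j, while the operator looks at the last entry;
        the word is regrouped to expose the latter.\<close>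
      have eq: "u @ (j, t) # v = (u @ (j, t) # v') @ [(i, z)]" for t
        using snoc p by simp
      show ?thesis
      proof (cases "i = k")
        case True
        then have z: "z \<in> carrier (M k)" and "u @ (j, x) # v' \<in> H.G" "u @ (j, y) # v' \<in> H.G"
          using 2 unfolding eq by (auto simp only: snoc_gens_iff)
        then show ?thesis
          unfolding eq right_word_snoc using True compat_add[OF same[OF z]] by simp
      next
        case False
        then have "u @ (j, x) # v \<in> H.G" "u @ (j, y) # v \<in> H.G"
          using 2 unfolding eq last_gens_iff by auto
        then show ?thesis
          unfolding eq right_word_snoc using False compat_add[OF other, of u j x v y] unfolding eq by simp
      qed
    qed
  next
    case (3 u j x b l y v)
    show ?case
    proof (cases v rule: rev_cases)
      case Nil
      have eq: "u @ (j, s) # (l, t) # v = (u @ [(j, s)]) @ [(l, t)]" for s t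
        using Nil by simp
      have gens: "(u @ [(j, x)]) @ [(l, y)] \<in> A.G"
        using 3 unfolding eq by auto
      show ?thesis
      proof (cases "l = k")
        case True
        then have in_M: "y \<in> carrier (M k)" and init: "u @ [(j, x)] \<in> H.G"
          using gens by (auto simp only: snoc_gens_iff)
        then have "T (0, lact (M k) b y) = lact (Xk k) b (T (0, y))"
          using right_operatorsD(2)[OF T 3(1), of "(0, y)"] by simp
        then show ?thesis
          unfolding eq right_word_snoc
          using True suffix_vec_balanced[OF k Tx[OF in_M] 3(1) init] by simp
      next
        case False
        then have "u @ (j, x) # (l, y) # v \<in> H.G"
          using gens unfolding eq last_gens_iff by auto
        then show ?thesis
          unfolding eq right_word_snoc using False compat_balanced[OF other 3(1), of u j x l y v]
          unfolding eq by simp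
      qed
    next
      case (snoc v' p)
      obtain i z where p: "p = (i, z)" by (cases p)
      have eq: "u @ (j, s) # (l, t) # v = (u @ (j, s) # (l, t) # v') @ [(i, z)]" for s t
        using snoc p by simp
      show ?thesis
      proof (cases "i = k")
        case True
        then have z: "z \<in> carrier (M k)" and "u @ (j, x) # (l, y) # v' \<in> H.G"
          using 3 unfolding eq by (auto simp only: snoc_gens_iff)
        then show ?thesis
          unfolding eq right_word_snoc using True compat_balanced[OF same[OF z] 3(1)] by simp
      next
        case False
        then have "u @ (j, x) # (l, y) # v \<in> H.G"
          using 3 unfolding eq last_gens_iff by auto
        then show ?thesis
          unfolding eq right_word_snoc using False compat_balanced[OF other 3(1), of u j x l y v]
          unfolding eq by simp
      qed
    qed
  qed
qed

lemma right_op_hom: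
  assumes T: "T \<in> right_operators B (Xk k)"
  shows "add_hom X X (right_op k T)"
proof -
  note T_op = operatorsD[OF right_operatorsD(1)[OF T]]
  have 1: "add_hom X X (\<lambda>v. suffix_vec k [] (T (fst v, \<zero>\<^bsub>M k\<^esub>)))"
  proof (rule add_homI)
    show "suffix_vec k [] (T (fst v, \<zero>\<^bsub>M k\<^esub>)) \<in> carrier X" if "v \<in> carrier X" for v
      using that by (intro suffix_vec_closed[OF k] T_op) auto
    show "suffix_vec k [] (T (fst (v \<oplus>\<^bsub>X\<^esub> v'), \<zero>\<^bsub>M k\<^esub>)) =
        suffix_vec k [] (T (fst v, \<zero>\<^bsub>M k\<^esub>)) \<oplus>\<^bsub>X\<^esub> suffix_vec k [] (T (fst v', \<zero>\<^bsub>M k\<^esub>))"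
      if "v \<in> carrier X" "v' \<in> carrier X" for v v'
    proof -
      have "T (fst v, \<zero>\<^bsub>M k\<^esub>) \<in> carrier (Xk k)" "T (fst v', \<zero>\<^bsub>M k\<^esub>) \<in> carrier (Xk k)"
        by (rule T_op(1); use that in auto)+
      moreover have "T (fst v + fst v', \<zero>\<^bsub>M k\<^esub>) = T (fst v, \<zero>\<^bsub>M k\<^esub>) \<oplus>\<^bsub>Xk k\<^esub> T (fst v', \<zero>\<^bsub>M k\<^esub>)"
        using that T_op(2)[of "(fst v, \<zero>\<^bsub>M k\<^esub>)" "(fst v', \<zero>\<^bsub>M k\<^esub>)"] by auto
      ultimately show ?thesis
        using that by (cases v, cases v') (simp add: suffix_vec_add[OF k] del: B_plus_simps(1))
    qed
  qed
  have "add_hom X A.N snd"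
    by (rule add_homI) auto
  then have 2: "add_hom X X (\<lambda>v. word_extend B M (alt_words K) X (right_word k T) (snd v))"
    by (rule add_hom_comp) (rule A.word_extend(1)[OF X.abelian_group_axioms right_word_compat[OF T]])
  show ?thesis
    using add_hom_sum[OF X.abelian_group_axioms 1 2] by (simp add: right_op_def[abs_def])
qed

lemma right_op_word:
  assumes T: "T \<in> right_operators B (Xk k)" and w: "w \<in> A.G"
  shows "right_op k T (0, A.wt w) = right_word k T w"
proof -
  note T_op = operatorsD[OF right_operatorsD(1)[OF T]]
  have "T \<zero>\<^bsub>Xk k\<^esub> = \<zero>\<^bsub>Xk k\<^esub>"
    using T_op by (intro add_hom_zero Xk.abelian_group_axioms) (auto simp: add_hom_def)
  then have "suffix_vec k [] (T (0, \<zero>\<^bsub>M k\<^esub>)) = \<zero>\<^bsub>X\<^esub>"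
    using suffix_vec_Nil[OF k, of 0] by simp
  then show ?thesis
    using A.word_extend(2)[OF X.abelian_group_axioms right_word_compat[OF T] w]
      compat_closed[OF right_word_compat[OF T] w] X.l_zero
    by (simp add: right_op_def del: X_simps)
qed

lemma right_op_suffix_vec:
  assumes T: "T \<in> right_operators B (Xk k)" and \<xi>: "\<xi> \<in> carrier (Xk k)" and w: "w \<in> insert [] H.G"
  shows "right_op k T (suffix_vec k w \<xi>) = suffix_vec k w (T \<xi>)"
proof -
  obtain a x where ax: "\<xi> = (a, x)" "a \<in> B" "x \<in> carrier (M k)"
    using \<xi> by (cases \<xi>) auto
  note T_op = operatorsD[OF right_operatorsD(1)[OF T]]
  have cl: "T (a, \<zero>\<^bsub>M k\<^esub>) \<in> carrier (Xk k)" "T (0, x) \<in> carrier (Xk k)" "T (vac k) \<in> carrier (Xk k)"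
    by (rule T_op(1); use ax in simp)+
  have T_split: "T \<xi> = T (a, \<zero>\<^bsub>M k\<^esub>) \<oplus>\<^bsub>Xk k\<^esub> T (0, x)"
    using T_op(2)[of "(a, \<zero>\<^bsub>M k\<^esub>)" "(0, x)"] ax by simp
  have split: "suffix_vec k w \<xi> = suffix_vec k w (a, \<zero>\<^bsub>M k\<^esub>) \<oplus>\<^bsub>X\<^esub> suffix_vec k w (0, x)"
    using suffix_vec_add[OF k _ _ w, of "(a, \<zero>\<^bsub>M k\<^esub>)" "(0, x)"] ax by simp
  have gens: "w @ [(k, x)] \<in> A.G"
    using snoc_gens[OF k] ax w by blast
  have 2: "right_op k T (suffix_vec k w (0, x)) = suffix_vec k w (T (0, x))"
    using right_op_word[OF T gens] ax w by (simp add: suffix_vec_snoc[OF k] right_word_snoc)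
  have 1: "right_op k T (suffix_vec k w (a, \<zero>\<^bsub>M k\<^esub>)) = suffix_vec k w (T (a, \<zero>\<^bsub>M k\<^esub>))"
  proof (cases "w = []")
    case True
    have "word_extend B M (alt_words K) X (right_word k T) \<zero>\<^bsub>A.N\<^esub> = \<zero>\<^bsub>X\<^esub>"
      by (rule add_hom_zero[OF A.word_extend(1)[OF X.abelian_group_axioms right_word_compat[OF T]]
            abelian_group_AN X.abelian_group_axioms])
    then show ?thesis
      using True ax suffix_vec_closed[OF k cl(1), of "[]"]
      by (simp add: suffix_vec_Nil[OF k] right_op_def X.r_zero del: X_simps)
  next
    case False
    then have wH: "w \<in> H.G" using w by simp
    \<comment> \<open>Here the scalar is applied to the vacuum from the left, so that balancing
      passes it to the end of w.\<close>
    have "lact (Xk k) a (vac k) = (a, \<zero>\<^bsub>M k\<^esub>)"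
      using ax bimodule_zero(3)[OF M[OF k] B] by simp
    then have eq: "suffix_vec k w (T (a, \<zero>\<^bsub>M k\<^esub>)) = suffix_vec k (ract_last M w a) (T (vac k))"
      "suffix_vec k w (a, \<zero>\<^bsub>M k\<^esub>) = suffix_vec k (ract_last M w a) (vac k)"
      using suffix_vec_balanced[OF k cl(3) ax(2) wH] suffix_vec_balanced[OF k _ ax(2) wH, of "vac k"]
        right_operatorsD(2)[OF T ax(2), of "vac k"] by simp_all
    have lw: "ract_last M w a \<in> H.G"
      by (rule H.ract_last_gens[OF wH ax(2)])
    obtain j y v where "ract_last M w a = v @ [(j, y)]"
      using H.gens_last[OF lw] .
    then have "right_word k T (ract_last M w a) = suffix_vec k (ract_last M w a) (T (vac k))"
      using lw by (simp add: right_word_snoc last_gens_iff)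
    then show ?thesis
      using right_op_word[OF T last_gens_subset[OF lw]] suffix_vec_other[OF k lw] eq by simp
  qed
  have "right_op k T (suffix_vec k w \<xi>) = suffix_vec k w (T (a, \<zero>\<^bsub>M k\<^esub>)) \<oplus>\<^bsub>X\<^esub> suffix_vec k w (T (0, x))"
    unfolding split 1[symmetric] 2[symmetric]
    by (rule add_hom_add[OF right_op_hom[OF T]]; rule suffix_vec_closed[OF k _ w]) (use ax in auto)
  then show ?thesis
    using suffix_vec_add[OF k cl(1,2) w] T_split by simp
qed

lemma incl_last:
  defines "incl \<equiv> word_extend B M (alt_words_last K k) A.N A.wt"
  shows "add_hom H.N A.N incl" "w \<in> H.G \<Longrightarrow> incl (H.wt w) = A.wt w"
    "\<lbrakk>b \<in> B; \<xi> \<in> carrier H.N\<rbrakk> \<Longrightarrow> incl (ract H.N \<xi> b) = ract A.N (incl \<xi>) b"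
proof -
  have c: "compat B M (alt_words_last K k) A.N A.wt"
    by (rule compat_subset[OF _ A.word_tensor_compat]) (auto simp: alt_words_last_def)
  show 1: "add_hom H.N A.N incl" and 2: "\<And>w. w \<in> H.G \<Longrightarrow> incl (H.wt w) = A.wt w"
    unfolding incl_def by (rule H.word_extend[OF abelian_group_AN c], assumption?)+
  show "incl (ract H.N \<xi> b) = ract A.N (incl \<xi>) b" if "b \<in> B" "\<xi> \<in> carrier H.N"
    by (rule H.word_hom_eqI[OF abelian_group_AN add_hom_comp[OF H.ract_hom 1]
          add_hom_comp[OF 1 A.ract_hom] _ that(2)])
      (simp_all add: that 2 H.ract_wt A.ract_wt H.ract_last_gens last_gens_subset)
qed

lemma postpend:
  defines "post \<equiv> \<lambda>\<eta>. word_extend B M (alt_words_last K k) A.N (\<lambda>w. A.wt (w @ [(k, \<eta>)]))"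
  shows "\<eta> \<in> carrier (M k) \<Longrightarrow> add_hom H.N A.N (post \<eta>)"
    "\<lbrakk>\<eta> \<in> carrier (M k); w \<in> H.G\<rbrakk> \<Longrightarrow> post \<eta> (H.wt w) = A.wt (w @ [(k, \<eta>)])"
    "\<lbrakk>\<eta> \<in> carrier (M k); \<eta>' \<in> carrier (M k); \<xi> \<in> carrier H.N\<rbrakk> \<Longrightarrow>
       post (\<eta> \<oplus>\<^bsub>M k\<^esub> \<eta>') \<xi> = post \<eta> \<xi> \<oplus>\<^bsub>A.N\<^esub> post \<eta>' \<xi>"
    "\<lbrakk>\<eta> \<in> carrier (M k); b \<in> B; \<xi> \<in> carrier H.N\<rbrakk> \<Longrightarrow> post \<eta> (ract H.N \<xi> b) = post (lact (M k) b \<eta>) \<xi>"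
proof -
  have c: "compat B M (alt_words_last K k) A.N (\<lambda>w. A.wt (w @ [(k, \<eta>)]))" if "\<eta> \<in> carrier (M k)" for \<eta>
    using A.insert_compat[OF word_family_last, of k "[]" "[(k, \<eta>)]"] snoc_gens[OF k that] by simp
  have 1: "add_hom H.N A.N (post \<eta>)" if "\<eta> \<in> carrier (M k)" for \<eta>
    unfolding post_def by (rule H.word_extend(1)[OF abelian_group_AN c[OF that]])
  have 2: "post \<eta> (H.wt w) = A.wt (w @ [(k, \<eta>)])" if "\<eta> \<in> carrier (M k)" "w \<in> H.G" for \<eta> w
    unfolding post_def by (rule H.word_extend(2)[OF abelian_group_AN c[OF that(1)] that(2)])
  note eqI = H.word_hom_eqI[OF abelian_group_AN]
  show "\<eta> \<in> carrier (M k) \<Longrightarrow> add_hom H.N A.N (post \<eta>)"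
    "\<lbrakk>\<eta> \<in> carrier (M k); w \<in> H.G\<rbrakk> \<Longrightarrow> post \<eta> (H.wt w) = A.wt (w @ [(k, \<eta>)])"
    by (fact 1 2)+
  show "post (\<eta> \<oplus>\<^bsub>M k\<^esub> \<eta>') \<xi> = post \<eta> \<xi> \<oplus>\<^bsub>A.N\<^esub> post \<eta>' \<xi>"
    if "\<eta> \<in> carrier (M k)" "\<eta>' \<in> carrier (M k)" "\<xi> \<in> carrier H.N"
  proof (rule eqI[OF 1 add_hom_sum[OF abelian_group_AN 1 1] _ that(3)])
    fix w assume w: "w \<in> H.G"
    show "post (\<eta> \<oplus>\<^bsub>M k\<^esub> \<eta>') (H.wt w) = post \<eta> (H.wt w) \<oplus>\<^bsub>A.N\<^esub> post \<eta>' (H.wt w)"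
      using A.wt_add[of w k \<eta> "[]" \<eta>'] snoc_gens[OF k that(1)] that w by (simp add: 2)
  qed (use that in auto)
  show "post \<eta> (ract H.N \<xi> b) = post (lact (M k) b \<eta>) \<xi>"
    if "\<eta> \<in> carrier (M k)" "b \<in> B" "\<xi> \<in> carrier H.N"
  proof (rule eqI[OF add_hom_comp[OF H.ract_hom 1] 1 _ that(3)])
    fix w assume w: "w \<in> H.G"
    then obtain j y v where jy: "w = v @ [(j, y)]" using H.gens_last by blast
    have "A.wt (ract_last M w b @ [(k, \<eta>)]) = A.wt (w @ [(k, lact (M k) b \<eta>)])"
      using compat_balanced[OF A.word_tensor_compat that(2), of v j y k \<eta> "[]"] snoc_gens[OF k that(1), of w] w jy
      by simp
    then show "post \<eta> (ract H.N (H.wt w) b) = post (lact (M k) b \<eta>) (H.wt w)"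
      using that w by (simp add: 2 bimoduleD(2)[OF M[OF k]] H.ract_wt H.ract_last_gens)
  qed (use that bimoduleD(2)[OF M[OF k]] in auto)
qed

lemma right_glue_balanced: "balanced B (B_plus B H.N) (Xk k) X (right_glue k)"
proof -
  note Mk = bimoduleD[OF M[OF k]] and AN = bimoduleD[OF A.bimodule_N]
  have sgl: "A.wt [(k, x)] \<in> carrier A.N" if "x \<in> carrier (M k)" for x
    using suffix_closed(1)[OF k that, of "[]"] by simp
  have sgl_add: "A.wt [(k, x \<oplus>\<^bsub>M k\<^esub> y)] = A.wt [(k, x)] \<oplus>\<^bsub>A.N\<^esub> A.wt [(k, y)]"
    if "x \<in> carrier (M k)" "y \<in> carrier (M k)" for x y
    using A.wt_add[of "[]" k x "[]" y] snoc_gens[OF k that(1), of "[]"] that by simp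
  note cl = add_hom_closed[OF incl_last(1)] add_hom_closed[OF postpend(1)] sgl AN(3) Mk(2,3) H.N.a_closed
  show ?thesis
  proof (rule balancedI, goal_cases)
    case (1 y p)
    then show ?case by (auto simp: right_glue_def cl)
  next
    case (2 y p p')
    then show ?case
      by (auto simp: right_glue_def cl postpend(3) AN(7) Mk(4) sgl_add distrib_left A.N.a_ac ac_simps)
  next
    case (3 y y' p)
    then show ?case
      by (auto simp: right_glue_def cl add_hom_add[OF incl_last(1)] add_hom_add[OF postpend(1)] AN(5) Mk(6)
          sgl_add distrib_right A.N.a_ac ac_simps)
  next
    case (4 y b p)
    then show ?case
      by (auto simp: right_glue_def cl postpend(4) incl_last(3) AN(9) Mk(8) mult.assoc)
  qed
qed

lemma right_glue_vacuum:
  assumes "\<xi> \<in> carrier (Xk k)"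
  shows "right_glue k (1, \<zero>\<^bsub>H.N\<^esub>) \<xi> = suffix_vec k [] \<xi>"
proof -
  obtain a x where "\<xi> = (a, x)" "a \<in> B" "x \<in> carrier (M k)"
    using assms by (cases \<xi>) auto
  then show ?thesis
    using suffix_closed(1)[OF k, of x "[]"]
    by (simp add: right_glue_def suffix_vec_def bimoduleD(11)[OF M[OF k]] bimodule_zero[OF A.bimodule_N B]
        add_hom_zero[OF incl_last(1) H.N.abelian_group_axioms abelian_group_AN]
        add_hom_zero[OF postpend(1) H.N.abelian_group_axioms abelian_group_AN])
qed

lemma right_glue_word:
  assumes "\<xi> \<in> carrier (Xk k)" "w \<in> H.G"
  shows "right_glue k (0, H.wt w) \<xi> = suffix_vec k w \<xi>"
proof -
  obtain a x where \<xi>: "\<xi> = (a, x)" "a \<in> B" "x \<in> carrier (M k)"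
    using assms by (cases \<xi>) auto
  have "A.wt [(k, \<zero>\<^bsub>M k\<^esub>)] = \<zero>\<^bsub>A.N\<^esub>"
    using A.wt_zero[of "[]" k "[]"] snoc_gens[OF k, of "\<zero>\<^bsub>M k\<^esub>" "[]"] by simp
  then show ?thesis
    using \<xi> assms suffix_closed(1)[OF k \<xi>(3), of w] suffix_closed(2)[OF k assms(2) \<xi>(2)]
      H.gens_not_Nil[OF assms(2)]
    by (simp add: right_glue_def suffix_vec_def bimodule_zero[OF M[OF k] B] incl_last(2) postpend(2)
        A.ract_wt last_gens_subset)
qed

lemma W_inv_eq: "W_inv B K M k = tensor_extend B (B_plus B H.N) (Xk k) X (right_glue k)"
  by (simp add: W_inv_def Let_def right_glue_def)

lemma right_glue_hom_eqI:
  assumes Y: "abelian_group Y" and \<xi>: "\<xi> \<in> carrier (Xk k)" and y: "y \<in> carrier (B_plus B H.N)"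
    and f: "balanced B (B_plus B H.N) (Xk k) Y f" and g: "balanced B (B_plus B H.N) (Xk k) Y g"
    and 1: "\<And>\<xi>. \<xi> \<in> carrier (Xk k) \<Longrightarrow> f (1, \<zero>\<^bsub>H.N\<^esub>) \<xi> = g (1, \<zero>\<^bsub>H.N\<^esub>) \<xi>"
    and 2: "\<And>\<xi> w. \<xi> \<in> carrier (Xk k) \<Longrightarrow> w \<in> H.G \<Longrightarrow> f (0, H.wt w) \<xi> = g (0, H.wt w) \<xi>"
  shows "f y \<xi> = g y \<xi>"
proof -
  obtain c \<eta> where c\<eta>: "y = (c, \<eta>)" "c \<in> B" "\<eta> \<in> carrier H.N" using y by auto
  have emb: "add_hom H.N (B_plus B H.N) (\<lambda>\<eta>. (0, \<eta>))"
    by (rule add_homI) auto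
  have homs: "add_hom (B_plus B H.N) Y (\<lambda>y. f y \<xi>)" "add_hom (B_plus B H.N) Y (\<lambda>y. g y \<xi>)"
    using f g \<xi> by (auto simp: balanced_def)
  have "f (0, \<eta>) \<xi> = g (0, \<eta>) \<xi>"
    by (rule H.word_hom_eqI[OF Y add_hom_comp[OF emb homs(1)] add_hom_comp[OF emb homs(2)] 2[OF \<xi>] c\<eta>(3)])
  moreover have "f (c, \<zero>\<^bsub>H.N\<^esub>) \<xi> = g (c, \<zero>\<^bsub>H.N\<^esub>) \<xi>"
  proof -
    have "lact (Xk k) c \<xi> \<in> carrier (Xk k)"
      using bimoduleD(2)[OF bimodule_Xk[OF k] c\<eta>(2) \<xi>] .
    from 1[OF this] show ?thesis
      using balancedD(4)[OF f _ c\<eta>(2) \<xi>, of "(1, \<zero>\<^bsub>H.N\<^esub>)"] balancedD(4)[OF g _ c\<eta>(2) \<xi>, of "(1, \<zero>\<^bsub>H.N\<^esub>)"]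
        bimodule_zero(4)[OF H.bimodule_N B c\<eta>(2)] by simp
  qed
  ultimately show ?thesis
    using c\<eta> add_hom_add[OF homs(1), of "(c, \<zero>\<^bsub>H.N\<^esub>)" "(0, \<eta>)"]
      add_hom_add[OF homs(2), of "(c, \<zero>\<^bsub>H.N\<^esub>)" "(0, \<eta>)"] by simp
qed

lemma balanced_right_operator:
  assumes "balanced B Q (Xk k) Y f" "T \<in> right_operators B (Xk k)"
  shows "balanced B Q (Xk k) Y (\<lambda>y x. f y (T x))"
proof -
  note T = operatorsD[OF right_operatorsD(1)[OF assms(2)]]
  show ?thesis
    by (rule balancedI)
      (simp_all add: T balancedD[OF assms(1)] right_operatorsD(2)[OF assms(2)] del: B_plus_simps)
qed

lemma right_rep_eq:
  assumes T: "T \<in> right_operators B (Xk k)" and v: "v \<in> carrier X"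
  shows "right_rep B K M k T v = right_op k T v"
proof -
  let ?Y = "B_plus B H.N"
  let ?t = "tensor B ?Y (Xk k)" and ?p = "pure_tensor B ?Y (Xk k)"
  note Xk = bimodule_Xk[OF k] and Y = bimodule_B_plus[OF B H.bimodule_N]
  note wi = tensor_extend[OF Y Xk X.abelian_group_axioms right_glue_balanced]
  have op: "right_op k T (right_glue k y \<xi>) = right_glue k y (T \<xi>)"
    if "\<xi> \<in> carrier (Xk k)" "y \<in> carrier ?Y" for \<xi> y
    by (rule right_glue_hom_eqI[OF X.abelian_group_axioms that
          balanced_comp[OF right_glue_balanced right_op_hom[OF T]]
          balanced_right_operator[OF right_glue_balanced T]])
      (simp_all add: right_glue_vacuum right_glue_word right_op_suffix_vec[OF T]
        operatorsD(1)[OF right_operatorsD(1)[OF T]] del: B_plus_simps)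
  have img: "suffix_vec k w \<xi> \<in> tensor_extend B ?Y (Xk k) X (right_glue k) ` carrier ?t"
    if \<xi>: "\<xi> \<in> carrier (Xk k)" "w \<in> insert [] H.G" for \<xi> w
  proof -
    obtain y where y: "y \<in> carrier ?Y" "suffix_vec k w \<xi> = right_glue k y \<xi>"
    proof (cases "w = []")
      case True
      then show ?thesis
        using that[of "(1, \<zero>\<^bsub>H.N\<^esub>)"] right_glue_vacuum[OF \<xi>(1)] by simp
    next
      case False
      then show ?thesis
        using that[of "(0, H.wt w)"] right_glue_word[OF \<xi>(1), of w] \<xi>(2) H.word_tensor_closed by simp
    qed
    then have "suffix_vec k w \<xi> = tensor_extend B ?Y (Xk k) X (right_glue k) (?p y \<xi>)"
      using wi(2) \<xi>(1) by metis
    moreover have "?p y \<xi> \<in> carrier ?t"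
      by (rule balancedD(1)[OF pure_tensor_balanced[OF Y Xk] y(1) \<xi>(1)])
    ultimately show ?thesis by blast
  qed
  have surj: "v \<in> tensor_extend B ?Y (Xk k) X (right_glue k) ` carrier ?t"
  proof (rule X_hom_surj[OF abelian_group_tensor[OF Y Xk] wi(1) _ _ v])
    show "(b, \<zero>\<^bsub>A.N\<^esub>) \<in> tensor_extend B ?Y (Xk k) X (right_glue k) ` carrier ?t" if "b \<in> B" for b
      using img[of "(b, \<zero>\<^bsub>M k\<^esub>)" "[]"] that suffix_vec_Nil[OF k that] by simp
    show "(0, A.wt w) \<in> tensor_extend B ?Y (Xk k) X (right_glue k) ` carrier ?t" if w: "w \<in> A.G" for w
    proof -
      obtain \<xi> u where "\<xi> \<in> carrier (Xk k)" "u \<in> insert [] H.G" "(0, A.wt w) = suffix_vec k u \<xi>"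
        by (rule suffix_vec_cases[OF k w])
      then show ?thesis using img by metis
    qed
  qed
  show ?thesis
    unfolding right_rep_def Let_def W_inv_eq
  proof (rule induced_operator[OF Y Xk X.abelian_group_axioms right_glue_balanced _ _ _ right_op_hom[OF T] _ surj])
    show "balanced B ?Y (Xk k) ?t (\<lambda>y x. ?p (id y) (T x))"
      using balanced_right_operator[OF pure_tensor_balanced[OF Y Xk] T] by simp
  qed (use op operatorsD(1)[OF right_operatorsD(1)[OF T]] in auto)
qed

end

section \<open>Left and right operators commute\<close>

lemma hd_gens: "w \<in> word_gens M (alt_words_hd K k) \<longleftrightarrow> w \<in> A.G \<and> fst (hd w) \<noteq> k"
  by (cases w) (auto simp: word_gens_def alt_words_hd_def alt_words_def)

lemma last_gens: "w \<in> word_gens M (alt_words_last K k) \<longleftrightarrow> w \<in> A.G \<and> fst (last w) \<noteq> k"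
  by (cases w rule: rev_cases) (auto simp: word_gens_def alt_words_last_def alt_words_def)

context
  fixes k m assumes k: "k \<in> K" and m: "m \<in> K"
begin

interpretation L: word_family B K M "alt_words_hd K k"
  by (rule word_family_hd)

interpretation R: word_family B K M "alt_words_last K m"
  by (rule word_family_last)

text \<open>The words u for which x \<otimes> u \<otimes> y alternates when x and y are taken from
  the summands of index k and m. An empty u makes these two neighbours, whence k \<noteq> m.\<close>

definition middle :: "('k \<times> 'x) list \<Rightarrow> bool" where
  "middle u \<longleftrightarrow> (if u = [] then k \<noteq> m else u \<in> L.G \<and> u \<in> R.G)"

text \<open>The image of \<open>\<xi> \<otimes> u \<otimes> \<zeta>\<close>, expanded in \<open>\<zeta>\<close> and equivalently in \<open>\<xi>\<close>.\<close>

definition outer_vec :: "'d \<times> 'x \<Rightarrow> ('k \<times> 'x) list \<Rightarrow> 'd \<times> 'x \<Rightarrow> ('d, 'k, 'x) vector" where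
  "outer_vec \<xi> u \<zeta> = (if u = [] then prefix_vec k (ract (Xk k) \<xi> (fst \<zeta>)) []
     else prefix_vec k \<xi> (ract_last M u (fst \<zeta>))) \<oplus>\<^bsub>X\<^esub> prefix_vec k \<xi> (u @ [(m, snd \<zeta>)])"

lemma middle_snoc: "middle u \<Longrightarrow> y \<in> carrier (M m) \<Longrightarrow> u @ [(m, y)] \<in> L.G"
  using snoc_gens[OF m, of y u] by (cases u) (auto simp: middle_def hd_gens)

lemma middle_Cons: "middle u \<Longrightarrow> x \<in> carrier (M k) \<Longrightarrow> (k, x) # u \<in> R.G"
  using Cons_gens[OF k, of x u] by (cases u rule: rev_cases) (auto simp: middle_def last_gens)

text \<open>With \<xi> = a \<oplus> x and \<zeta> = c \<oplus> y both expansions consist of the same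
  four terms auc, auy, xuc and xuy. For auc the two actions on the word u have to commute; for empty
  u the scalars multiply directly.\<close>

lemma outer_vec_right:
  assumes u: "middle u" and \<xi>: "\<xi> \<in> carrier (Xk k)" and \<zeta>: "\<zeta> \<in> carrier (Xk m)"
  shows "outer_vec \<xi> u \<zeta> = (if u = [] then suffix_vec m [] (lact (Xk m) (fst \<xi>) \<zeta>)
     else suffix_vec m (lact_hd M (fst \<xi>) u) \<zeta>) \<oplus>\<^bsub>X\<^esub> suffix_vec m ((k, snd \<xi>) # u) \<zeta>"
proof -
  obtain a x where ax: "\<xi> = (a, x)" "a \<in> B" "x \<in> carrier (M k)"
    using \<xi> by (cases \<xi>) auto
  obtain c y where cy: "\<zeta> = (c, y)" "c \<in> B" "y \<in> carrier (M m)"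
    using \<zeta> by (cases \<zeta>) auto
  have g: "(k, x) # u @ [(m, y)] \<in> A.G"
    using Cons_gens[OF k ax(3), of "u @ [(m, y)]"] middle_snoc[OF u cy(3)] by simp
  show ?thesis
  proof (cases "u = []")
    case True
    have "A.wt [(k, ract (M k) x c)] \<in> carrier A.N" "A.wt [(m, lact (M m) a y)] \<in> carrier A.N"
      using closed(1)[OF k, of _ "[]"] closed(1)[OF m, of _ "[]"] ax cy
      by (simp_all add: bimoduleD(3)[OF M[OF k]] bimoduleD(2)[OF M[OF m]])
    then show ?thesis
      using True ax cy A.word_tensor_closed[OF g]
      by (simp add: outer_vec_def prefix_vec_def suffix_vec_def A.N.a_ac)
  next
    case False
    have uG: "u \<in> A.G" "u \<in> L.G" "u \<in> R.G"
      using u False by (auto simp: middle_def hd_gens)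
    have 1: "lact_hd M a u @ [(m, y)] \<in> A.G" "ract_last M (lact_hd M a u) c \<in> A.G"
      using R.lact_hd_gens[OF uG(3) ax(2)] snoc_gens[OF m cy(3)]
        A.ract_last_gens[OF A.lact_hd_gens[OF uG(1) ax(2)] cy(2)]
      by auto
    have 2: "(k, x) # ract_last M u c \<in> A.G"
      using Cons_gens[OF k ax(3)] L.ract_last_gens[OF uG(2) cy(2)] by auto
    show ?thesis
      using False ax cy A.word_tensor_closed[OF g] A.word_tensor_closed[OF 1(1)] A.word_tensor_closed[OF 1(2)]
        A.word_tensor_closed[OF 2] A.acts_commute[OF uG(1) ax(2) cy(2)]
      by (simp add: outer_vec_def prefix_vec_def suffix_vec_def lact_hd_append ract_last_Cons A.N.a_ac)
  qed
qed

lemma prefix_vec_zero: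
  assumes "\<xi> \<in> carrier (Xk k)" "u @ [(j, \<zero>\<^bsub>M j\<^esub>)] \<in> L.G"
  shows "prefix_vec k \<xi> (u @ [(j, \<zero>\<^bsub>M j\<^esub>)]) = \<zero>\<^bsub>X\<^esub>"
proof -
  have j: "j \<in> K"
    using assms(2) L.W by (force simp: word_gens_def)
  interpret Mj: abelian_group "M j" by (rule bimoduleD(1)[OF M[OF j]])
  show ?thesis
    using compat_add[OF prefix_vec_compat[OF k assms(1)], of u j "\<zero>\<^bsub>M j\<^esub>" "[]" "\<zero>\<^bsub>M j\<^esub>"] assms(2)
      prefix_vec_closed[OF k assms(1), of "u @ [(j, \<zero>\<^bsub>M j\<^esub>)]"]
    by (intro X.idem_zero) (auto simp del: X_simps)
qed

text \<open>Taking the vacuum for \<zeta>, or a centred vector as in the next lemma, writes prefix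
  vectors as outer vectors; this is how arbitrary words reach the two-sided form.\<close>

lemma outer_vec_one:
  assumes u: "middle u" and \<xi>: "\<xi> \<in> carrier (Xk k)"
  shows "outer_vec \<xi> u (vac m) = prefix_vec k \<xi> u"
proof -
  have "u \<in> insert [] L.G"
    using u by (auto simp: middle_def split: if_splits)
  moreover have "ract_last M u 1 = u" if "u \<noteq> []"
    using A.acts_one(2)[of u] that u by (auto simp: middle_def hd_gens)
  ultimately show ?thesis
    using prefix_vec_zero[OF \<xi> middle_snoc[OF u zero_Mk[OF m]]] prefix_vec_closed[OF k \<xi>, of u] \<xi>
      bimoduleD(12)[OF bimodule_Xk[OF k] \<xi>]
    by (auto simp: outer_vec_def X.r_zero simp del: X_simps B_plus_simps)
qed

lemma outer_vec_zero:
  assumes u: "middle u" and \<xi>: "\<xi> \<in> carrier (Xk k)" and y: "y \<in> carrier (M m)"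
  shows "outer_vec \<xi> u (0, y) = prefix_vec k \<xi> (u @ [(m, y)])"
proof -
  have "(if u = [] then prefix_vec k (ract (Xk k) \<xi> 0) [] else prefix_vec k \<xi> (ract_last M u 0)) = \<zero>\<^bsub>X\<^esub>"
  proof (cases "u = []")
    case True
    then show ?thesis
      using bimodule_zero(2)[OF bimodule_Xk[OF k] B \<xi>] prefix_vec_Nil[OF k, of 0] by simp
  next
    case False
    then have "u \<in> L.G" using u by (simp add: middle_def)
    then obtain v j z where v: "u = v @ [(j, z)]" "bimodule B (M j)" "z \<in> carrier (M j)"
      using L.gens_last by blast
    then have "ract_last M u 0 = v @ [(j, \<zero>\<^bsub>M j\<^esub>)]"
      using bimodule_zero(2)[OF v(2) B v(3)] by simp
    then show ?thesis
      using prefix_vec_zero[OF \<xi>, of v j] L.ract_last_gens[OF \<open>u \<in> L.G\<close>, of 0] False by simp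
  qed
  moreover have "prefix_vec k \<xi> (u @ [(m, y)]) \<in> carrier X"
    using prefix_vec_closed[OF k \<xi>] middle_snoc[OF u y] by blast
  ultimately show ?thesis
    by (simp only: outer_vec_def fst_conv snd_conv X.l_zero)
qed

context
  fixes T S
  assumes T: "T \<in> left_operators B (Xk k)" and S: "S \<in> right_operators B (Xk m)"
begin

text \<open>In the expansion along \<zeta> both summands are prefix vectors with \<xi>, or \<xi>
  times a scalar, in front. The right operator is treated with the other expansion.\<close>

lemma left_op_outer_vec:
  assumes u: "middle u" and \<xi>: "\<xi> \<in> carrier (Xk k)" and \<zeta>: "\<zeta> \<in> carrier (Xk m)"
  shows "left_op k T (outer_vec \<xi> u \<zeta>) = outer_vec (T \<xi>) u \<zeta>"
proof -
  have c: "fst \<zeta> \<in> B" "snd \<zeta> \<in> carrier (M m)" using \<zeta> by auto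
  note rc = bimoduleD(3)[OF bimodule_Xk[OF k] c(1) \<xi>]
  have mem: "u @ [(m, snd \<zeta>)] \<in> insert [] L.G" "u \<noteq> [] \<Longrightarrow> ract_last M u (fst \<zeta>) \<in> insert [] L.G"
    using middle_snoc[OF u c(2)] L.ract_last_gens[OF _ c(1), of u] u by (auto simp: middle_def)
  show ?thesis
    unfolding outer_vec_def
    using mem rc \<xi>
    by (simp add: add_hom_add[OF left_op_hom[OF k T]] prefix_vec_closed[OF k] left_op_prefix_vec[OF k T]
        left_operatorsD(2)[OF T c(1) \<xi>] del: X_simps B_plus_simps)
qed

lemma right_op_outer_vec:
  assumes u: "middle u" and \<xi>: "\<xi> \<in> carrier (Xk k)" and \<zeta>: "\<zeta> \<in> carrier (Xk m)"
  shows "right_op m S (outer_vec \<xi> u \<zeta>) = outer_vec \<xi> u (S \<zeta>)"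
proof -
  have c: "fst \<xi> \<in> B" "snd \<xi> \<in> carrier (M k)" using \<xi> by auto
  note S_op = operatorsD[OF right_operatorsD(1)[OF S]]
  note rc = bimoduleD(2)[OF bimodule_Xk[OF m] c(1) \<zeta>]
  \<comment> \<open>The B-component of \<xi> is applied to u if there is one and to \<zeta>
    otherwise; the two names treat both cases at once.\<close>
  define \<zeta>' u' where "\<zeta>' = (if u = [] then lact (Xk m) (fst \<xi>) \<zeta> else \<zeta>)"
    and "u' = (if u = [] then [] else lact_hd M (fst \<xi>) u)"
  have mem: "(k, snd \<xi>) # u \<in> insert [] R.G" "u' \<in> insert [] R.G" "\<zeta>' \<in> carrier (Xk m)"
    using middle_Cons[OF u c(2)] R.lact_hd_gens[OF _ c(1), of u] u rc \<zeta>
    by (auto simp: middle_def u'_def \<zeta>'_def simp del: B_plus_simps)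
  have "outer_vec \<xi> u \<zeta> = suffix_vec m u' \<zeta>' \<oplus>\<^bsub>X\<^esub> suffix_vec m ((k, snd \<xi>) # u) \<zeta>"
    unfolding outer_vec_right[OF u \<xi> \<zeta>] u'_def \<zeta>'_def by simp
  moreover have "outer_vec \<xi> u (S \<zeta>) = suffix_vec m u' (S \<zeta>') \<oplus>\<^bsub>X\<^esub> suffix_vec m ((k, snd \<xi>) # u) (S \<zeta>)"
    unfolding outer_vec_right[OF u \<xi> S_op(1)[OF \<zeta>]] u'_def \<zeta>'_def
    by (simp add: right_operatorsD(2)[OF S c(1) \<zeta>])
  ultimately show ?thesis
    using add_hom_add[OF right_op_hom[OF m S] suffix_vec_closed[OF m mem(3,2)] suffix_vec_closed[OF m \<zeta> mem(1)]]
    by (simp only: right_op_suffix_vec[OF m S mem(3,2)] right_op_suffix_vec[OF m S \<zeta> mem(1)])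
qed

text \<open>Every prefix vector is an outer vector, on which the operators act at opposite ends,
  except for an empty word with k = m. That exception is what \<open>comm\<close> covers.\<close>

lemma ops_commute:
  assumes comm: "k = m \<Longrightarrow> \<forall>\<xi>\<in>carrier (Xk k). T (S \<xi>) = S (T \<xi>)" and v: "v \<in> carrier X"
  shows "left_op k T (right_op m S v) = right_op m S (left_op k T v)"
proof (rule prefix_hom_eqI[OF k X.abelian_group_axioms _ _ _ v])
  show "add_hom X X (\<lambda>v. left_op k T (right_op m S v))" "add_hom X X (\<lambda>v. right_op m S (left_op k T v))"
    by (rule add_hom_comp[OF right_op_hom[OF m S] left_op_hom[OF k T]]
        add_hom_comp[OF left_op_hom[OF k T] right_op_hom[OF m S]])+
  fix \<xi> w assume \<xi>: "\<xi> \<in> carrier (Xk k)" and w: "w \<in> insert [] L.G"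
  note T_op = operatorsD[OF left_operatorsD(1)[OF T]] and S_op = operatorsD[OF right_operatorsD(1)[OF S]]
  have outer: "left_op k T (right_op m S (outer_vec \<xi> u \<zeta>)) = right_op m S (left_op k T (outer_vec \<xi> u \<zeta>))"
    if "middle u" "\<zeta> \<in> carrier (Xk m)" for u \<zeta>
    using that \<xi> S_op(1) T_op(1)
    by (simp add: left_op_outer_vec right_op_outer_vec del: B_plus_simps X_simps)
  show "left_op k T (right_op m S (prefix_vec k \<xi> w)) = right_op m S (left_op k T (prefix_vec k \<xi> w))"
  proof (cases w rule: rev_cases)
    case Nil
    show ?thesis
    proof (cases "k = m")
      \<comment> \<open>Both operators stay inside the embedded copy of X_k, where prefix and suffix
        vectors are the same.\<close>
      case True
      have sw: "suffix_vec j [] \<eta> = prefix_vec j \<eta> []" for j \<eta>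
        by (simp add: prefix_vec_def suffix_vec_def)
      have "left_op k T (right_op m S (prefix_vec k \<xi> w)) = prefix_vec k (T (S \<xi>)) []"
        using True Nil \<xi> S_op(1)[of \<xi>] left_op_prefix_vec[OF k T, of "S \<xi>" "[]"]
          right_op_suffix_vec[OF m S, of \<xi> "[]"] by (simp add: sw del: B_plus_simps)
      moreover have "right_op m S (left_op k T (prefix_vec k \<xi> w)) = prefix_vec k (S (T \<xi>)) []"
        using True Nil \<xi> T_op(1)[of \<xi>] left_op_prefix_vec[OF k T, of "\<xi>" "[]"]
          right_op_suffix_vec[OF m S, of "T \<xi>" "[]"] by (simp add: sw del: B_plus_simps)
      ultimately show ?thesis
        using comm[OF True] \<xi> by (simp del: B_plus_simps)
    next
      case False
      then show ?thesis
        using Nil outer[of "[]" "vac m"] outer_vec_one[of "[]" \<xi>] \<xi> m by (simp add: middle_def)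
    qed
  next
    case (snoc u p)
    obtain j y where p: "p = (j, y)" by (cases p)
    have wG: "w \<in> L.G" "w \<in> A.G" using w snoc by (auto simp: hd_gens)
    show ?thesis
    proof (cases "j = m")
      case True
      have y: "y \<in> carrier (M m)" and u: "u \<in> insert [] R.G"
        using wG(2) snoc True by (auto simp: p snoc_gens_iff)
      \<comment> \<open>If stripping the last letter leaves nothing, the word was a single letter of
        index m not beginning with k, which gives k \<noteq> m.\<close>
      have "middle u"
        using u wG(1) snoc p True by (cases u) (auto simp: middle_def hd_gens last_gens)
      then show ?thesis
        using outer[of u "(0, y)"] outer_vec_zero[of u \<xi> y] \<xi> y snoc p True by simp
    next
      case False
      then have "middle w"
        using wG snoc p by (simp add: middle_def last_gens)
      then show ?thesis
        using outer[of w "vac m"] outer_vec_one[of w \<xi>] \<xi> m by simp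
    qed
  qed
qed

end

end

end

section \<open>States and vectors of words\<close>

lemma additive_group_simps [simp]:
  "carrier additive_group = UNIV" "\<zero>\<^bsub>additive_group\<^esub> = 0" "x \<oplus>\<^bsub>additive_group\<^esub> y = x + y"
  by (simp_all add: additive_group_def)

lemma abelian_group_additive_group: "abelian_group (additive_group :: 'd::ab_group_add ring)"
proof (rule abelian_groupI)
  fix x :: 'd
  show "\<exists>y\<in>carrier additive_group. y \<oplus>\<^bsub>additive_group\<^esub> x = \<zero>\<^bsub>additive_group\<^esub>"
    by (rule bexI[of _ "- x"]) auto
qed (auto simp: ac_simps)

lemma is_stateD:
  assumes "is_state B M q"
  shows "\<lbrakk>x \<in> carrier (B_plus B M); y \<in> carrier (B_plus B M)\<rbrakk> \<Longrightarrow> q (x \<oplus>\<^bsub>B_plus B M\<^esub> y) = q x + q y"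
    "\<lbrakk>b \<in> B; x \<in> carrier (B_plus B M)\<rbrakk> \<Longrightarrow> q (lact (B_plus B M) b x) = b * q x"
    "\<lbrakk>b \<in> B; x \<in> carrier (B_plus B M)\<rbrakk> \<Longrightarrow> q (ract (B_plus B M) x b) = q x * b"
    "q (1, \<zero>\<^bsub>M\<^esub>) = 1"
  using assms unfolding is_state_def Let_def by metis+

lemma unital_representationD:
  assumes "unital_representation A X Ops r"
  shows "a \<in> A \<Longrightarrow> r a \<in> Ops" "x \<in> carrier X \<Longrightarrow> r 1 x = x"
    "\<lbrakk>x \<in> carrier X; a \<in> A; a' \<in> A\<rbrakk> \<Longrightarrow> r (a + a') x = r a x \<oplus>\<^bsub>X\<^esub> r a' x"
    "\<lbrakk>x \<in> carrier X; a \<in> A; a' \<in> A\<rbrakk> \<Longrightarrow> r (a * a') x = r a (r a' x)"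
  using assms unfolding unital_representation_def by metis+

text \<open>The product over the entries is well defined because each state is a bimodule map:
  q_k(xb) q_l(y) and q_k(x) q_l(by) are both q_k(x) b q_l(y).\<close>

lemma (in bimodule_family) free_product_state:
  assumes q: "\<And>k. k \<in> K \<Longrightarrow> is_state B (M k) (q k)"
  shows "add_hom X additive_group (free_product_state B K M q)"
    and "b \<in> B \<Longrightarrow> free_product_state B K M q (b, \<zero>\<^bsub>A.N\<^esub>) = b"
    and "w \<in> A.G \<Longrightarrow> free_product_state B K M q (0, A.wt w) = prod_list (map (\<lambda>(k, x). q k (0, x)) w)"
proof -
  let ?f = "\<lambda>w. prod_list (map (\<lambda>(k, x). q k (0, x)) w)"
  let ?g = "word_extend B M (alt_words K) additive_group ?f"
  have qs: "k \<in> K" "is_state B (M k) (q k)" "bimodule B (M k)" "x \<in> carrier (M k)"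
    if "u @ (k, x) # v \<in> A.G" for u k x v
    using that A.W q A.gens_M[OF that] by (force simp: word_gens_def)+
  have compat: "compat B M (alt_words K) additive_group ?f"
  proof (rule compatI, goal_cases)
    case (2 u k x y v)
    then show ?case
      using is_stateD(1)[OF qs(2)[OF 2(1)], of "(0, x)" "(0, y)"] qs(4)[OF 2(1)] qs(4)[OF 2(2)]
      by (simp add: distrib_left distrib_right)
  next
    case (3 u k x b l y v)
    have l: "u @ (k, x) # (l, y) # v = (u @ [(k, x)]) @ (l, y) # v" by simp
    have "q k (0, ract (M k) x b) = q k (0, x) * b" "q l (0, lact (M l) b y) = b * q l (0, y)"
      using is_stateD(3)[OF qs(2)[OF 3(2)] 3(1), of "(0, x)"] qs(4)[OF 3(2)]
        is_stateD(2)[OF qs(2)[OF 3(2)[unfolded l]] 3(1), of "(0, y)"] qs(4)[OF 3(2)[unfolded l]] by auto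
    then show ?case by (simp add: mult.assoc)
  qed simp
  note g = A.word_extend[OF abelian_group_additive_group compat]
  have st: "free_product_state B K M q (b, \<eta>) = b + ?g \<eta>" for b \<eta>
    by (simp add: free_product_state_def)
  have g0: "?g \<zero>\<^bsub>A.N\<^esub> = 0"
    using add_hom_zero[OF g(1) abelian_group_AN abelian_group_additive_group] by simp
  show "add_hom X additive_group (free_product_state B K M q)"
    using add_hom_add[OF g(1)] by (intro add_homI) (auto simp: st ac_simps)
  show "b \<in> B \<Longrightarrow> free_product_state B K M q (b, \<zero>\<^bsub>A.N\<^esub>) = b"
    "w \<in> A.G \<Longrightarrow> free_product_state B K M q (0, A.wt w) = ?f w"
    by (simp_all add: st g0 g(2))
qed

text \<open>The data of a c-bi-free realisation without the equality of moments: this is common to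
  the direction that assumes the equality and the one that proves it.\<close>

locale represented_family = bimodule_family B K M
  for B :: "'d::complex_algebra_1 set" and K :: "'k set" and M :: "'k \<Rightarrow> ('d, 'x) bimod" +
  fixes q :: "'k \<Rightarrow> 'd \<times> 'x \<Rightarrow> 'd" and l r :: "'k \<Rightarrow> 'a::complex_algebra_1 \<Rightarrow> 'd \<times> 'x \<Rightarrow> 'd \<times> 'x"
    and Al Ar :: "'k \<Rightarrow> 'a set"
  assumes q: "\<And>k. k \<in> K \<Longrightarrow> is_state B (M k) (q k)"
    and l: "\<And>k. k \<in> K \<Longrightarrow> unital_representation (Al k) (Xk k) (left_operators B (Xk k)) (l k)"
    and r: "\<And>k. k \<in> K \<Longrightarrow> unital_representation (Ar k) (Xk k) (right_operators B (Xk k)) (r k)"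
begin

abbreviation "vec \<equiv> word_vector B K M l r"
abbreviation "state \<equiv> free_product_state B K M q"

definition letters :: "('k \<times> side \<times> 'a) list \<Rightarrow> bool" where
  "letters Zs \<longleftrightarrow> (\<forall>(k, s, Z)\<in>set Zs. k \<in> K \<and> Z \<in> (case s of Lft \<Rightarrow> Al k | Rgt \<Rightarrow> Ar k))"

definition act :: "'k \<times> side \<times> 'a \<Rightarrow> ('d, 'k, 'x) vector \<Rightarrow> ('d, 'k, 'x) vector" where
  "act = (\<lambda>(k, s, Z). case s of Lft \<Rightarrow> left_op k (l k Z) | Rgt \<Rightarrow> right_op k (r k Z))"

lemma letters_simps [simp]:
  "letters []" "letters (Zs @ Ys) \<longleftrightarrow> letters Zs \<and> letters Ys"
  "letters ((k, Lft, Z) # Zs) \<longleftrightarrow> k \<in> K \<and> Z \<in> Al k \<and> letters Zs"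
  "letters ((k, Rgt, Z) # Zs) \<longleftrightarrow> k \<in> K \<and> Z \<in> Ar k \<and> letters Zs"
  by (simp_all add: letters_def ball_Un)

lemma letters_Cons: "letters (p # Zs) \<longleftrightarrow> letters [p] \<and> letters Zs"
  by (simp add: letters_def)

lemmas l_op = unital_representationD(1)[OF l] and r_op = unital_representationD(1)[OF r]

lemma act_hom: "letters [p] \<Longrightarrow> add_hom X X (act p)"
  using left_op_hom[OF _ l_op] right_op_hom[OF _ r_op]
  by (cases p) (auto simp: act_def letters_def split: side.splits)

lemma vec_Nil: "vec [] = (1, \<zero>\<^bsub>A.N\<^esub>)"
  by (simp add: word_vector_def)

text \<open>The explicit operators coincide with the defined ones on the carrier only, so membership
  of the vector and its recursion are proved by one induction.\<close>

lemma vec_Cons_closed: "letters Zs \<Longrightarrow> vec Zs \<in> carrier X \<and> (\<forall>p Ys. Zs = p # Ys \<longrightarrow> vec Zs = act p (vec Ys))"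
proof (induction Zs)
  case Nil
  then show ?case by (simp add: vec_Nil)
next
  case (Cons p Zs)
  then have *: "letters [p]" "vec Zs \<in> carrier X"
    using letters_Cons by blast+
  obtain k s Z where p: "p = (k, s, Z)" by (cases p)
  have "vec (p # Zs) = act p (vec Zs)"
  proof (cases s)
    case Lft
    then show ?thesis
      using left_rep_eq[OF _ l_op *(2)] *(1) by (simp add: word_vector_def act_def p)
  next
    case Rgt
    then show ?thesis
      using right_rep_eq[OF _ r_op *(2)] *(1) by (simp add: word_vector_def act_def p)
  qed
  then show ?case
    using add_hom_closed[OF act_hom[OF *(1)] *(2)] by simp
qed

lemma vec_closed: "letters Zs \<Longrightarrow> vec Zs \<in> carrier X"
  using vec_Cons_closed by blast

lemma vec_Cons: "letters (p # Zs) \<Longrightarrow> vec (p # Zs) = act p (vec Zs)"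
  using vec_Cons_closed by blast

lemma vec_append_cong:
  assumes "letters Zs" "letters Ys" "letters Ys'" "vec Ys = vec Ys'"
  shows "vec (Zs @ Ys) = vec (Zs @ Ys')"
  using assms(1)
proof (induction Zs)
  case (Cons p Zs)
  then have p: "letters [p]" "letters Zs" using letters_Cons by blast+
  then have "letters (p # Zs @ Ys)" "letters (p # Zs @ Ys')"
    using assms letters_Cons[of p] letters_simps(2) by blast+
  then show ?case
    using Cons.IH[OF p(2)] by (simp add: vec_Cons)
qed (simp add: assms)

lemma vec_append_add:
  assumes "letters Zs" "letters Ys" "letters Ys'" "letters Ys''" "vec Ys = vec Ys' \<oplus>\<^bsub>X\<^esub> vec Ys''"
  shows "vec (Zs @ Ys) = vec (Zs @ Ys') \<oplus>\<^bsub>X\<^esub> vec (Zs @ Ys'')"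
  using assms(1)
proof (induction Zs)
  case (Cons p Zs)
  then have p: "letters [p]" "letters Zs" using letters_Cons by blast+
  have lt: "letters (Zs @ Ys)" "letters (Zs @ Ys')" "letters (Zs @ Ys'')"
    using assms p by simp_all
  then have "letters (p # Zs @ Ys)" "letters (p # Zs @ Ys')" "letters (p # Zs @ Ys'')"
    using p(1) letters_Cons[of p] by blast+
  then show ?case
    using Cons.IH[OF p(2)] add_hom_add[OF act_hom[OF p(1)] vec_closed[OF lt(2)] vec_closed[OF lt(3)]]
    by (simp add: vec_Cons del: X_simps)
qed (simp add: assms)

lemma vec_single:
  assumes "k \<in> K" "Z \<in> Al k"
  shows "vec [(k, Lft, Z)] = prefix_vec k (l k Z (vac k)) []"
  using assms left_op_prefix_vec[OF _ l_op, of k Z "vac k" "[]"] prefix_vec_Nil[of k 1]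
  by (simp add: vec_Cons vec_Nil act_def)

text \<open>On the embedded copy of X_k the two functionals of the free product restrict to those of
  X_k.\<close>

lemma state_prefix_vec:
  assumes k: "k \<in> K" and \<xi>: "\<xi> \<in> carrier (Xk k)"
  shows "state (prefix_vec k \<xi> []) = q k \<xi>" "fst (prefix_vec k \<xi> []) = fst \<xi>"
proof -
  obtain a x where ax: "\<xi> = (a, x)" "a \<in> B" "x \<in> carrier (M k)"
    using \<xi> by (cases \<xi>) auto
  interpret Mk: abelian_group "M k" by (rule bimoduleD(1)[OF M[OF k]])
  note st = is_stateD[OF q[OF k]]
  have "prefix_vec k \<xi> [] = (a, \<zero>\<^bsub>A.N\<^esub>) \<oplus>\<^bsub>X\<^esub> (0, A.wt [(k, x)])" and g: "[(k, x)] \<in> A.G"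
    using Cons_gens[OF k ax(3), of "[]"] A.word_tensor_closed[of "[(k, x)]"] ax by (simp_all add: prefix_vec_def)
  then have "state (prefix_vec k \<xi> []) = a + q k (0, x)"
    using add_hom_add[OF free_product_state(1)[OF q], of "(a, \<zero>\<^bsub>A.N\<^esub>)" "(0, A.wt [(k, x)])"]
      free_product_state(2,3)[OF q] A.word_tensor_closed[OF g] ax(2) by simp
  also have "a = q k (a, \<zero>\<^bsub>M k\<^esub>)"
    using st(2)[of a "vac k"] st(4) ax(2) bimodule_zero(3)[OF M[OF k] B] by simp
  also have "q k (a, \<zero>\<^bsub>M k\<^esub>) + q k (0, x) = q k \<xi>"
    using st(1)[of "(a, \<zero>\<^bsub>M k\<^esub>)" "(0, x)"] ax by simp
  finally show "state (prefix_vec k \<xi> []) = q k \<xi>" .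
  show "fst (prefix_vec k \<xi> []) = fst \<xi>"
    by (simp add: prefix_vec_def)
qed

lemma vacuum_closed: "k \<in> K \<Longrightarrow> Z \<in> Al k \<Longrightarrow> l k Z (vac k) \<in> carrier (Xk k)"
  by (rule operatorsD(1)[OF left_operatorsD(1)[OF l_op]]) auto

lemma vec_centred:
  assumes "Xs \<noteq> []" "distinct_adj (map fst Xs)"
    and "\<forall>(k, Z)\<in>set Xs. k \<in> K \<and> Z \<in> Al k \<and> fst (l k Z (vac k)) = 0"
  defines "w \<equiv> map (\<lambda>(k, Z). (k, snd (l k Z (vac k)))) Xs"
  shows "vec (map (\<lambda>(k, Z). (k, Lft, Z)) Xs) = (0, A.wt w) \<and> w \<in> A.G"
  using assms(1-3) unfolding w_def
proof (induction Xs rule: list_nonempty_induct)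
  case (single p)
  obtain k Z where p: "p = (k, Z)" by (cases p)
  then have kX: "k \<in> K" "Z \<in> Al k" "fst (l k Z (vac k)) = 0" using single by auto
  have "snd (l k Z (vac k)) \<in> carrier (M k)"
    using vacuum_closed[OF kX(1,2)] by auto
  then show ?case
    using kX Cons_gens[OF kX(1), of _ "[]"] vec_single[OF kX(1,2)] by (auto simp: p prefix_vec_def)
next
  case (cons p Xs)
  obtain k Z where p: "p = (k, Z)" by (cases p)
  then have kX: "k \<in> K" "Z \<in> Al k" "fst (l k Z (vac k)) = 0" using cons.prems(2) by auto
  define \<eta> where "\<eta> = snd (l k Z (vac k))"
  have \<eta>: "l k Z (vac k) = (0, \<eta>)" "\<eta> \<in> carrier (M k)"
    using vacuum_closed[OF kX(1,2)] kX(3) by (auto simp: \<eta>_def prod_eq_iff)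
  let ?w = "map (\<lambda>(k, Z). (k, snd (l k Z (vac k)))) Xs"
  have adj: "distinct_adj (map fst Xs)" "k \<noteq> fst (hd Xs)"
    using cons.prems(1) cons.hyps(1) by (auto simp: p distinct_adj_Cons hd_map)
  have IH: "vec (map (\<lambda>(k, Z). (k, Lft, Z)) Xs) = (0, A.wt ?w)" "?w \<in> A.G"
    using cons.IH[OF adj(1)] cons.prems(2) by simp_all
  have "fst (hd ?w) = fst (hd Xs)"
    using cons.hyps(1) by (simp add: hd_map case_prod_beta)
  then have w: "?w \<in> word_gens M (alt_words_hd K k)"
    using IH(2) adj(2) by (simp add: hd_gens)
  have "letters (map (\<lambda>(k, Z). (k, Lft, Z)) (p # Xs))"
    using cons.prems(2) by (auto simp: letters_def)
  \<comment> \<open>By alternation the word built so far does not begin with k, so it is the vacuum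
    of X_k tensored with that word, and the next operator acts on this vacuum.\<close>
  then have "vec (map (\<lambda>(k, Z). (k, Lft, Z)) (p # Xs)) = left_op k (l k Z) (prefix_vec k (vac k) ?w)"
    using IH(1) by (simp add: p vec_Cons act_def prefix_vec_other[OF kX(1) w])
  also have "\<dots> = prefix_vec k (0, \<eta>) ?w"
    using w kX left_op_prefix_vec[OF kX(1) l_op[OF kX(1,2)], of "vac k" ?w] \<eta>(1) by simp
  also have "\<dots> = (0, A.wt ((k, \<eta>) # ?w))"
    using prefix_vec_Cons[OF kX(1) \<eta>(2)] w by blast
  finally show ?case
    using Cons_gens[OF kX(1) \<eta>(2), of ?w] w by (simp add: p \<eta>_def)
qed

lemma centred_moments:
  assumes "Xs \<noteq> []" "distinct_adj (map fst Xs)"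
    and "\<forall>(k, Z)\<in>set Xs. k \<in> K \<and> Z \<in> Al k \<and> fst (vec [(k, Lft, Z)]) = 0"
  shows "fst (vec (map (\<lambda>(k, Z). (k, Lft, Z)) Xs)) = 0"
    and "state (vec (map (\<lambda>(k, Z). (k, Lft, Z)) Xs)) = prod_list (map (\<lambda>(k, Z). state (vec [(k, Lft, Z)])) Xs)"
proof -
  have fst0: "fst (l k Z (vac k)) = 0" "state (vec [(k, Lft, Z)]) = q k (0, snd (l k Z (vac k)))"
    if "(k, Z) \<in> set Xs" for k Z
  proof -
    have kX: "k \<in> K" "Z \<in> Al k" "fst (vec [(k, Lft, Z)]) = 0"
      using assms(3) that by auto
    note v = vec_single[OF kX(1,2)] state_prefix_vec[OF kX(1) vacuum_closed[OF kX(1,2)]]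
    show *: "fst (l k Z (vac k)) = 0"
      using v kX(3) by simp
    show "state (vec [(k, Lft, Z)]) = q k (0, snd (l k Z (vac k)))"
      using v * by (metis prod.collapse)
  qed
  let ?w = "map (\<lambda>(k, Z). (k, snd (l k Z (vac k)))) Xs"
  have v: "vec (map (\<lambda>(k, Z). (k, Lft, Z)) Xs) = (0, A.wt ?w)" "?w \<in> A.G"
    using vec_centred[OF assms(1,2)] assms(3) fst0(1) by auto
  then show "fst (vec (map (\<lambda>(k, Z). (k, Lft, Z)) Xs)) = 0"
    by simp
  have "map (\<lambda>(k, x). q k (0, x)) ?w = map (\<lambda>(k, Z). state (vec [(k, Lft, Z)])) Xs"
    using fst0(2) by auto
  then show "state (vec (map (\<lambda>(k, Z). (k, Lft, Z)) Xs)) = prod_list (map (\<lambda>(k, Z). state (vec [(k, Lft, Z)])) Xs)"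
    by (simp only: v(1) free_product_state(3)[OF q v(2)])
qed

end

text \<open>The computation takes place in the free product of the given bimodules, so it is valid
  for every universe \<open>'x\<close>.\<close>

theorem c_bi_free_imp_c_free_left:
  fixes B :: "'d::complex_algebra_1 set" and E F :: "'a::complex_algebra_1 \<Rightarrow> 'd"
    and Al Ar :: "'k \<Rightarrow> 'a set"
  assumes B: "unital_subalgebra B" and bf: "c_bi_free TYPE('x) B E F K Al Ar"
  shows "c_free_left E F K Al"
proof -
  obtain M :: "'k \<Rightarrow> ('d, 'x) bimod" and q l r where
    rep: "\<forall>k\<in>K. bimodule B (M k) \<and> is_state B (M k) (q k) \<and>
           unital_representation (Al k) (B_plus B (M k)) (left_operators B (B_plus B (M k))) (l k) \<and>
           unital_representation (Ar k) (B_plus B (M k)) (right_operators B (B_plus B (M k))) (r k)" and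
    dist: "\<And>Zs. (\<forall>(k, s, Z)\<in>set Zs. k \<in> K \<and> Z \<in> (case s of Lft \<Rightarrow> Al k | Rgt \<Rightarrow> Ar k)) \<Longrightarrow>
           E (prod_list (map (\<lambda>(k, s, Z). Z) Zs)) = fst (word_vector B K M l r Zs) \<and>
           F (prod_list (map (\<lambda>(k, s, Z). Z) Zs)) = free_product_state B K M q (word_vector B K M l r Zs)"
    using bf unfolding c_bi_free_def by blast
  interpret represented_family B K M q l r Al Ar
    using B rep by unfold_locales blast+
  show ?thesis
    unfolding c_free_left_def
  proof (intro allI impI)
    fix Xs assume Xs: "centred_alternating E K Al Xs"
    \<comment> \<open>Words of one letter identify E and F on each left algebra with the functionals
      of the product, so being centred means the same on both sides.\<close>
    have single: "E Z = fst (vec [(k, Lft, Z)])" "F Z = state (vec [(k, Lft, Z)])" if "k \<in> K" "Z \<in> Al k" for k Z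
      using dist[of "[(k, Lft, Z)]"] that by auto
    have word: "E (prod_list (map snd Xs)) = fst (vec (map (\<lambda>(k, Z). (k, Lft, Z)) Xs))"
      "F (prod_list (map snd Xs)) = state (vec (map (\<lambda>(k, Z). (k, Lft, Z)) Xs))"
      using dist[of "map (\<lambda>(k, Z). (k, Lft, Z)) Xs"] Xs
      by (auto simp: centred_alternating_def comp_def case_prod_beta)
    have F_eq: "map (\<lambda>(k, Z). state (vec [(k, Lft, Z)])) Xs = map (\<lambda>(k, Z). F Z) Xs"
      using Xs single(2) by (auto simp: centred_alternating_def)
    have Xs': "Xs \<noteq> []" "distinct_adj (map fst Xs)"
      "\<forall>(k, Z)\<in>set Xs. k \<in> K \<and> Z \<in> Al k \<and> fst (vec [(k, Lft, Z)]) = 0"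
      using Xs single(1) by (auto simp: centred_alternating_def)
    show "E (prod_list (map snd Xs)) = 0 \<and> F (prod_list (map snd Xs)) = prod_list (map (\<lambda>(k, Z). F Z) Xs)"
      unfolding word centred_moments[OF Xs'] F_eq by simp
  qed
qed

section \<open>Moments of mixed words\<close>

lemma not_distinct_adj_split:
  "\<not> distinct_adj (map fst Xs) \<Longrightarrow> \<exists>us k Z Z' vs. Xs = us @ (k, Z) # (k, Z') # vs"
proof (induction Xs)
  case (Cons p Xs)
  show ?case
  proof (cases "distinct_adj (map fst Xs)")
    case True
    then obtain p' Xs' where "Xs = p' # Xs'" "fst p = fst p'"
      using Cons.prems by (cases Xs) auto
    then have "p # Xs = [] @ (fst p, snd p) # (fst p, snd p') # Xs'"
      by (simp add: prod_eq_iff)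
    then show ?thesis by blast
  next
    case False
    then show ?thesis
      using Cons.IH by (metis append_Cons)
  qed
qed simp

context represented_family
begin

definition lft :: "('k \<times> 'a) list \<Rightarrow> ('k \<times> side \<times> 'a) list" where
  "lft = map (\<lambda>(k, Z). (k, Lft, Z))"

lemma lft_simps [simp]:
  "lft [] = []" "lft ((k, Z) # Xs) = (k, Lft, Z) # lft Xs" "lft (Xs @ Ys) = lft Xs @ lft Ys"
  "length (lft Xs) = length Xs"
  by (simp_all add: lft_def)

lemma letters_lft: "letters (lft Xs) \<longleftrightarrow> (\<forall>(k, Z)\<in>set Xs. k \<in> K \<and> Z \<in> Al k)"
  by (auto simp: letters_def lft_def)

lemma act_left_prefix_vec:
  assumes "k \<in> K" "Z \<in> Al k" "\<xi> \<in> carrier (Xk k)" "w \<in> insert [] (word_gens M (alt_words_hd K k))"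
  shows "act (k, Lft, Z) (prefix_vec k \<xi> w) = prefix_vec k (l k Z \<xi>) w" "l k Z \<xi> \<in> carrier (Xk k)"
  using assms left_op_prefix_vec[OF assms(1) l_op[OF assms(1,2)]]
    operatorsD(1)[OF left_operatorsD(1)[OF l_op[OF assms(1,2)]]]
  by (simp_all add: act_def)

lemma act_left_hom: "k \<in> K \<Longrightarrow> Z \<in> Al k \<Longrightarrow> add_hom X X (act (k, Lft, Z))"
  by (rule act_hom) simp

text \<open>Identities of the representation on X_k carry over to X: the operators change only the
  vector in front of a prefix vector, and prefix vectors generate X.\<close>

lemma act_left_add:
  assumes k: "k \<in> K" and Z: "Z \<in> Al k" "Z' \<in> Al k" "Z + Z' \<in> Al k" and v: "v \<in> carrier X"
  shows "act (k, Lft, Z + Z') v = act (k, Lft, Z) v \<oplus>\<^bsub>X\<^esub> act (k, Lft, Z') v"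
  by (rule prefix_hom_eqI[OF k X.abelian_group_axioms act_left_hom[OF k Z(3)]
        add_hom_sum[OF X.abelian_group_axioms act_left_hom[OF k Z(1)] act_left_hom[OF k Z(2)]] _ v])
    (simp add: act_left_prefix_vec[OF k] Z prefix_vec_add[OF k, symmetric] unital_representationD(3)[OF l[OF k]]
      del: B_plus_simps X_simps)

lemma act_left_mult:
  assumes k: "k \<in> K" and Z: "Z \<in> Al k" "Z' \<in> Al k" "Z * Z' \<in> Al k" and v: "v \<in> carrier X"
  shows "act (k, Lft, Z * Z') v = act (k, Lft, Z) (act (k, Lft, Z') v)"
  by (rule prefix_hom_eqI[OF k X.abelian_group_axioms act_left_hom[OF k Z(3)]
        add_hom_comp[OF act_left_hom[OF k Z(2)] act_left_hom[OF k Z(1)]] _ v])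
    (simp add: act_left_prefix_vec[OF k] Z unital_representationD(4)[OF l[OF k]] del: B_plus_simps X_simps)

lemma lact_hom_X: "b \<in> B \<Longrightarrow> add_hom X X (lact X b)"
  using bimoduleD(2,4)[OF bimodule_X] by (auto simp: add_hom_def simp del: X_simps)

text \<open>A letter acting on X_k as b acts on all of X as the left action of b, an operator in
  which k no longer appears.\<close>

lemma act_left_scalar:
  assumes k: "k \<in> K" and Z: "Z \<in> Al k" and b: "b \<in> B"
    and act_Z: "\<And>\<xi>. \<xi> \<in> carrier (Xk k) \<Longrightarrow> l k Z \<xi> = lact (Xk k) b \<xi>" and v: "v \<in> carrier X"
  shows "act (k, Lft, Z) v = lact X b v"
  by (rule prefix_hom_eqI[OF k X.abelian_group_axioms act_left_hom[OF k Z] lact_hom_X[OF b] _ v])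
    (simp add: act_left_prefix_vec[OF k] Z act_Z lact_prefix_vec[OF k _ b] del: B_plus_simps X_simps)

lemma act_commute:
  assumes k: "k \<in> K" "Z \<in> Al k" and m: "m \<in> K" "Y \<in> Ar m"
    and comm: "k = m \<Longrightarrow> \<forall>\<xi>\<in>carrier (Xk k). l k Z (r m Y \<xi>) = r m Y (l k Z \<xi>)" and v: "v \<in> carrier X"
  shows "act (k, Lft, Z) (act (m, Rgt, Y) v) = act (m, Rgt, Y) (act (k, Lft, Z) v)"
  using ops_commute[OF k(1) m(1) l_op[OF k] r_op[OF m] comm v] by (simp add: act_def)

end

text \<open>What the moment computation asks of a realisation: L_b acts as b, single left letters
  have the right moments, left and right operators with the same index commute, and each right
  letter agrees with its partner at the vacuum.\<close>

locale matched_family = represented_family B K M q l r Al Ar + two_expectation_space B eps E F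
  for B :: "'d::complex_algebra_1 set" and K :: "'k set" and M :: "'k \<Rightarrow> ('d, 'x) bimod"
    and q :: "'k \<Rightarrow> 'd \<times> 'x \<Rightarrow> 'd" and l r :: "'k \<Rightarrow> 'a::complex_algebra_1 \<Rightarrow> 'd \<times> 'x \<Rightarrow> 'd \<times> 'x"
    and Al Ar :: "'k \<Rightarrow> 'a set" and eps :: "'d \<Rightarrow> 'd \<Rightarrow> 'a" and E F :: "'a \<Rightarrow> 'd" +
  assumes pairs: "\<And>k. k \<in> K \<Longrightarrow> pair_of_B_algebras B eps (Al k) (Ar k)"
    and commute: "\<And>m n Z Y. \<lbrakk>m \<in> K; n \<in> K; Z \<in> Al m; Y \<in> Ar n\<rbrakk> \<Longrightarrow> Z * Y = Y * Z"
    and l_scalar: "\<And>k b \<xi>. \<lbrakk>k \<in> K; b \<in> B; \<xi> \<in> carrier (Xk k)\<rbrakk> \<Longrightarrow> l k (eps b 1) \<xi> = lact (Xk k) b \<xi>"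
    and l_vacuum: "\<And>k Z. \<lbrakk>k \<in> K; Z \<in> Al k\<rbrakk> \<Longrightarrow> fst (l k Z (vac k)) = E Z"
      "\<And>k Z. \<lbrakk>k \<in> K; Z \<in> Al k\<rbrakk> \<Longrightarrow> q k (l k Z (vac k)) = F Z"
    and lr_commute: "\<And>k Z Y \<xi>. \<lbrakk>k \<in> K; Z \<in> Al k; Y \<in> Ar k; \<xi> \<in> carrier (Xk k)\<rbrakk> \<Longrightarrow>
      l k Z (r k Y \<xi>) = r k Y (l k Z \<xi>)"
    and partner: "\<And>k Y. \<lbrakk>k \<in> K; Y \<in> Ar k\<rbrakk> \<Longrightarrow> \<exists>Z\<in>Al k. (\<forall>W. E (W * Y) = E (W * Z) \<and> F (W * Y) = F (W * Z)) \<and>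
      r k Y (vac k) = l k Z (vac k)"
    and free: "c_free_left E F K Al"
begin

interpretation E: Vector_Spaces.linear scaleC scaleC E by (rule E_linear)
interpretation F: Vector_Spaces.linear scaleC scaleC F by (rule F_linear)

abbreviation wprod :: "('k \<times> side \<times> 'a) list \<Rightarrow> 'a" where
  "wprod Zs \<equiv> prod_list (map (\<lambda>(k, s, Z). Z) Zs)"

definition agree :: "('k \<times> side \<times> 'a) list \<Rightarrow> bool" where
  "agree Zs \<longleftrightarrow> E (wprod Zs) = fst (vec Zs) \<and> F (wprod Zs) = state (vec Zs)"

lemma agree_cong: "\<lbrakk>vec Zs = vec Ys; E (wprod Zs) = E (wprod Ys); F (wprod Zs) = F (wprod Ys); agree Ys\<rbrakk> \<Longrightarrow> agree Zs"
  by (simp add: agree_def)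

lemma agree_add:
  assumes "vec Zs = vec Ys \<oplus>\<^bsub>X\<^esub> vec Ys'" "wprod Zs = wprod Ys + wprod Ys'" "letters Ys" "letters Ys'"
    and "agree Ys" "agree Ys'"
  shows "agree Zs"
proof -
  have "state (vec Zs) = state (vec Ys) + state (vec Ys')"
    using add_hom_add[OF free_product_state(1)[OF q] vec_closed[OF assms(3)] vec_closed[OF assms(4)]] assms(1)
    by simp
  moreover have "fst (vec Zs) = fst (vec Ys) + fst (vec Ys')"
    unfolding assms(1) by (cases "vec Ys", cases "vec Ys'") simp
  ultimately show ?thesis
    using assms by (simp add: agree_def E.add F.add)
qed

lemma Al_closed:
  assumes "k \<in> K"
  shows "Z \<in> Al k \<Longrightarrow> Z' \<in> Al k \<Longrightarrow> Z + Z' \<in> Al k" "Z \<in> Al k \<Longrightarrow> Z' \<in> Al k \<Longrightarrow> Z - Z' \<in> Al k"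
    "Z \<in> Al k \<Longrightarrow> Z' \<in> Al k \<Longrightarrow> Z * Z' \<in> Al k" "b \<in> B \<Longrightarrow> eps b 1 \<in> Al k"
  using pairs[OF assms] subalgebraD[of "Al k"] by (auto simp: pair_of_B_algebras_def)

lemma agree_split:
  assumes "letters us" "letters vs" "k \<in> K" "Z \<in> Al k" "Z' \<in> Al k"
    and "agree (us @ (k, Lft, Z) # vs)" "agree (us @ (k, Lft, Z') # vs)"
  shows "agree (us @ (k, Lft, Z + Z') # vs)"
proof (rule agree_add[OF _ _ _ _ assms(6,7)])
  have lt: "letters ((k, Lft, Z + Z') # vs)" "letters ((k, Lft, Z) # vs)" "letters ((k, Lft, Z') # vs)"
    using assms Al_closed[OF assms(3)] by simp_all
  show "vec (us @ (k, Lft, Z + Z') # vs) = vec (us @ (k, Lft, Z) # vs) \<oplus>\<^bsub>X\<^esub> vec (us @ (k, Lft, Z') # vs)"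
    by (rule vec_append_add[OF assms(1) lt])
      (simp add: vec_Cons lt act_left_add assms Al_closed vec_closed del: X_simps)
qed (use assms in \<open>simp_all add: algebra_simps\<close>)

lemma agree_merge:
  assumes "letters us" "letters vs" "k \<in> K" "Z \<in> Al k" "Z' \<in> Al k" "agree (us @ (k, Lft, Z * Z') # vs)"
  shows "agree (us @ (k, Lft, Z) # (k, Lft, Z') # vs)"
proof (rule agree_cong[OF _ _ _ assms(6)])
  have lt: "letters ((k, Lft, Z) # (k, Lft, Z') # vs)" "letters ((k, Lft, Z * Z') # vs)"
    "letters ((k, Lft, Z') # vs)"
    using assms Al_closed[OF assms(3)] by simp_all
  show "vec (us @ (k, Lft, Z) # (k, Lft, Z') # vs) = vec (us @ (k, Lft, Z * Z') # vs)"
    by (rule vec_append_cong[OF assms(1) lt(1,2)])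
      (simp add: vec_Cons lt act_left_mult assms Al_closed vec_closed del: X_simps)
qed (simp_all add: mult.assoc)

text \<open>L_b lies in every left algebra, the product in A is the same whichever index it carries,
  and on X it is the left action of b for either index.\<close>

lemma agree_scalar:
  assumes us: "letters us" and vs: "letters vs" and k: "k \<in> K" and m: "m \<in> K" and b: "b \<in> B"
    and agree: "agree (us @ (m, Lft, eps b 1) # vs)"
  shows "agree (us @ (k, Lft, eps b 1) # vs)"
proof (rule agree_cong[OF _ _ _ agree])
  have lt: "letters ((k, Lft, eps b 1) # vs)" "letters ((m, Lft, eps b 1) # vs)"
    using assms Al_closed by simp_all
  have "act (k, Lft, eps b 1) (vec vs) = lact X b (vec vs)" "act (m, Lft, eps b 1) (vec vs) = lact X b (vec vs)"
    using k m b by (auto intro!: act_left_scalar Al_closed l_scalar vec_closed[OF vs]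
        simp del: X_simps B_plus_simps)
  then show "vec (us @ (k, Lft, eps b 1) # vs) = vec (us @ (m, Lft, eps b 1) # vs)"
    by (intro vec_append_cong[OF us lt]) (simp add: vec_Cons[OF lt(1)] vec_Cons[OF lt(2)])
qed simp_all

lemma agree_single:
  assumes "k \<in> K" "Z \<in> Al k"
  shows "agree [(k, Lft, Z)]"
  using assms vec_single[OF assms] state_prefix_vec[OF assms(1) vacuum_closed[OF assms]] l_vacuum[OF assms]
  by (simp add: agree_def)

lemma agree_Nil: "agree []"
  using free_product_state(2)[OF q, of 1] E_one F_one by (simp add: agree_def vec_Nil)

lemma agree_centred:
  assumes "Xs \<noteq> []" "distinct_adj (map fst Xs)" "\<forall>(k, Z)\<in>set Xs. k \<in> K \<and> Z \<in> Al k \<and> E Z = 0"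
  shows "agree (lft Xs)"
proof -
  have single: "fst (vec [(k, Lft, Z)]) = E Z" "state (vec [(k, Lft, Z)]) = F Z" if "(k, Z) \<in> set Xs" for k Z
    using agree_single[of k Z] assms(3) that by (auto simp: agree_def)
  have cent: "\<forall>(k, Z)\<in>set Xs. k \<in> K \<and> Z \<in> Al k \<and> fst (vec [(k, Lft, Z)]) = 0"
    using assms(3) single(1) by auto
  have F_eq: "map (\<lambda>(k, Z). state (vec [(k, Lft, Z)])) Xs = map (\<lambda>(k, Z). F Z) Xs"
    using single(2) by auto
  have "wprod (lft Xs) = prod_list (map snd Xs)"
    by (simp add: lft_def comp_def case_prod_beta)
  moreover have "centred_alternating E K Al Xs"
    using assms by (simp add: centred_alternating_def)
  ultimately show ?thesis
    using free centred_moments[OF assms(1,2) cent, folded lft_def]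
    unfolding agree_def c_free_left_def F_eq by simp
qed

text \<open>Outer induction on the length: neighbours with equal index are merged. In an alternating
  word the letters are centred from left to right by Z = (Z - L_b) + L_b with b = E Z. The first
  term enlarges the centred part; in the second, L_b is absorbed by a neighbour and the outer
  hypothesis applies.\<close>

lemma agree_left: "letters (lft Xs) \<Longrightarrow> agree (lft Xs)"
proof (induction "length Xs" arbitrary: Xs rule: less_induct)
  case less
  show ?case
  proof (cases "distinct_adj (map fst Xs)")
    case False
    then obtain us k Z Z' vs where Xs: "Xs = us @ (k, Z) # (k, Z') # vs"
      using not_distinct_adj_split by blast
    then have lt: "k \<in> K" "Z \<in> Al k" "Z' \<in> Al k" "letters (lft us)" "letters (lft vs)"
      using less.prems by auto
    have "agree (lft (us @ (k, Z * Z') # vs))"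
      using lt by (intro less.hyps) (auto simp: Xs Al_closed)
    then show ?thesis
      using agree_merge[OF lt(4,5,1,2,3)] Xs by simp
  next
    case adj: True
    \<comment> \<open>The inner induction runs over the letters vs still to be centred, while us
      holds the centred ones; the total length stays fixed, so that the outer hypothesis remains
      available.\<close>
    have "agree (lft (us @ vs))"
      if "length (us @ vs) = length Xs" "letters (lft (us @ vs))" "\<forall>(k, Z)\<in>set us. E Z = 0"
        "distinct_adj (map fst (us @ vs))" for us vs
      using that
    proof (induction vs arbitrary: us)
      case Nil
      show ?case
      proof (cases us)
        case (Cons p us')
        then show ?thesis
          using Nil by (intro agree_centred) (auto simp: letters_lft)
      qed (simp add: agree_Nil)
    next
      case (Cons p vs)
      obtain k Z where p: "p = (k, Z)" by (cases p)
      define b where "b = E Z"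
      have b: "b \<in> B" by (simp add: b_def E_range)
      have lt: "k \<in> K" "Z \<in> Al k" "letters (lft us)" "letters (lft vs)"
        using Cons.prems by (auto simp: p)
      have bA: "eps b 1 \<in> Al m" if "m \<in> K" for m
        using Al_closed(4)[OF that b] .
      have Zb: "Z - eps b 1 \<in> Al k"
        using lt bA Al_closed(2) by blast
      have "E (eps b 1) = b"
        using E_bimodule[OF b, of 1 1] E_one eps_one subalgebraD(2)[OF B] by simp
      then have "agree (lft ((us @ [(k, Z - eps b 1)]) @ vs))"
        using Cons.prems lt Zb by (intro Cons.IH) (auto simp: p b_def E.diff)
      then have 1: "agree (lft us @ (k, Lft, Z - eps b 1) # lft vs)" by simp
      have 2: "agree (lft us @ (k, Lft, eps b 1) # lft vs)"
      proof (cases vs)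
        case (Cons p' vs')
        obtain m Y where p': "p' = (m, Y)" by (cases p')
        have m: "m \<in> K" "Y \<in> Al m" "letters (lft vs')"
          using lt(4) by (auto simp: Cons p')
        \<comment> \<open>The scalar takes the index m of the letter on its right and is multiplied
          into it. The shorter word may fail to alternate, which the outer hypothesis
          allows.\<close>
        have "agree (lft (us @ (m, eps b 1 * Y) # vs'))"
          using lt m bA Al_closed(3)[OF m(1)] Cons.prems(1)
          by (intro less.hyps) (auto simp: Cons p' p)
        then have "agree (lft us @ (m, Lft, eps b 1) # lft vs)"
          using agree_merge[OF lt(3) m(3,1) bA[OF m(1)] m(2)] by (simp add: Cons p')
        then show ?thesis
          by (rule agree_scalar[OF lt(3,4,1) m(1) b])
      next
        case Nil
        note vs = this
        show ?thesis
        proof (cases us rule: rev_cases)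
          case Nil
          then show ?thesis
            using agree_single[OF lt(1) bA[OF lt(1)]] vs by simp
        next
          case (snoc us' p')
          obtain m Y where p': "p' = (m, Y)" by (cases p')
          have m: "m \<in> K" "Y \<in> Al m" "letters (lft us')"
            using lt(3) by (auto simp: snoc p')
          \<comment> \<open>The last letter has no right neighbour, so the scalar is absorbed from
            the right by the letter before it.\<close>
          have "agree (lft (us' @ [(m, Y * eps b 1)]))"
            using lt m bA Al_closed(3)[OF m(1)] Cons.prems(1)
            by (intro less.hyps) (auto simp: snoc p' p vs)
          then have "agree (lft us @ (m, Lft, eps b 1) # lft vs)"
            using agree_merge[OF m(3) _ m(1,2) bA[OF m(1)], of "[]"] by (simp add: snoc p' vs)
          then show ?thesis
            by (rule agree_scalar[OF lt(3,4,1) m(1) b])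
        qed
      qed
      show ?case
        using agree_split[OF lt(3,4,1) Zb bA[OF lt(1)] 1 2] by (simp add: p)
    qed
    from this[of "[]" Xs] show ?thesis
      using less.prems adj by simp
  qed
qed

lemma act_vec_right:
  assumes m: "m \<in> K" "Y \<in> Ar m" and Xs: "letters (lft Xs)" and Ys: "letters Ys"
  shows "act (m, Rgt, Y) (vec (lft Xs @ Ys)) = vec (lft Xs @ (m, Rgt, Y) # Ys)"
  using Xs
proof (induction Xs)
  case Nil
  then show ?case using m Ys by (simp add: vec_Cons)
next
  case (Cons p Xs)
  obtain k Z where p: "p = (k, Z)" by (cases p)
  have lt: "k \<in> K" "Z \<in> Al k" "letters (lft Xs)"
    using Cons.prems by (auto simp: p)
  have "vec (lft (p # Xs) @ (m, Rgt, Y) # Ys) = act (k, Lft, Z) (act (m, Rgt, Y) (vec (lft Xs @ Ys)))"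
    using lt m Ys Cons.IH[OF lt(3)] by (simp add: p vec_Cons)
  also have "\<dots> = act (m, Rgt, Y) (act (k, Lft, Z) (vec (lft Xs @ Ys)))"
    using lt m Ys lr_commute by (intro act_commute vec_closed) auto
  finally show ?case
    using lt Ys by (simp add: p vec_Cons)
qed

text \<open>At the vacuum both operators act inside the embedded copy of X_k, where left and right
  embeddings coincide, so equality of the two vectors in X_k is enough.\<close>

lemma vec_partner:
  assumes "k \<in> K" "Y \<in> Ar k" "Z \<in> Al k" "r k Y (vac k) = l k Z (vac k)"
  shows "vec [(k, Rgt, Y)] = vec [(k, Lft, Z)]"
proof -
  have "vec [(k, Rgt, Y)] = right_op k (r k Y) (suffix_vec k [] (vac k))"
    using assms suffix_vec_Nil[OF assms(1), of 1] by (simp add: vec_Cons vec_Nil act_def)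
  also have "\<dots> = suffix_vec k [] (r k Y (vac k))"
    using assms by (intro right_op_suffix_vec r_op) auto
  finally show ?thesis
    using assms vec_single[OF assms(1,3)] by (simp add: suffix_vec_def prefix_vec_def)
qed

lemma wprod_move:
  assumes "m \<in> K" "Y \<in> Ar m" "letters (lft Xs)"
  shows "Y * wprod (lft Xs) = wprod (lft Xs) * Y"
  using assms(3)
proof (induction Xs)
  case (Cons p Xs)
  obtain k Z where p: "p = (k, Z)" by (cases p)
  have lt: "k \<in> K" "Z \<in> Al k" "letters (lft Xs)"
    using Cons.prems by (auto simp: p)
  have "Y * (Z * wprod (lft Xs)) = Z * (Y * wprod (lft Xs))"
    using commute[OF lt(1) assms(1) lt(2) assms(2)] by (simp flip: mult.assoc)
  then show ?case
    using Cons.IH[OF lt(3)] by (simp add: p mult.assoc)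
qed simp

lemma lft_obtain:
  assumes "\<forall>z\<in>set Zs. fst (snd z) \<noteq> Rgt"
  obtains Xs where "Zs = lft Xs"
proof -
  have "\<exists>Xs. Zs = lft Xs"
    using assms
  proof (induction Zs)
    case Nil
    then show ?case by (metis lft_simps(1))
  next
    case (Cons z Zs)
    then obtain Xs where "Zs = lft Xs" by auto
    moreover obtain k Z where "z = (k, Lft, Z)"
      using Cons.prems by (cases z; cases "fst (snd z)") auto
    ultimately have "z # Zs = lft ((k, Z) # Xs)" by simp
    then show ?case by blast
  qed
  then show ?thesis using that by blast
qed

text \<open>Induction on the number of right letters. Replacing one of them by its partner changes
  neither side of the claim and lowers that number.\<close>

lemma agree_letters: "letters Zs \<Longrightarrow> agree Zs"
proof (induction "length (filter (\<lambda>z. fst (snd z) = Rgt) Zs)" arbitrary: Zs)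
  case 0
  then have "\<forall>z\<in>set Zs. fst (snd z) \<noteq> Rgt"
    by (simp add: filter_empty_conv)
  then obtain Xs where "Zs = lft Xs"
    by (rule lft_obtain)
  then show ?case using agree_left 0 by simp
next
  case (Suc n)
  have "\<exists>z\<in>set Zs. fst (snd z) = Rgt"
  proof (rule ccontr)
    assume "\<not> ?thesis"
    then have "filter (\<lambda>z. fst (snd z) = Rgt) Zs = []"
      by (simp add: filter_empty_conv)
    then show False using Suc.hyps(2) by simp
  qed
  \<comment> \<open>The last right letter is taken: only left letters follow it, so it can be moved
    to the end, next to the vacuum. The prefix us may still contain right letters.\<close>
  then obtain us z vs where Zs: "Zs = us @ z # vs" "fst (snd z) = Rgt" "\<forall>z\<in>set vs. fst (snd z) \<noteq> Rgt"
    by (rule split_list_last_propE)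
  obtain k Y where z: "z = (k, Rgt, Y)" using Zs(2) by (cases z) auto
  obtain Xs where vs: "vs = lft Xs"
    using Zs(3) by (rule lft_obtain)
  have lt: "letters us" "k \<in> K" "Y \<in> Ar k" "letters (lft Xs)"
    using Suc.prems by (auto simp: Zs z vs)
  obtain Z where Z: "Z \<in> Al k" "\<And>W. E (W * Y) = E (W * Z)" "\<And>W. F (W * Y) = F (W * Z)"
      "r k Y (vac k) = l k Z (vac k)"
    using partner[OF lt(2,3)] by blast
  let ?Ys = "us @ lft (Xs @ [(k, Z)])"
  have "vec (z # vs) = vec (lft Xs @ [(k, Rgt, Y)])"
    using act_vec_right[OF lt(2,3,4), of "[]"] lt by (simp add: z vs vec_Cons)
  also have "\<dots> = vec (lft Xs @ [(k, Lft, Z)])"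
    using lt Z by (intro vec_append_cong vec_partner) auto
  finally have v: "vec (us @ z # vs) = vec ?Ys"
    using lt Z by (intro vec_append_cong) (auto simp: z vs)
  \<comment> \<open>In A the letter is moved to the end as well. All remaining letters then form the
    left factor W for which the partner property is used.\<close>
  have "wprod (us @ z # vs) = wprod (us @ lft Xs) * Y"
    using wprod_move[OF lt(2,3,4)] by (simp add: z vs mult.assoc)
  moreover have "wprod ?Ys = wprod (us @ lft Xs) * Z"
    by (simp add: mult.assoc)
  ultimately have "E (wprod Zs) = E (wprod ?Ys)" "F (wprod Zs) = F (wprod ?Ys)"
    using Z(2,3) by (simp_all only: Zs(1))
  moreover have "agree ?Ys"
  proof (rule Suc.hyps(1))
    have "filter (\<lambda>z. fst (snd z) = Rgt) (lft Xs) = []" for Xs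
      by (auto simp: lft_def filter_empty_conv)
    then show "n = length (filter (\<lambda>z. fst (snd z) = Rgt) ?Ys)"
      using Suc.hyps(2) by (simp add: Zs z vs)
  qed (use lt Z in auto)
  ultimately show ?case
    using v agree_cong by (simp only: Zs(1))
qed

end

section \<open>The standard representation\<close>

context two_expectation_space
begin

interpretation E: Vector_Spaces.linear scaleC scaleC E by (rule E_linear)
interpretation F: Vector_Spaces.linear scaleC scaleC F by (rule F_linear)

definition null :: "'a set" where
  "null = {Z. \<forall>W. E (W * Z) = 0 \<and> F (W * Z) = 0}"

lemma null_mult: "Z \<in> null \<Longrightarrow> W * Z \<in> null"
  by (auto simp: null_def simp flip: mult.assoc)

lemma null_E_F: "Z \<in> null \<Longrightarrow> E Z = 0 \<and> F Z = 0"
  unfolding null_def by (metis (mono_tags, lifting) mem_Collect_eq mult_1)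

lemma subspace_null: "complex_vector.subspace null"
  by (rule complex_vector.subspaceI)
    (auto simp: null_def distrib_left mult_scaleC_right E.add F.add E.scale F.scale E.zero F.zero)

text \<open>A left inverse of the identity on \<open>null\<close> is a linear retraction g onto it,
  and Z - g Z is a representative of the class of Z that depends on the class only. The quotient
  thus has its elements in \<open>'a\<close>, the universe of the final statement.\<close>

lemma projection_exists:
  obtains \<pi> where "Vector_Spaces.linear scaleC scaleC \<pi>" "\<And>Z. Z - \<pi> Z \<in> null" "\<And>Z. Z \<in> null \<Longrightarrow> \<pi> Z = 0"
proof -
  interpret AA: vector_space_pair "scaleC :: complex \<Rightarrow> 'a \<Rightarrow> 'a" "scaleC :: complex \<Rightarrow> 'a \<Rightarrow> 'a" ..
  have id: "Vector_Spaces.linear scaleC scaleC (\<lambda>x :: 'a. x)"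
    by (rule complex_vector.linear_ident)
  obtain g where g: "range g \<subseteq> null" "Vector_Spaces.linear scaleC scaleC g" "\<forall>v\<in>null. g v = v"
    using AA.linear_exists_left_inverse_on[OF id subspace_null] by auto
  show ?thesis
    by (rule that[of "\<lambda>Z. Z - g Z"]) (use g AA.linear_compose_sub[OF id g(2)] in auto)
qed

end

section \<open>The quotient by the null ideal as a bimodule with a pair of states\<close>

locale standard_model = two_expectation_space B eps E F
  for B :: "'d::complex_algebra_1 set" and eps :: "'d \<Rightarrow> 'd \<Rightarrow> 'a::complex_algebra_1" and E F :: "'a \<Rightarrow> 'd" +
  fixes \<pi> :: "'a \<Rightarrow> 'a"
  assumes \<pi>_linear: "Vector_Spaces.linear scaleC scaleC \<pi>" and \<pi>_diff: "\<And>Z. Z - \<pi> Z \<in> null"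
    and \<pi>_null: "\<And>Z. Z \<in> null \<Longrightarrow> \<pi> Z = 0"
begin

sublocale E: Vector_Spaces.linear scaleC scaleC E by (rule E_linear)
sublocale F: Vector_Spaces.linear scaleC scaleC F by (rule F_linear)
sublocale \<pi>: Vector_Spaces.linear scaleC scaleC \<pi> by (rule \<pi>_linear)

lemma null_cong:
  assumes "Y - Z \<in> null"
  shows "\<pi> Y = \<pi> Z" "E Y = E Z" "F Y = F Z"
  using \<pi>_null[OF assms] null_E_F[OF assms] by (simp_all add: \<pi>.diff E.diff F.diff)

lemma \<pi>_mult: "\<pi> (W * \<pi> Z) = \<pi> (W * Z)" and E_\<pi>: "E (W * \<pi> Z) = E (W * Z)" and F_\<pi>: "F (W * \<pi> Z) = F (W * Z)"
  using null_cong[of "W * Z" "W * \<pi> Z"] null_mult[OF \<pi>_diff, of W Z] by (simp_all add: right_diff_distrib)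

lemma \<pi>_simps [simp]: "\<pi> (\<pi> Z) = \<pi> Z" "E (\<pi> Z) = E Z" "F (\<pi> Z) = F Z"
  using \<pi>_mult[of 1] E_\<pi>[of 1] F_\<pi>[of 1] by simp_all

lemma B_mem [simp]: "0 \<in> B" "1 \<in> B" "b \<in> B \<Longrightarrow> c \<in> B \<Longrightarrow> b + c \<in> B" "b \<in> B \<Longrightarrow> c \<in> B \<Longrightarrow> b * c \<in> B"
  "b \<in> B \<Longrightarrow> z *\<^sub>C b \<in> B" "b \<in> B \<Longrightarrow> c \<in> B \<Longrightarrow> b - c \<in> B"
  by (simp_all add: subalgebraD[OF B_subalgebra])

abbreviation "Lb b \<equiv> eps b 1"
abbreviation "Rb b \<equiv> eps 1 b"

lemma Lb_add: "b \<in> B \<Longrightarrow> c \<in> B \<Longrightarrow> Lb (b + c) = Lb b + Lb c" and Rb_add: "b \<in> B \<Longrightarrow> c \<in> B \<Longrightarrow> Rb (b + c) = Rb b + Rb c"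
  by (simp_all add: eps_add_left eps_add_right)

lemma Lb_mult: "b \<in> B \<Longrightarrow> c \<in> B \<Longrightarrow> Lb (b * c) = Lb b * Lb c" and Rb_mult: "b \<in> B \<Longrightarrow> c \<in> B \<Longrightarrow> Rb (b * c) = Rb c * Rb b"
  and Lb_Rb: "b \<in> B \<Longrightarrow> c \<in> B \<Longrightarrow> Rb c * Lb b = Lb b * Rb c"
  by (simp_all add: eps_mult)

lemma Lb_scalar: "Lb (z *\<^sub>C 1) = z *\<^sub>C 1" and Rb_scalar: "Rb (z *\<^sub>C 1) = z *\<^sub>C 1"
  by (simp_all add: eps_scale_left eps_scale_right eps_one)

lemma E_Lb: "b \<in> B \<Longrightarrow> E (Lb b * Z) = b * E Z" and E_Rb: "b \<in> B \<Longrightarrow> E (Rb b * Z) = E Z * b"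
  and F_Lb: "b \<in> B \<Longrightarrow> F (Lb b * Z) = b * F Z" and F_Rb: "b \<in> B \<Longrightarrow> F (Rb b * Z) = F Z * b"
  using E_bimodule[of b 1 Z] E_bimodule[of 1 b Z] F_bimodule[of b 1 Z] F_bimodule[of 1 b Z] eps_one by simp_all

text \<open>The balancing axioms for E and F hold behind every left factor, which is membership in
  \<open>null\<close>.\<close>

lemma Rb_Lb_null: "b \<in> B \<Longrightarrow> W * Rb b - W * Lb b \<in> null"
  by (simp add: null_def right_diff_distrib E.diff F.diff E_balanced F_balanced flip: mult.assoc)

text \<open>The classes of centred elements, each represented by its fixed point of \<pi>. Both
  actions of B are left multiplications, by L_b and by R_b; since R is an anti-homomorphism, the
  latter is a right action.\<close>

definition M0 :: "('d, 'a) bimod" where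
  "M0 = \<lparr>carrier = {x. \<pi> x = x \<and> E x = 0}, mult = undefined, one = undefined, zero = 0, add = (+),
     lact = (\<lambda>b x. \<pi> (Lb b * x)), ract = (\<lambda>x b. \<pi> (Rb b * x))\<rparr>"

lemma M0_simps [simp]:
  "x \<in> carrier M0 \<longleftrightarrow> \<pi> x = x \<and> E x = 0" "\<zero>\<^bsub>M0\<^esub> = 0" "x \<oplus>\<^bsub>M0\<^esub> y = x + y"
  "lact M0 b x = \<pi> (Lb b * x)" "ract M0 x b = \<pi> (Rb b * x)"
  by (simp_all add: M0_def)

lemma bimodule_M0: "bimodule B M0"
proof -
  have "abelian_group M0"
  proof (rule abelian_groupI)
    fix x assume "x \<in> carrier M0"
    then show "\<exists>y\<in>carrier M0. y \<oplus>\<^bsub>M0\<^esub> x = \<zero>\<^bsub>M0\<^esub>"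
      by (intro bexI[of _ "- x"]) (auto simp: \<pi>.neg E.neg)
  qed (auto simp: \<pi>.add E.add \<pi>.zero E.zero ac_simps)
  moreover have "Rb c * (Lb b * x) = Lb b * (Rb c * x)" if "b \<in> B" "c \<in> B" for b c x
    using Lb_Rb[OF that] by (simp flip: mult.assoc)
  ultimately show ?thesis
    unfolding bimodule_def
    by (auto simp: E_Lb E_Rb \<pi>.add E.add Lb_add Rb_add distrib_left distrib_right Lb_mult Rb_mult mult.assoc
        \<pi>_mult eps_one Lb_scalar Rb_scalar)
qed

abbreviation "X0 \<equiv> B_plus B M0"

text \<open>\<open>repr\<close> and \<open>cls\<close> are the two directions of the decomposition
  of A/N into B and \<open>M0\<close>: a class is recorded by E Z and the projection of Z - L_b with
  b = E Z. They are inverse to each other exactly on the carrier and modulo \<open>null\<close> on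
  A.\<close>

definition repr :: "'d \<times> 'a \<Rightarrow> 'a" where "repr v = Lb (fst v) + snd v"

definition cls :: "'a \<Rightarrow> 'd \<times> 'a" where "cls Z = (E Z, \<pi> (Z - Lb (E Z)))"

lemma E_Lb1: "b \<in> B \<Longrightarrow> E (Lb b) = b" and F_Lb1: "b \<in> B \<Longrightarrow> F (Lb b) = b"
  using E_Lb[of b 1] F_Lb[of b 1] E_one F_one by simp_all

lemma cls_closed: "cls Z \<in> carrier X0"
  by (simp add: cls_def E_range E.diff E_Lb1)

lemma cls_add: "cls (Y + Z) = cls Y \<oplus>\<^bsub>X0\<^esub> cls Z"
  by (simp add: cls_def E.add \<pi>.add \<pi>.diff Lb_add E_range)

lemma cls_cong: "Y - Z \<in> null \<Longrightarrow> cls Y = cls Z"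
  using null_cong[of Y Z] by (simp add: cls_def \<pi>.diff)

lemma cls_repr: "v \<in> carrier X0 \<Longrightarrow> cls (repr v) = v"
  by (cases v) (simp add: cls_def repr_def E.add E_Lb1)

lemma repr_cls: "repr (cls Z) - Z \<in> null"
proof -
  have "repr (cls Z) - Z = - ((Z - Lb (E Z)) - \<pi> (Z - Lb (E Z)))"
    by (simp add: repr_def cls_def)
  then show ?thesis
    using complex_vector.subspace_neg[OF subspace_null \<pi>_diff[of "Z - Lb (E Z)"]] by (simp only:)
qed

lemma cls_mult_repr_cls: "cls (W * repr (cls Z)) = cls (W * Z)"
  using null_mult[OF repr_cls, of W Z] by (intro cls_cong) (simp add: right_diff_distrib)

lemma repr_add: "\<lbrakk>v \<in> carrier X0; w \<in> carrier X0\<rbrakk> \<Longrightarrow> repr (v \<oplus>\<^bsub>X0\<^esub> w) = repr v + repr w"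
  by (cases v, cases w) (simp add: repr_def Lb_add)

lemma lact_X0: "\<lbrakk>b \<in> B; v \<in> carrier X0\<rbrakk> \<Longrightarrow> lact X0 b v = cls (Lb b * repr v)"
  by (cases v) (simp add: repr_def cls_def distrib_left E.add E_Lb E_Lb1 Lb_mult)

text \<open>On the B-component the right action of the direct sum is c \<mapsto> cb, while
  multiplication by R_b gives R_b L_c = L_c R_b. Modulo \<open>null\<close> this is L_c L_b, the
  representative of cb.\<close>

lemma ract_X0:
  assumes "b \<in> B" "v \<in> carrier X0"
  shows "ract X0 v b = cls (Rb b * repr v)"
proof -
  obtain c x where v: "v = (c, x)" "c \<in> B" "\<pi> x = x" "E x = 0" using assms by (cases v) auto
  have "E (Rb b * repr v) = c * b"
    using v assms by (simp add: repr_def distrib_left E.add E_Rb E_Lb1)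
  moreover have "\<pi> (Rb b * Lb c) = \<pi> (Lb (c * b))"
    using null_cong(1)[OF Rb_Lb_null[OF assms(1), of "Lb c"]] v assms by (simp add: Lb_Rb Lb_mult)
  ultimately show ?thesis
    using v by (simp add: cls_def repr_def distrib_left \<pi>.add \<pi>.diff)
qed

text \<open>Left multiplication on A/N, for all of A at once. Commuting with every R_b, respectively
  every L_b, becomes commuting with the right, respectively left, action.\<close>

definition rep :: "'a \<Rightarrow> 'd \<times> 'a \<Rightarrow> 'd \<times> 'a" where "rep Z v = cls (Z * repr v)"

lemma rep_mult: "rep (Y * Z) v = rep Y (rep Z v)"
  by (simp add: rep_def cls_mult_repr_cls mult.assoc)

lemma rep_Lb: "\<lbrakk>b \<in> B; v \<in> carrier X0\<rbrakk> \<Longrightarrow> rep (Lb b) v = lact X0 b v"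
  and rep_Rb: "\<lbrakk>b \<in> B; v \<in> carrier X0\<rbrakk> \<Longrightarrow> rep (Rb b) v = ract X0 v b"
  by (simp_all add: rep_def lact_X0 ract_X0 del: B_plus_simps)

lemma rep_closed: "rep Z v \<in> carrier X0"
  by (simp only: rep_def cls_closed)

lemma rep_operators: "rep Z \<in> operators X0"
proof -
  have "rep Z (lact X0 (z *\<^sub>C 1) v) = lact X0 (z *\<^sub>C 1) (rep Z v)" if "v \<in> carrier X0" for z v
  proof -
    have "Z * Lb (z *\<^sub>C 1) = Lb (z *\<^sub>C 1) * Z"
      by (simp add: Lb_scalar mult_scaleC_left mult_scaleC_right)
    then show ?thesis
      using rep_Lb[of "z *\<^sub>C 1" v] rep_Lb[of "z *\<^sub>C 1" "rep Z v"] that rep_closed by (metis rep_mult B_mem(2,5))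
  qed
  then show ?thesis
    using rep_closed by (simp add: operators_def rep_def repr_add distrib_left cls_add del: B_plus_simps)
qed

lemma rep_left:
  assumes "Z \<in> left_algebra B eps"
  shows "rep Z \<in> left_operators B X0"
proof -
  have "rep Z (ract X0 v b) = ract X0 (rep Z v) b" if "b \<in> B" "v \<in> carrier X0" for b v
  proof -
    have "Z * Rb b = Rb b * Z"
      using assms that by (simp add: left_algebra_def)
    then have "rep Z (rep (Rb b) v) = rep (Rb b) (rep Z v)"
      by (simp only: rep_mult[symmetric])
    then show ?thesis
      by (simp only: rep_Rb[OF that] rep_Rb[OF that(1) rep_closed])
  qed
  then show ?thesis
    using rep_operators by (simp add: left_operators_def del: B_plus_simps)
qed

lemma rep_right:
  assumes "Z \<in> right_algebra B eps"
  shows "rep Z \<in> right_operators B X0"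
proof -
  have "rep Z (lact X0 b v) = lact X0 b (rep Z v)" if "b \<in> B" "v \<in> carrier X0" for b v
  proof -
    have "Z * Lb b = Lb b * Z"
      using assms that by (simp add: right_algebra_def)
    then have "rep Z (rep (Lb b) v) = rep (Lb b) (rep Z v)"
      by (simp only: rep_mult[symmetric])
    then show ?thesis
      by (simp only: rep_Lb[OF that] rep_Lb[OF that(1) rep_closed])
  qed
  then show ?thesis
    using rep_operators by (simp add: right_operators_def del: B_plus_simps)
qed

lemma rep_unital:
  assumes "\<And>Z. Z \<in> A \<Longrightarrow> rep Z \<in> Ops"
  shows "unital_representation A X0 Ops rep"
proof -
  have "rep (z *\<^sub>C Z) v = lact X0 (z *\<^sub>C 1) (rep Z v)" for z Z v
  proof -
    have "z *\<^sub>C Z = Lb (z *\<^sub>C 1) * Z"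
      by (simp add: Lb_scalar mult_scaleC_left)
    then show ?thesis
      using rep_Lb[of "z *\<^sub>C 1" "rep Z v"] rep_closed by (simp add: rep_mult del: B_plus_simps)
  qed
  then show ?thesis
    using assms by (auto simp: unital_representation_def rep_mult rep_def[of 1] cls_repr simp del: B_plus_simps)
      (simp add: rep_def distrib_right cls_add del: B_plus_simps)
qed

definition q0 :: "'d \<times> 'a \<Rightarrow> 'd" where "q0 v = F (repr v)"

lemma q0_cls: "q0 (cls Z) = F Z"
  using null_cong(3)[OF repr_cls] by (simp add: q0_def)

lemma is_state_q0: "is_state B M0 q0"
proof -
  have "q0 (lact X0 (z *\<^sub>C 1) v) = z *\<^sub>C q0 v" if "v \<in> carrier X0" for z v
  proof -
    have "q0 (lact X0 (z *\<^sub>C 1) v) = F (z *\<^sub>C repr v)"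
      using that by (simp add: lact_X0 q0_cls Lb_scalar mult_scaleC_left del: B_plus_simps)
    then show ?thesis
      by (simp add: q0_def F.scale)
  qed
  moreover have "q0 (1, \<zero>\<^bsub>M0\<^esub>) = 1"
    by (simp add: q0_def repr_def eps_one F_one)
  ultimately show ?thesis
    unfolding is_state_def Let_def
    by (simp add: lact_X0 ract_X0 q0_cls F_Lb F_Rb del: B_plus_simps)
      (simp add: q0_def repr_add F.add del: B_plus_simps)
qed

lemma rep_vacuum: "rep Z (1, \<zero>\<^bsub>M0\<^esub>) = cls Z"
  by (simp add: rep_def repr_def eps_one)

text \<open>One space with one action serves every index; the indices are kept apart by the free
  product alone. Commutation of \<open>rep Z\<close> and \<open>rep Y\<close> on it is hypothesis
  (1) for a single index.\<close>

lemma c_bi_free_standard: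
  fixes K :: "'k set" and Al Ar :: "'k \<Rightarrow> 'a set"
  assumes pairs: "\<And>k. k \<in> K \<Longrightarrow> pair_of_B_algebras B eps (Al k) (Ar k)"
    and commute: "\<And>m n Z Y. \<lbrakk>m \<in> K; n \<in> K; Z \<in> Al m; Y \<in> Ar n\<rbrakk> \<Longrightarrow> Z * Y = Y * Z"
    and partner: "\<And>k Y. \<lbrakk>k \<in> K; Y \<in> Ar k\<rbrakk> \<Longrightarrow> \<exists>Z\<in>Al k. \<forall>W. E (W * Y) = E (W * Z) \<and> F (W * Y) = F (W * Z)"
    and free: "c_free_left E F K Al"
  shows "c_bi_free TYPE('a) B E F K Al Ar"
proof -
  have Al: "unital_representation (Al k) X0 (left_operators B X0) rep" if "k \<in> K" for k
    using pairs[OF that] rep_left by (intro rep_unital) (auto simp: pair_of_B_algebras_def)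
  have Ar: "unital_representation (Ar k) X0 (right_operators B X0) rep" if "k \<in> K" for k
    using pairs[OF that] rep_right by (intro rep_unital) (auto simp: pair_of_B_algebras_def)
  have lr: "rep Z (rep Y v) = rep Y (rep Z v)" if "k \<in> K" "Z \<in> Al k" "Y \<in> Ar k" for k Y Z v
    by (simp only: rep_mult[symmetric] commute[OF that(1,1,2,3)])
  interpret matched_family B K "\<lambda>_. M0" "\<lambda>_. q0" "\<lambda>_. rep" "\<lambda>_. rep" Al Ar eps E F
  proof (unfold_locales, goal_cases)
    \<comment> \<open>Hypothesis (2) puts Y - Z into \<open>null\<close>, so both have the same
      class, and the class is the vector to which they send the vacuum.\<close>
    case (12 k Y)
    then obtain Z where Z: "Z \<in> Al k" "\<And>W. E (W * Y) = E (W * Z) \<and> F (W * Y) = F (W * Z)"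
      using partner by blast
    then have "Y - Z \<in> null"
      by (simp add: null_def right_diff_distrib E.diff F.diff)
    then show ?case
      using Z cls_cong unfolding rep_vacuum by blast
  qed (use B_subalgebra bimodule_M0 is_state_q0 Al Ar pairs commute lr free rep_Lb rep_vacuum q0_cls in
      \<open>simp_all add: cls_def del: B_plus_simps\<close>)
  show ?thesis
    unfolding c_bi_free_def
    using agree_letters bimodule_M0 is_state_q0 Al Ar unfolding agree_def letters_def
    by (intro exI[of _ "\<lambda>_. M0"] exI[of _ "\<lambda>_. q0"] exI[of _ "\<lambda>_. rep"] conjI allI ballI impI) blast+
qed

end

text \<open>Each right factor is traded for its left partner, which moves to the front; so the order is reversed.\<close>

lemma partner_reversal:
  fixes G :: "'a::monoid_mult \<Rightarrow> 'd"
  assumes "\<forall>(Y, Z)\<in>set Ps. \<forall>W. G (W * Y) = G (W * Z)"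
    and "\<forall>(Y, Z)\<in>set Ps. \<forall>(Y', Z')\<in>set Ps. Y * Z' = Z' * Y"
  shows "G (W * prod_list (map fst Ps)) = G (W * prod_list (map snd (rev Ps)))"
  using assms
proof (induction Ps arbitrary: W rule: rev_induct)
  case (snoc p Ps)
  obtain Y Z where p: "p = (Y, Z)" by (cases p)
  have comm: "prod_list (map fst Ps) * Z = Z * prod_list (map fst Ps)"
    if "\<forall>(Y, Z')\<in>set Ps. Y * Z = Z * Y" for Ps :: "('a \<times> 'a) list"
    using that by (induction Ps) (auto simp: mult.assoc, simp flip: mult.assoc)
  have "G (W * prod_list (map fst (Ps @ [p]))) = G ((W * prod_list (map fst Ps)) * Z)"
    using snoc.prems(1) by (simp add: p flip: mult.assoc)
  \<comment> \<open>The partner Z of the last factor passes all earlier right factors. Afterwards W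
    * Z is the left factor of the shorter product, hence the induction over arbitrary W.\<close>
  also have "\<dots> = G ((W * Z) * prod_list (map fst Ps))"
  proof -
    have "\<forall>(Y', Z')\<in>set Ps. Y' * Z = Z * Y'"
      using snoc.prems(2) by (fastforce simp: p)
    from comm[OF this] show ?thesis
      by (simp add: mult.assoc)
  qed
  also have "\<dots> = G ((W * Z) * prod_list (map snd (rev Ps)))"
    using snoc.prems by (intro snoc.IH) auto
  finally show ?case
    by (simp add: p mult.assoc)
qed simp

text \<open>The left partners in reverse order form a centred alternating word with the same
  moments, and the reversal accounts for the reversed product of the values of F.\<close>

lemma c_free_left_imp_right:
  fixes E F :: "'a::monoid_mult \<Rightarrow> 'd::complex_algebra_1"
  assumes free: "c_free_left E F K Al"
    and commute: "\<And>m n Z Y. \<lbrakk>m \<in> K; n \<in> K; Z \<in> Al m; Y \<in> Ar n\<rbrakk> \<Longrightarrow> Z * Y = Y * Z"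
    and partner: "\<And>k Y. \<lbrakk>k \<in> K; Y \<in> Ar k\<rbrakk> \<Longrightarrow> \<exists>Z\<in>Al k. \<forall>W. E (W * Y) = E (W * Z) \<and> F (W * Y) = F (W * Z)"
  shows "c_free_right E F K Ar"
  unfolding c_free_right_def
proof (intro allI impI)
  fix Ys assume Ys: "centred_alternating E K Ar Ys"
  obtain f where f: "\<And>k Y. \<lbrakk>k \<in> K; Y \<in> Ar k\<rbrakk> \<Longrightarrow> f k Y \<in> Al k \<and>
      (\<forall>W. E (W * Y) = E (W * f k Y) \<and> F (W * Y) = F (W * f k Y))"
    using partner by metis
  \<comment> \<open>The left factor 1 shows that a partner has the same expectations, so it is
    centred too.\<close>
  have f1: "E (f k Y) = E Y" "F (f k Y) = F Y" if "k \<in> K" "Y \<in> Ar k" for k Y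
    using f[OF that] by (metis mult_1)+
  define Ps where "Ps = map (\<lambda>(k, Y). (Y, f k Y)) Ys"
  define Xs where "Xs = rev (map (\<lambda>(k, Y). (k, f k Y)) Ys)"
  have mem: "k \<in> K" "Y \<in> Ar k" "E Y = 0" if "(k, Y) \<in> set Ys" for k Y
    using Ys that by (auto simp: centred_alternating_def)
  have prods: "prod_list (map fst Ps) = prod_list (map snd Ys)"
    "prod_list (map snd (rev Ps)) = prod_list (map snd Xs)"
    by (simp_all add: Ps_def Xs_def rev_map comp_def case_prod_beta)
  have comm: "\<forall>(Y, Z)\<in>set Ps. \<forall>(Y', Z')\<in>set Ps. Y * Z' = Z' * Y"
    using mem f commute by (auto simp: Ps_def) metis
  have "centred_alternating E K Al Xs"
  proof -
    have "map fst Xs = rev (map fst Ys)"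
      by (simp add: Xs_def rev_map comp_def case_prod_beta)
    then have "distinct_adj (map fst Xs)"
      using Ys by (simp only: centred_alternating_def distinct_adj_rev)
    then show ?thesis
      using Ys mem f f1 by (auto simp: centred_alternating_def Xs_def)
  qed
  then have "E (prod_list (map snd Xs)) = 0" "F (prod_list (map snd Xs)) = prod_list (map (\<lambda>(k, Z). F Z) Xs)"
    using free by (auto simp: c_free_left_def)
  moreover have "map (\<lambda>(k, Z). F Z) Xs = rev (map (\<lambda>(k, Y). F Y) Ys)"
    using mem f1 by (auto simp: Xs_def rev_map)
  moreover have "E (prod_list (map snd Ys)) = E (prod_list (map snd Xs))"
      "F (prod_list (map snd Ys)) = F (prod_list (map snd Xs))"
  proof -
    have "\<forall>(Y, Z)\<in>set Ps. \<forall>W. E (W * Y) = E (W * Z)" "\<forall>(Y, Z)\<in>set Ps. \<forall>W. F (W * Y) = F (W * Z)"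
      using mem f by (auto simp: Ps_def)
    from this[THEN partner_reversal, OF comm, of 1]
    show "E (prod_list (map snd Ys)) = E (prod_list (map snd Xs))"
      "F (prod_list (map snd Ys)) = F (prod_list (map snd Xs))"
      by (simp_all add: prods)
  qed
  ultimately show "E (prod_list (map snd Ys)) = 0 \<and>
      F (prod_list (map snd Ys)) = prod_list (rev (map (\<lambda>(k, Y). F Y) Ys))"
    by simp
qed

text \<open>The equivalence is stated in the universe \<open>'a\<close> of the standard model. The
  second conjunct adds an arbitrary universe \<open>'x\<close>, so c-bi-freeness realised in any
  universe implies c-bi-freeness realised in \<open>'a\<close>.\<close>

theorem theorem7p10:
  fixes B :: "'d::complex_algebra_1 set"
    and eps :: "'d \<Rightarrow> 'd \<Rightarrow> 'a::complex_algebra_1"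
    and E F :: "'a \<Rightarrow> 'd"
    and K :: "'k set"
    and Al Ar :: "'k \<Rightarrow> 'a set"
  assumes "two_expectation_space B eps E F"
    and "\<And>k. k \<in> K \<Longrightarrow> pair_of_B_algebras B eps (Al k) (Ar k)"
    and "\<And>m n X Y. \<lbrakk>m \<in> K; n \<in> K; X \<in> Al m; Y \<in> Ar n\<rbrakk> \<Longrightarrow> X * Y = Y * X"
    and "\<And>k Y. \<lbrakk>k \<in> K; Y \<in> Ar k\<rbrakk> \<Longrightarrow>
           \<exists>X\<in>Al k. \<forall>Z. E (Z * Y) = E (Z * X) \<and> F (Z * Y) = F (Z * X)"
  shows "(c_bi_free TYPE('a) B E F K Al Ar \<longleftrightarrow> c_free_left E F K Al) \<and>
         (c_bi_free TYPE('x) B E F K Al Ar \<longrightarrow> c_free_left E F K Al) \<and>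
         (c_free_left E F K Al \<longrightarrow> c_free_right E F K Ar)"
proof -
  interpret two_expectation_space B eps E F by fact
  obtain \<pi> where \<pi>: "Vector_Spaces.linear scaleC scaleC \<pi>" "\<And>Z. Z - \<pi> Z \<in> null"
      "\<And>Z. Z \<in> null \<Longrightarrow> \<pi> Z = 0"
    by (rule projection_exists) (rule that)
  interpret standard_model B eps E F \<pi>
    by (intro standard_model.intro standard_model_axioms.intro two_expectation_space_axioms \<pi>)
  show ?thesis
  proof (intro conjI iffI impI)
    show "c_free_left E F K Al" if "c_bi_free TYPE('a) B E F K Al Ar"
      using that by (rule c_bi_free_imp_c_free_left[OF B_subalgebra])
    show "c_free_left E F K Al" if "c_bi_free TYPE('x) B E F K Al Ar"
      using that by (rule c_bi_free_imp_c_free_left[OF B_subalgebra])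
    show "c_bi_free TYPE('a) B E F K Al Ar" "c_free_right E F K Ar" if "c_free_left E F K Al"
      using c_bi_free_standard[OF assms(2-4) that] c_free_left_imp_right[OF that assms(3,4)] by auto
  qed
qed

end
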